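(* Let $\alpha\in[1,2]$ and let $L_{\alpha+1}$ satisfy Hypothesis 1 (see context). Let $0<T<1$, let $N_1,N_2\ge1$ be dyadic numbers, let $f_1,f_2\in L^\infty(]0,T[;L^2(\mathbb{T}))$, and let $a\in L^\infty(\mathbb{R}^2)$ with $\|a\|_{L^\infty}\lesssim1$. Let $u_1,u_2\in C([0,T];L^2(\mathbb{T}))$ satisfy $$\partial_t u_j+L_{\alpha+1}u_j+\partial_x f_j=0\quad\text{on } ]0,T[\times\mathbb{T},\qquad j=1,2.$$ Then $$\|\Lambda_a(P_{N_1}u_1,P_{N_2}u_2)\|_{L^2_{T,x}}\lesssim T^{-\frac14}(N_1\vee N_2)^{\frac12-\frac{\alpha}{4}}\big(\|P_{N_1}u_1\|_{L^2_{T,x}}+\|P_{N_1}f_1\|_{L^2_{T,x}}\big)\big(\|P_{N_2}u_2\|_{L^\infty_TL^2_x}+\|P_{N_2}f_2\|_{L^\infty_TL^2_x}\big),$$ where the implicit constant is independent of $T,N_1,N_2,u_1,u_2,f_1,f_2$ (it depends only on $L_{\alpha+1}$ and on the bound for $\|a\|_{L^\infty}$).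
   Context: $\mathbb{T}=\mathbb{R}/2\pi\mathbb{Z}$; $a\vee b=\max\{a,b\}$; $\hat u$ is the Fourier transform in $x$ ($\xi\in\mathbb{Z}$); $L^p_TL^2_x=L^p([0,T];L^2(\mathbb{T}))$, $L^2_{T,x}=L^2_TL^2_x$. $X\lesssim Y$ means $X\le CY$ with a constant $C>0$. Hypothesis 1 (on $L_{\alpha+1}$): $L_{\alpha+1}$ is the Fourier multiplier operator (in $x$) with symbol $-ip_{\alpha+1}(\xi)$, where $p_{\alpha+1}\in C^1(\mathbb{R})\cap C^2(\mathbb{R}\setminus\{0\})$ is a real-valued odd function such that for some $\xi_0>0$, $p_{\alpha+1}'(\xi)\sim\xi^{\alpha}$ and $p_{\alpha+1}''(\xi)\sim\xi^{\alpha-1}$ for all $\xi\ge\xi_0$ (where $a\sim b$ means $c\,b\le a\le C\,b$ with positive constants $c,C$). Frequency projectors: fix an even $\chi\in C_0^\infty(\mathbb{R})$ with $0\le\chi\le1$, $\chi=1$ on $[-1,1]$, $\operatorname{supp}\chi\subset[-2,2]$; $\phi(\xi)=\chi(\xi)-\chi(2\xi)$, $\phi_N(\xi)=\phi(\xi/N)$ for $N=2^l$, $l\in\mathbb{N}=\{0,1,2,\dots\}$. Dyadic numbers $N\ge1$ are the numbers $2^l$, $l\in\mathbb{N}$, and $\widehat{P_Nu}=\phi_N\hat u$. Bilinear multiplier: for $u,v\in L^2(\mathbb{T})$ and $a\in L^\infty(\mathbb{R}^2)$ (understood as a bounded function, $\|a\|_{L^\infty}$ being its supremum, since only its values at integer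 points are used), $$\widehat{\Lambda_a(u,v)}(\xi)=\sum_{\xi_1+\xi_2=\xi}a(\xi_1,\xi_2)\hat u(\xi_1)\hat v(\xi_2).$$ For time-dependent functions $\Lambda_a$ acts at each fixed time. *)

theory Defs
  imports "HOL-Probability.Essential_Supremum"
begin

text \<open>
  Functions on the torus \<open>\<real>/2\<pi>\<int>\<close> are represented by their values on the fundamental domain
  \<open>[0,2\<pi>[\<close>, and elements of \<open>L\<^sup>2\<close> by square-integrable representatives. Everything below depends
  on the representative only up to null sets. Functions are complex-valued; real-valued functions
  are the special case of values in \<open>\<real>\<close>.
\<close>

abbreviation torus :: "real measure" where
  "torus \<equiv> lebesgue_on {0..<2*pi}"

definition ennsqrt :: "ennreal \<Rightarrow> ennreal" where
  "ennsqrt x = (if x = top then top else ennreal (sqrt (enn2real x)))"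

definition L2norm :: "(real \<Rightarrow> complex) \<Rightarrow> ennreal" where
  "L2norm u = ennsqrt (\<integral>\<^sup>+x. ennreal ((cmod (u x))\<^sup>2) \<partial>torus)"

definition memL2 :: "(real \<Rightarrow> complex) \<Rightarrow> bool" where
  "memL2 u \<longleftrightarrow> u \<in> borel_measurable torus \<and> L2norm u < top"

text \<open>Normalised so that \<open>u = \<Sum>\<^sub>\<xi> fourier u \<xi> e\<^bsup>i\<xi>x\<^esup>\<close>.\<close>

definition fourier :: "(real \<Rightarrow> complex) \<Rightarrow> int \<Rightarrow> complex" where
  "fourier u \<xi> = complex_of_real (1 / (2*pi)) * (LINT x|torus. u x * cis (- (of_int \<xi> * x)))"

text \<open>
  The inverse transform. It is only applied to finitely supported sequences \<open>c\<close>, for which the sum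
  is a trigonometric polynomial.
\<close>

definition inv_fourier :: "(int \<Rightarrow> complex) \<Rightarrow> real \<Rightarrow> complex" where
  "inv_fourier c x = (\<Sum>\<^sub>\<infinity>\<xi>. c \<xi> * cis (of_int \<xi> * x))"

definition cutoff :: "(real \<Rightarrow> real) \<Rightarrow> bool" where
  "cutoff \<eta> \<longleftrightarrow>
     (\<forall>n. \<forall>x. (deriv ^^ n) \<eta> differentiable (at x)) \<and>
     (\<forall>x. \<eta> (- x) = \<eta> x) \<and>
     (\<forall>x. 0 \<le> \<eta> x \<and> \<eta> x \<le> 1) \<and>
     (\<forall>x\<in>{-1..1}. \<eta> x = 1) \<and>
     closure {x. \<eta> x \<noteq> 0} \<subseteq> {-2..2}"

definition dyadic :: "real \<Rightarrow> bool" where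
  "dyadic N \<longleftrightarrow> (\<exists>l::nat. N = 2 ^ l)"

definition phi :: "(real \<Rightarrow> real) \<Rightarrow> real \<Rightarrow> real \<Rightarrow> real" where
  "phi \<eta> N \<xi> = \<eta> (\<xi> / N) - \<eta> (2 * (\<xi> / N))"

definition proj :: "(real \<Rightarrow> real) \<Rightarrow> real \<Rightarrow> (real \<Rightarrow> complex) \<Rightarrow> real \<Rightarrow> complex" where
  "proj \<eta> N u = inv_fourier (\<lambda>\<xi>. complex_of_real (phi \<eta> N (of_int \<xi>)) * fourier u \<xi>)"

text \<open>
  For general \<open>u, v \<in> L\<^sup>2\<close> the sum over \<open>\<xi>\<^sub>1\<close> converges absolutely, but \<open>\<Lambda>\<^sub>a(u,v)\<close> is merely a
  distribution. If \<open>u\<close> and \<open>v\<close> are trigonometric polynomials, then so is \<open>\<Lambda>\<^sub>a(u,v)\<close>; this is the only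
  case in which \<open>Lam\<close> is used.
\<close>

definition Lam_hat ::
  "(real \<Rightarrow> real \<Rightarrow> complex) \<Rightarrow> (real \<Rightarrow> complex) \<Rightarrow> (real \<Rightarrow> complex) \<Rightarrow> int \<Rightarrow> complex" where
  "Lam_hat a u v \<xi> =
     (\<Sum>\<^sub>\<infinity>\<xi>\<^sub>1. a (of_int \<xi>\<^sub>1) (of_int (\<xi> - \<xi>\<^sub>1)) * fourier u \<xi>\<^sub>1 * fourier v (\<xi> - \<xi>\<^sub>1))"

definition Lam ::
  "(real \<Rightarrow> real \<Rightarrow> complex) \<Rightarrow> (real \<Rightarrow> complex) \<Rightarrow> (real \<Rightarrow> complex) \<Rightarrow> real \<Rightarrow> complex" where
  "Lam a u v = inv_fourier (Lam_hat a u v)"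

abbreviation time :: "real \<Rightarrow> real measure" where
  "time T \<equiv> lebesgue_on {0<..<T}"

definition L2TL2norm :: "real \<Rightarrow> (real \<Rightarrow> real \<Rightarrow> complex) \<Rightarrow> ennreal" where
  "L2TL2norm T w = ennsqrt (\<integral>\<^sup>+t. (L2norm (w t))\<^sup>2 \<partial>time T)"

definition LinfTL2norm :: "real \<Rightarrow> (real \<Rightarrow> real \<Rightarrow> complex) \<Rightarrow> ennreal" where
  "LinfTL2norm T w = esssup (time T) (\<lambda>t. L2norm (w t))"

text \<open>Bochner measurability: almost everywhere limit in \<open>L\<^sup>2\<close> of simple functions.\<close>

definition strongly_measurable_L2 :: "real \<Rightarrow> (real \<Rightarrow> real \<Rightarrow> complex) \<Rightarrow> bool" where
  "strongly_measurable_L2 T f \<longleftrightarrow>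
     (\<exists>s :: nat \<Rightarrow> real \<Rightarrow> real \<Rightarrow> complex.
        (\<forall>n. simple_function (time T) (s n) \<and> (\<forall>t\<in>{0<..<T}. memL2 (s n t))) \<and>
        (AE t in time T. (\<lambda>n. L2norm (\<lambda>x. s n t x - f t x)) \<longlonglongrightarrow> 0))"

definition memLinfTL2 :: "real \<Rightarrow> (real \<Rightarrow> real \<Rightarrow> complex) \<Rightarrow> bool" where
  "memLinfTL2 T f \<longleftrightarrow>
     (\<forall>t\<in>{0<..<T}. memL2 (f t)) \<and> strongly_measurable_L2 T f \<and> LinfTL2norm T f < top"

definition memCTL2 :: "real \<Rightarrow> (real \<Rightarrow> real \<Rightarrow> complex) \<Rightarrow> bool" where
  "memCTL2 T u \<longleftrightarrow>
     (\<forall>t\<in>{0..T}. memL2 (u t) \<and>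
        ((\<lambda>s. L2norm (\<lambda>x. u s x - u t x)) \<longlongrightarrow> 0) (at t within {0..T}))"

definition comparable_on :: "real set \<Rightarrow> (real \<Rightarrow> real) \<Rightarrow> (real \<Rightarrow> real) \<Rightarrow> bool" where
  "comparable_on S f g \<longleftrightarrow> (\<exists>c>0. \<exists>C>0. \<forall>\<xi>\<in>S. c * g \<xi> \<le> f \<xi> \<and> f \<xi> \<le> C * g \<xi>)"

definition dispersive_symbol :: "real \<Rightarrow> (real \<Rightarrow> real) \<Rightarrow> bool" where
  "dispersive_symbol \<alpha> p \<longleftrightarrow>
     (\<forall>\<xi>. p differentiable (at \<xi>)) \<and> continuous_on UNIV (deriv p) \<and>
     (\<forall>\<xi>. \<xi> \<noteq> 0 \<longrightarrow> deriv p differentiable (at \<xi>)) \<and> continuous_on (- {0}) (deriv (deriv p)) \<and>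
     (\<forall>\<xi>. p (- \<xi>) = - p \<xi>) \<and>
     (\<exists>\<xi>\<^sub>0>0. comparable_on {\<xi>\<^sub>0..} (deriv p) (\<lambda>\<xi>. \<xi> powr \<alpha>) \<and>
             comparable_on {\<xi>\<^sub>0..} (deriv (deriv p)) (\<lambda>\<xi>. \<xi> powr (\<alpha> - 1)))"

text \<open>
  \<open>D 0 0\<close> is a test function on \<open>]0,T[ \<times> \<real>/2\<pi>\<int>\<close>, i.e. smooth, \<open>2\<pi>\<close>-periodic in \<open>x\<close> and compactly
  supported in time, and \<open>D m n\<close> is its derivative of order \<open>m\<close> in \<open>t\<close> and \<open>n\<close> in \<open>x\<close>.
\<close>

definition test_function :: "real \<Rightarrow> (nat \<Rightarrow> nat \<Rightarrow> real \<Rightarrow> real \<Rightarrow> complex) \<Rightarrow> bool" where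
  "test_function T D \<longleftrightarrow>
     (\<forall>m n. continuous_on UNIV (\<lambda>(t, x). D m n t x) \<and>
        (\<forall>t x. ((\<lambda>s. D m n s x) has_vector_derivative D (Suc m) n t x) (at t) \<and>
               ((\<lambda>y. D m n t y) has_vector_derivative D m (Suc n) t x) (at x))) \<and>
     (\<forall>t x. D 0 0 t (x + 2*pi) = D 0 0 t x) \<and>
     (\<exists>a b. 0 < a \<and> b < T \<and> (\<forall>t x. t \<notin> {a..b} \<longrightarrow> D 0 0 t x = 0))"

text \<open>
  The pairing of the periodic distribution with Fourier coefficients \<open>c\<close> (of polynomial growth) with
  a smooth function; if \<open>c = fourier u\<close> for some \<open>u \<in> L\<^sup>2\<close>, it equals \<open>\<integral> u \<psi>\<close> over one period.
\<close>

definition dist_pairing :: "(int \<Rightarrow> complex) \<Rightarrow> (real \<Rightarrow> complex) \<Rightarrow> complex" where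
  "dist_pairing c \<psi> = complex_of_real (2*pi) * (\<Sum>\<^sub>\<infinity>\<xi>. c \<xi> * fourier \<psi> (- \<xi>))"

definition L_hat :: "(real \<Rightarrow> real) \<Rightarrow> (real \<Rightarrow> complex) \<Rightarrow> int \<Rightarrow> complex" where
  "L_hat p u \<xi> = - \<i> * complex_of_real (p (of_int \<xi>)) * fourier u \<xi>"

text \<open>\<open>\<partial>\<^sub>t u + L u + \<partial>\<^sub>x f = 0\<close> in the sense of distributions on \<open>]0,T[ \<times> \<real>/2\<pi>\<int>\<close>.\<close>

definition solves ::
  "(real \<Rightarrow> real) \<Rightarrow> real \<Rightarrow> (real \<Rightarrow> real \<Rightarrow> complex) \<Rightarrow> (real \<Rightarrow> real \<Rightarrow> complex) \<Rightarrow> bool" where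
  "solves p T u f \<longleftrightarrow>
     (\<forall>D. test_function T D \<longrightarrow>
        - (LINT t|time T. (LINT x|torus. u t x * D 1 0 t x))
        + (LINT t|time T. dist_pairing (L_hat p (u t)) (D 0 0 t))
        - (LINT t|time T. (LINT x|torus. f t x * D 0 1 t x)) = 0)"

end

theory Submission
  imports Defs
begin

text \<open>
  Let \<open>N = N\<^sub>1 \<or> N\<^sub>2\<close>, \<open>Q = T\<^bsup>-1/2\<^esup>N\<^bsup>1-\<alpha>/2\<^esup> \<ge> 1\<close> and \<open>h(n) = p(n) + p(\<xi>-n)\<close>. An output mode \<open>|\<xi>| < Q\<close> is
  bounded by the Cauchy-Schwarz inequality, and there are \<open>O(Q)\<close> of them. If \<open>|\<xi>| \<ge> Q\<close>, then every
  interval of length \<open>N/T\<close> contains \<open>O(Q)\<close> of the values \<open>h(n)\<close>: this follows from \<open>h'' \<ge> cN\<^bsup>\<alpha>-1\<^esup>\<close> if \<open>n\<close> and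
  \<open>\<xi>-n\<close> have the same sign, and from \<open>|h'| \<ge> cN\<^bsup>\<alpha>-1\<^esup>|\<xi>|\<close> if they have opposite signs. Hence a large sieve
  inequality on time intervals of length \<open>T/N\<close> loses only a factor \<open>Q\<close>. On such an interval the
  Fourier coefficients of \<open>u\<^sub>j\<close>, multiplied by \<open>e\<^bsup>-itp(n)\<^esup>\<close>, vary by at most \<open>O(T)\<close> times the size of \<open>f\<^sub>j\<close>, because their time
  derivative is \<open>-in\<close> times the corresponding coefficient of \<open>f\<^sub>j\<close> and \<open>|n| \<le> 2N\<close>.
\<close>

section \<open>Counting resonances\<close>

text \<open>The size of Q is dictated by the count. As N/T = N^(\<alpha>-1) Q^2, two resonances at
  distance d in one window satisfy N^(\<alpha>-1) d^2 \<le> C N/T when the signs agree, hence d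
  \<le> C Q. When they differ, N^(\<alpha>-1) |\<xi>| d \<le> C N/T, and |\<xi>| \<ge> Q gives d
  \<le> C Q again. The second bound degenerates for small |\<xi>|, which is why those output modes
  are treated apart. The loss Q occurs in the square of the norm, so its root T^(-1/4)
  N^(1/2-\<alpha>/4) is the factor of the theorem. Two obstacles shape the proof. The input
  frequencies may be of very different size and only the larger one is comparable to N, so every
  lower bound on the variation of h has to come from the larger one. Moreover the equation holds
  only in the sense of distributions, with a forcing that is merely bounded and measurable in time.
  Time derivatives are therefore replaced by integral identities, which come from testing with
  smooth approximations of indicators of time intervals, built from the same cutoff as the frequency
  projectors.\<close>

lemma card_le_of_diameter:
  fixes S :: "int set" and D :: real
  assumes "finite S" "0 \<le> D" "\<And>m n. m \<in> S \<Longrightarrow> n \<in> S \<Longrightarrow> m < n \<Longrightarrow> of_int (n - m) \<le> D"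
  shows "real (card S) \<le> D + 1"
proof (cases "S = {}")
  case False
  let ?m = "Min S"
  have "S \<subseteq> {?m..?m + \<lfloor>D\<rfloor>}"
  proof
    fix n assume n: "n \<in> S"
    have "?m \<le> n" using n assms(1) by simp
    moreover have "of_int (n - ?m) \<le> D"
      using assms(3)[of ?m n] n assms(1,2) False \<open>?m \<le> n\<close> by (cases "?m = n") auto
    hence "n - ?m \<le> \<lfloor>D\<rfloor>" by (simp add: le_floor_iff)
    ultimately show "n \<in> {?m..?m + \<lfloor>D\<rfloor>}" by simp
  qed
  hence "card S \<le> card {?m..?m + \<lfloor>D\<rfloor>}" by (intro card_mono) auto
  also have "\<dots> = nat (\<lfloor>D\<rfloor> + 1)" by simp
  finally have "card S \<le> nat (\<lfloor>D\<rfloor> + 1)" .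
  moreover have "0 \<le> \<lfloor>D\<rfloor>" using assms(2) by simp
  ultimately have "int (card S) \<le> \<lfloor>D\<rfloor> + 1" by linarith
  hence "real (card S) \<le> real_of_int (\<lfloor>D\<rfloor> + 1)" by (metis of_int_le_iff of_int_of_nat_eq)
  thus ?thesis by (smt (verit) of_int_add of_int_1 of_int_floor_le)
qed (use assms in simp)

text \<open>Hypothesis 1 in the form used for counting: oddness, and convexity at the rate
  x^(\<alpha>-1) beyond \<open>\<xi>\<^sub>0\<close>. Besides \<alpha>, the final constant depends
  on the symbol only through \<open>c\<close> and \<open>\<xi>\<^sub>0\<close>.\<close>

locale convex_symbol =
  fixes p q q' :: "real \<Rightarrow> real" and \<alpha> c \<xi>\<^sub>0 :: real
  assumes \<alpha>_ge: "1 \<le> \<alpha>" and c_pos: "0 < c" and \<xi>\<^sub>0_pos: "0 < \<xi>\<^sub>0"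
    and p_odd: "p (- x) = - p x"
    and p_deriv: "(p has_real_derivative q x) (at x)"
    and q_deriv: "x \<noteq> 0 \<Longrightarrow> (q has_real_derivative q' x) (at x)"
    and q'_ge: "\<xi>\<^sub>0 \<le> x \<Longrightarrow> c * x powr (\<alpha> - 1) \<le> q' x"
begin

text \<open>As \<alpha> \<ge> 1, the lower bound for \<open>q'\<close> is smallest at the left end
  \<open>x\<close>; subtracting the line with that slope leaves a nondecreasing function.\<close>

lemma q_diff_ge:
  assumes "\<xi>\<^sub>0 \<le> x" "0 \<le> d"
  shows "c * x powr (\<alpha> - 1) * d \<le> q (x + d) - q x"
proof -
  let ?l = "c * x powr (\<alpha> - 1)"
  have "q x - ?l * x \<le> q (x + d) - ?l * (x + d)"
  proof (rule DERIV_nonneg_imp_nondecreasing[of x "x + d" "\<lambda>t. q t - ?l * t"])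
    fix t assume t: "x \<le> t" "t \<le> x + d"
    hence t0: "0 < t" using assms \<xi>\<^sub>0_pos by linarith
    have "?l \<le> c * t powr (\<alpha> - 1)"
      using t assms \<xi>\<^sub>0_pos \<alpha>_ge c_pos by (intro mult_left_mono powr_mono2) auto
    also have "\<dots> \<le> q' t" using q'_ge t assms by simp
    finally have "0 \<le> q' t - ?l" by simp
    moreover have "((\<lambda>t. q t - ?l * t) has_real_derivative q' t - ?l) (at t)"
      using t0 by (auto intro!: derivative_eq_intros q_deriv)
    ultimately show "\<exists>y. ((\<lambda>t. q t - ?l * t) has_real_derivative y) (at t) \<and> 0 \<le> y" by blast
  qed (use assms in simp)
  thus ?thesis by (simp add: algebra_simps)
qed

lemma q_mono: "\<xi>\<^sub>0 \<le> x \<Longrightarrow> x \<le> y \<Longrightarrow> q x \<le> q y"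
  using q_diff_ge[of x "y - x"] c_pos \<xi>\<^sub>0_pos
  by (smt (verit) mult_nonneg_nonneg powr_ge_zero)

text \<open>When the frequencies are pushed apart by t, the derivative in t is
  \<open>q (x + t) - q (y - t)\<close>. Since \<open>q (y - t) \<le> q x\<close>, at least
  \<open>q (x + t) - q x\<close> remains, which is bounded below linearly in t; integration gives
  the square. Only the stretch above the larger frequency \<open>x\<close> contributes, because
  \<open>y\<close> may be far below \<open>M\<close>.\<close>

lemma same_sign_gap:
  assumes "y \<le> x" "0 \<le> d" "\<xi>\<^sub>0 \<le> y - d" "0 < M" "M \<le> x"
  shows "c * M powr (\<alpha> - 1) * d\<^sup>2 / 2 \<le> (p (x + d) + p (y - d)) - (p x + p y)"
proof -
  let ?l = "c * M powr (\<alpha> - 1)"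
  have x: "\<xi>\<^sub>0 \<le> x" using assms by linarith
  let ?g = "\<lambda>t. p (x + t) + p (y - t) - ?l * t\<^sup>2 / 2"
  have "?g 0 \<le> ?g d"
  proof (rule DERIV_nonneg_imp_nondecreasing[of 0 d ?g])
    fix t assume t: "0 \<le> t" "t \<le> d"
    have "(?g has_real_derivative q (x + t) - q (y - t) - ?l * t) (at t)"
      by (auto intro!: derivative_eq_intros DERIV_chain2[OF p_deriv])
    moreover have "?l * t \<le> c * x powr (\<alpha> - 1) * t"
      using assms c_pos t \<alpha>_ge by (intro mult_right_mono mult_left_mono powr_mono2) auto
    moreover have "c * x powr (\<alpha> - 1) * t \<le> q (x + t) - q x" using q_diff_ge x t by simp
    moreover have "q (y - t) \<le> q x" using t assms by (intro q_mono) auto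
    ultimately show "\<exists>z. (?g has_real_derivative z) (at t) \<and> 0 \<le> z" by force
  qed (use assms in simp)
  thus ?thesis by simp
qed

text \<open>The derivative in the displacement is the increment of \<open>q\<close> over an interval
  of length \<open>x - y\<close>. Its lower end may be close to \<open>\<xi>\<^sub>0\<close>, so
  only the upper half is kept: it starts at a midpoint of at least \<open>M / 2\<close> and has
  length \<open>(x - y) / 2\<close>. This explains both halves in the bound.\<close>

lemma opposite_sign_gap:
  assumes "y \<le> x" "0 \<le> d" "\<xi>\<^sub>0 \<le> y" "0 < M" "M \<le> x"
  shows "c / 2 * (M / 2) powr (\<alpha> - 1) * (x - y) * d \<le> (p (x + d) - p (y + d)) - (p x - p y)"
proof -
  let ?l = "c / 2 * (M / 2) powr (\<alpha> - 1) * (x - y)"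
  let ?g = "\<lambda>t. p (x + t) - p (y + t) - ?l * t"
  have "?g 0 \<le> ?g d"
  proof (rule DERIV_nonneg_imp_nondecreasing[of 0 d ?g])
    fix t assume t: "0 \<le> t" "t \<le> d"
    define z where "z = (x + y) / 2 + t"
    have "M / 2 \<le> z" using assms t \<xi>\<^sub>0_pos unfolding z_def by (simp add: field_simps)
    have "\<xi>\<^sub>0 \<le> z" using assms t \<xi>\<^sub>0_pos unfolding z_def by (simp add: field_simps)
    have "?l = c * (M / 2) powr (\<alpha> - 1) * ((x - y) / 2)" by simp
    also have "\<dots> \<le> c * z powr (\<alpha> - 1) * ((x - y) / 2)"
      using assms c_pos \<alpha>_ge \<open>M / 2 \<le> z\<close> by (intro mult_right_mono mult_left_mono powr_mono2) auto
    also have "\<dots> \<le> q (z + (x - y) / 2) - q z"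
      using assms t \<open>\<xi>\<^sub>0 \<le> z\<close> by (intro q_diff_ge) auto
    also have "z + (x - y) / 2 = x + t" by (simp add: z_def field_simps)
    finally have "?l \<le> q (x + t) - q z" .
    have "(?g has_real_derivative q (x + t) - q (y + t) - ?l) (at t)"
      by (auto intro!: derivative_eq_intros DERIV_chain2[OF p_deriv])
    moreover note \<open>?l \<le> q (x + t) - q z\<close>
    moreover have "q (y + t) \<le> q z" using t assms by (intro q_mono) (auto simp: z_def)
    ultimately show "\<exists>z. (?g has_real_derivative z) (at t) \<and> 0 \<le> z" by force
  qed (use assms in simp)
  thus ?thesis by simp
qed

section \<open>The resonance function and its level windows\<close>

definition phase :: "int \<Rightarrow> int \<Rightarrow> real" where
  "phase \<xi> n = p (of_int n) + p (of_int (\<xi> - n))"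

text \<open>The exchange n to \<xi> - n and the reflection (\<xi>, n) to (-\<xi>, -n) reduce all
  sign patterns to two: both frequencies positive, or the first positive and the second
  negative.\<close>

lemma phase_swap: "phase \<xi> (\<xi> - n) = phase \<xi> n"
  by (simp add: phase_def)

lemma phase_neg: "phase (- \<xi>) (- n) = - phase \<xi> n"
proof -
  have "real_of_int (- \<xi> - - n) = - real_of_int (\<xi> - n)" by simp
  thus ?thesis unfolding phase_def by (simp only: p_odd of_int_minus minus_add_distrib)
qed

text \<open>The maximum appears because only the larger input frequency is known to be comparable to
  N.\<close>

definition window :: "real \<Rightarrow> real \<Rightarrow> int \<Rightarrow> real \<Rightarrow> int set" where
  "window M R \<xi> x = {n. M \<le> max \<bar>of_int n\<bar> \<bar>of_int (\<xi> - n)\<bar> \<and> phase \<xi> n \<in> {x..x + R}}"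

lemma window_diff:
  assumes "S \<subseteq> window M R \<xi> x" "m \<in> S" "n \<in> S"
  shows "phase \<xi> n - phase \<xi> m \<le> R"
proof -
  have "phase \<xi> n \<le> x + R" "x \<le> phase \<xi> m" using assms by (auto simp: window_def)
  thus ?thesis by linarith
qed

lemma window_swap: "n \<in> window M R \<xi> x \<longleftrightarrow> \<xi> - n \<in> window M R \<xi> x"
  by (simp add: window_def phase_swap max.commute)

text \<open>Reflection sends the value interval [x, x + R] to [-x - R, -x], whose left end is
  \<open>- x - R\<close>.\<close>

lemma window_neg: "n \<in> window M R \<xi> x \<longleftrightarrow> - n \<in> window M R (- \<xi>) (- x - R)"
proof -
  have "\<bar>real_of_int (- \<xi> - - n)\<bar> = \<bar>real_of_int (\<xi> - n)\<bar>" by simp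
  thus ?thesis unfolding window_def phase_neg mem_Collect_eq by auto
qed

text \<open>By \<open>order\<close>, n is the larger frequency for every member, so
  \<open>same_sign_gap\<close> compares any two of them. The condition on \<open>D\<close> turns its
  quadratic lower bound, which is at most \<open>R\<close>, into a bound on their distance.\<close>

lemma card_same_sign:
  assumes fin: "finite S" and S: "S \<subseteq> window M R \<xi> x" and pos: "0 < M" "0 \<le> R"
    and B: "\<And>n. n \<in> S \<Longrightarrow> \<xi>\<^sub>0 \<le> of_int n" "\<And>n. n \<in> S \<Longrightarrow> \<xi>\<^sub>0 \<le> of_int (\<xi> - n)"
    and D: "2 * R \<le> c * M powr (\<alpha> - 1) * D\<^sup>2" "0 \<le> D"
    and order: "\<And>n. n \<in> S \<Longrightarrow> \<xi> - n \<le> n"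
  shows "real (card S) \<le> D + 1"
proof (rule card_le_of_diameter[OF fin \<open>0 \<le> D\<close>])
  fix m n assume mn: "m \<in> S" "n \<in> S" "m < n"
  let ?d = "real_of_int (n - m)"
  have "c * M powr (\<alpha> - 1) * ?d\<^sup>2 / 2
      \<le> (p (of_int m + ?d) + p (of_int (\<xi> - m) - ?d)) - (p (of_int m) + p (of_int (\<xi> - m)))"
  proof (rule same_sign_gap)
    show "real_of_int (\<xi> - m) \<le> real_of_int m" using order[OF mn(1)] by linarith
    show "\<xi>\<^sub>0 \<le> real_of_int (\<xi> - m) - ?d" using B(2)[OF mn(2)] by simp
    show "M \<le> real_of_int m"
      using mn(1) S order[OF mn(1)] B[OF mn(1)] \<xi>\<^sub>0_pos by (force simp: window_def)
  qed (use mn pos in auto)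
  also have "\<dots> = phase \<xi> n - phase \<xi> m" by (simp add: phase_def)
  also have "\<dots> \<le> R" using window_diff[OF S] mn by blast
  finally have "c * M powr (\<alpha> - 1) * ?d\<^sup>2 \<le> c * M powr (\<alpha> - 1) * D\<^sup>2" using D by linarith
  hence "?d\<^sup>2 \<le> D\<^sup>2" using pos c_pos by simp
  thus "?d \<le> D" using D(2) power2_le_imp_le by blast
qed

text \<open>The phase is symmetric about \<xi>/2, so two points are separated by their values only
  if they lie on the same side of it. The lower half is reflected onto the upper one and the count
  doubles.\<close>

lemma card_both_positive:
  assumes fin: "finite S" and S: "S \<subseteq> window M R \<xi> x" and pos: "0 < M" "0 \<le> R"
    and B: "\<And>n. n \<in> S \<Longrightarrow> \<xi>\<^sub>0 \<le> of_int n" "\<And>n. n \<in> S \<Longrightarrow> \<xi>\<^sub>0 \<le> of_int (\<xi> - n)"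
    and D: "2 * R \<le> c * M powr (\<alpha> - 1) * D\<^sup>2" "0 \<le> D"
  shows "real (card S) \<le> 2 * D + 2"
proof -
  let ?A = "{n \<in> S. \<xi> - n \<le> n}" and ?B = "{n \<in> S. n < \<xi> - n}"
  have "real (card ?A) \<le> D + 1"
    by (rule card_same_sign[of _ M R \<xi> x]) (use assms in auto)
  moreover have "real (card ((\<lambda>n. \<xi> - n) ` ?B)) \<le> D + 1"
    by (rule card_same_sign[of _ M R \<xi> x]) (use assms window_swap in auto)
  moreover have "card ((\<lambda>n. \<xi> - n) ` ?B) = card ?B"
    by (rule card_image) (auto simp: inj_on_def)
  moreover have "S = ?A \<union> ?B" by auto
  hence "card S \<le> card ?A + card ?B" by (metis card_Un_le)
  ultimately show ?thesis by linarith
qed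

text \<open>By oddness the phase is p(k) - p(k - \<xi>), a difference of p over a distance |\<xi>|
  between two positive points. The sign of \<xi> decides which of them is larger, and whether the
  phase increases or decreases in k.\<close>

lemma card_opposite_sign:
  assumes fin: "finite S" and S: "S \<subseteq> window M R \<xi> x" and pos: "0 < M" "0 \<le> R" "\<xi> \<noteq> 0"
    and B: "\<And>n. n \<in> S \<Longrightarrow> \<xi>\<^sub>0 \<le> of_int n" "\<And>n. n \<in> S \<Longrightarrow> of_int (\<xi> - n) \<le> - \<xi>\<^sub>0"
    and D: "R \<le> c / 2 * (M / 2) powr (\<alpha> - 1) * \<bar>of_int \<xi>\<bar> * D" "0 \<le> D"
  shows "real (card S) \<le> D + 1"
proof (rule card_le_of_diameter[OF fin \<open>0 \<le> D\<close>])
  fix m n assume mn: "m \<in> S" "n \<in> S" "m < n"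
  let ?d = "real_of_int (n - m)" and ?l = "c / 2 * (M / 2) powr (\<alpha> - 1) * \<bar>of_int \<xi>\<bar>"
  have ph: "phase \<xi> k = p (of_int k) - p (of_int (k - \<xi>))" for k
    using p_odd[of "of_int (k - \<xi>)"] by (simp add: phase_def)
  have M: "M \<le> max \<bar>of_int m\<bar> \<bar>of_int (\<xi> - m)\<bar>" using mn S by (auto simp: window_def)
  have diff: "\<bar>phase \<xi> n - phase \<xi> m\<bar> \<le> R"
    using window_diff[OF S mn(1,2)] window_diff[OF S mn(2,1)] by linarith
  have "?l * ?d \<le> R"
  proof (cases "0 < \<xi>")
    case True
    have "c / 2 * (M / 2) powr (\<alpha> - 1) * (of_int m - of_int (m - \<xi>)) * ?d
      \<le> (p (of_int m + ?d) - p (of_int (m - \<xi>) + ?d)) - (p (of_int m) - p (of_int (m - \<xi>)))"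
    proof (rule opposite_sign_gap)
      show "M \<le> real_of_int m" using True M B[OF mn(1)] \<xi>\<^sub>0_pos by auto
    qed (use mn pos True B[OF mn(1)] in auto)
    also have "\<dots> = phase \<xi> n - phase \<xi> m" by (simp add: ph)
    finally show ?thesis using diff True by simp
  next
    case False
    have "c / 2 * (M / 2) powr (\<alpha> - 1) * (of_int (m - \<xi>) - of_int m) * ?d
      \<le> (p (of_int (m - \<xi>) + ?d) - p (of_int m + ?d)) - (p (of_int (m - \<xi>)) - p (of_int m))"
    proof (rule opposite_sign_gap)
      show "M \<le> real_of_int (m - \<xi>)" using False M B[OF mn(1)] \<xi>\<^sub>0_pos by auto
    qed (use mn pos False B[OF mn(1)] in auto)
    also have "\<dots> = phase \<xi> m - phase \<xi> n" by (simp add: ph)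
    finally show ?thesis using diff False by simp
  qed
  hence "?l * ?d \<le> ?l * D" using D by linarith
  moreover have "0 < ?l" using pos c_pos by simp
  ultimately show "?d \<le> D" by (metis mult_le_cancel_left_pos)
qed

text \<open>Below \<open>\<xi>\<^sub>0\<close> there is no convexity to exploit, so these
  frequencies are simply all counted.\<close>

lemma card_low:
  fixes S :: "int set"
  assumes "finite S" "\<And>n. n \<in> S \<Longrightarrow> \<bar>of_int n\<bar> \<le> \<xi>\<^sub>0"
  shows "real (card S) \<le> 2 * \<xi>\<^sub>0 + 1"
proof (rule card_le_of_diameter[OF assms(1)])
  fix m n :: int assume "m \<in> S" "n \<in> S"
  from assms(2)[OF this(1)] assms(2)[OF this(2)] show "of_int (n - m) \<le> 2 * \<xi>\<^sub>0" by simp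
qed (use \<xi>\<^sub>0_pos in simp)

text \<open>Six overlapping pieces: one of the frequencies low (\<open>?A1\<close>,
  \<open>?A2\<close>), both positive or both negative (\<open>?A3\<close>, \<open>?A4\<close>),
  opposite signs (\<open>?A5\<close>, \<open>?A6\<close>). In each pair a symmetry carries the
  second piece to the situation of the first. The bound is twice the sum of
  \<open>2 * \<xi>\<^sub>0 + 1\<close>, \<open>2 * D + 2\<close> and \<open>D + 1\<close>.\<close>

lemma card_window:
  assumes fin: "finite S" and S: "S \<subseteq> window M R \<xi> x" and pos: "0 < M" "0 \<le> R" "\<xi> \<noteq> 0"
    and D: "2 * R \<le> c * M powr (\<alpha> - 1) * D\<^sup>2" "0 \<le> D"
      "R \<le> c / 2 * (M / 2) powr (\<alpha> - 1) * \<bar>of_int \<xi>\<bar> * D"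
  shows "real (card S) \<le> 6 * D + 4 * \<xi>\<^sub>0 + 8"
proof -
  let ?f = "\<lambda>n. \<xi> - n"
  let ?A1 = "{n \<in> S. \<bar>of_int n\<bar> \<le> \<xi>\<^sub>0}" and ?A2 = "{n \<in> S. \<bar>of_int (\<xi> - n)\<bar> \<le> \<xi>\<^sub>0}"
  let ?A3 = "{n \<in> S. \<xi>\<^sub>0 \<le> of_int n \<and> \<xi>\<^sub>0 \<le> of_int (\<xi> - n)}"
  let ?A4 = "{n \<in> S. of_int n \<le> - \<xi>\<^sub>0 \<and> of_int (\<xi> - n) \<le> - \<xi>\<^sub>0}"
  let ?A5 = "{n \<in> S. \<xi>\<^sub>0 \<le> of_int n \<and> of_int (\<xi> - n) \<le> - \<xi>\<^sub>0}"
  let ?A6 = "{n \<in> S. of_int n \<le> - \<xi>\<^sub>0 \<and> \<xi>\<^sub>0 \<le> of_int (\<xi> - n)}"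
  have inj: "inj_on ?f X" "inj_on uminus X" for X :: "int set" by (auto simp: inj_on_def)
  have 1: "real (card ?A1) \<le> 2 * \<xi>\<^sub>0 + 1" by (rule card_low) (use fin in auto)
  have "real (card (?f ` ?A2)) \<le> 2 * \<xi>\<^sub>0 + 1" by (rule card_low) (use fin in auto)
  hence 2: "real (card ?A2) \<le> 2 * \<xi>\<^sub>0 + 1" by (simp add: card_image[OF inj(1)])
  have 3: "real (card ?A3) \<le> 2 * D + 2"
    by (rule card_both_positive[of _ M R \<xi> x]) (use assms in auto)
  have "real (card (uminus ` ?A4)) \<le> 2 * D + 2"
    by (rule card_both_positive[of _ M R "- \<xi>" "- x - R"]) (use assms window_neg[of _ M R \<xi> x] in auto)
  hence 4: "real (card ?A4) \<le> 2 * D + 2" by (simp add: card_image[OF inj(2)])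
  have 5: "real (card ?A5) \<le> D + 1"
    by (rule card_opposite_sign[of _ M R \<xi> x]) (use assms in auto)
  have "real (card (?f ` ?A6)) \<le> D + 1"
    by (rule card_opposite_sign[of _ M R \<xi> x]) (use assms window_swap[of _ M R \<xi> x] in auto)
  hence 6: "real (card ?A6) \<le> D + 1" by (simp add: card_image[OF inj(1)])
  have "S \<subseteq> ?A1 \<union> (?A2 \<union> (?A3 \<union> (?A4 \<union> (?A5 \<union> ?A6))))" by auto
  hence "card S \<le> card (?A1 \<union> (?A2 \<union> (?A3 \<union> (?A4 \<union> (?A5 \<union> ?A6)))))"
    using fin by (intro card_mono) auto
  also have "\<dots> \<le> card ?A1 + (card ?A2 + (card ?A3 + (card ?A4 + (card ?A5 + card ?A6))))"
    by (intro order_trans[OF card_Un_le] add_left_mono order_refl)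
  finally have "real (card S) \<le> real (card ?A1 + (card ?A2 + (card ?A3 + (card ?A4 + (card ?A5 + card ?A6)))))"
    by linarith
  thus ?thesis using 1 2 3 4 5 6 unfolding of_nat_add by linarith
qed

end

section \<open>A large sieve inequality\<close>

text \<open>The weight 1 - t^2 is nonnegative on [-1, 1] and vanishes at the ends, so its transform
  decays like \<tau>^(-2), which is summable over the integers; a sharp cutoff would only give
  1/|\<tau>|. \<open>A\<close> results from repeated integration by parts, which stops because the
  third derivative of the weight is zero.\<close>

lemma parabola_integral:
  fixes \<tau> :: real
  assumes "\<tau> \<noteq> 0"
  defines "w \<equiv> \<i> * complex_of_real \<tau>"
  defines "A \<equiv> \<lambda>t. cis (\<tau> * t) * ((1 - (complex_of_real t)\<^sup>2) / w + 2 * complex_of_real t / w\<^sup>2 - 2 / w ^ 3)"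
  shows "((\<lambda>t. complex_of_real (1 - t\<^sup>2) * cis (\<tau> * t)) has_integral (A 1 - A (-1))) {-1..1}"
proof (rule fundamental_theorem_of_calculus)
  fix t :: real assume "t \<in> {-1..1}"
  have w: "w \<noteq> 0" using assms by simp
  have "((\<lambda>t::real. cis (\<tau> * t)) has_vector_derivative w * cis (\<tau> * t)) (at t within {-1..1})"
    unfolding cis_conv_exp w_def
    by (auto intro!: derivative_eq_intros has_vector_derivative_real_field simp: algebra_simps)
  moreover have "((\<lambda>t::real. (1 - (complex_of_real t)\<^sup>2) * a + 2 * complex_of_real t * b - k)
     has_vector_derivative (- 2 * complex_of_real t * a + 2 * b)) (at t within {-1..1})" for a b k :: complex
    by (auto intro!: derivative_eq_intros has_vector_derivative_real_field)
  from this[of "1 / w" "1 / w\<^sup>2" "2 / w ^ 3"]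
  have "((\<lambda>t::real. (1 - (complex_of_real t)\<^sup>2) / w + 2 * complex_of_real t / w\<^sup>2 - 2 / w ^ 3)
     has_vector_derivative (- 2 * complex_of_real t / w + 2 / w\<^sup>2)) (at t within {-1..1})"
    by simp
  ultimately have "(A has_vector_derivative cis (\<tau> * t) * (- 2 * complex_of_real t / w + 2 / w\<^sup>2)
    + (w * cis (\<tau> * t)) * ((1 - (complex_of_real t)\<^sup>2) / w + 2 * complex_of_real t / w\<^sup>2 - 2 / w ^ 3)) (at t within {-1..1})"
    unfolding A_def by (rule has_vector_derivative_mult)
  also have "cis (\<tau> * t) * (- 2 * complex_of_real t / w + 2 / w\<^sup>2)
    + (w * cis (\<tau> * t)) * ((1 - (complex_of_real t)\<^sup>2) / w + 2 * complex_of_real t / w\<^sup>2 - 2 / w ^ 3)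
    = complex_of_real (1 - t\<^sup>2) * cis (\<tau> * t)"
    using w by (simp add: field_simps power2_eq_square power3_eq_cube)
  finally show "(A has_vector_derivative complex_of_real (1 - t\<^sup>2) * cis (\<tau> * t)) (at t within {-1..1})" .
qed simp

definition parabola_hat :: "real \<Rightarrow> complex" where
  "parabola_hat \<tau> = integral {-1..1} (\<lambda>t. complex_of_real (1 - t\<^sup>2) * cis (\<tau> * t))"

text \<open>Near zero the trivial bound 2 suffices. For large \<tau> the term of order 1/\<tau> in
  the antiderivative carries the factor 1 - t^2 and drops out at both ends.\<close>

lemma parabola_hat_bound: "cmod (parabola_hat \<tau>) \<le> 16 / (1 + \<tau>\<^sup>2)"
proof (cases "\<bar>\<tau>\<bar> \<le> 1")
  case True
  have "cmod (parabola_hat \<tau>) \<le> 1 * (1 - (-1))"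
    unfolding parabola_hat_def
  proof (rule integral_bound)
    fix t :: real assume "t \<in> {-1..1}"
    hence "\<bar>1 - t\<^sup>2\<bar> \<le> 1" using abs_square_le_1[of t] by auto
    thus "cmod (complex_of_real (1 - t\<^sup>2) * cis (\<tau> * t)) \<le> 1"
      by (simp only: norm_mult norm_cis norm_of_real mult_1_right)
  qed (auto intro!: continuous_intros)
  also have "\<dots> \<le> 16 / (1 + \<tau>\<^sup>2)"
    using True abs_square_le_1[of \<tau>] by (simp add: field_simps add_pos_nonneg)
  finally show ?thesis .
next
  case False
  hence \<tau>: "\<tau> \<noteq> 0" "1 < \<bar>\<tau>\<bar>" by auto
  have *: "cmod (cis x * (2 * a / (\<i> * \<tau>)\<^sup>2 - 2 / (\<i> * \<tau>)^3)) \<le> 4 / \<tau>\<^sup>2" if "a = 1 \<or> a = -1" for a :: complex and x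
  proof -
    have "cmod (cis x * (2 * a / (\<i> * \<tau>)\<^sup>2 - 2 / (\<i> * \<tau>)^3)) \<le> cmod (2 * a / (\<i> * \<tau>)\<^sup>2) + cmod (2 / (\<i> * \<tau>)^3)"
      by (simp add: norm_mult norm_triangle_ineq4)
    also have "\<dots> = 2 / \<tau>\<^sup>2 + 2 / (\<bar>\<tau>\<bar> * \<tau>\<^sup>2)"
      using that by (auto simp: norm_divide norm_mult norm_power power3_eq_cube power2_eq_square)
    also have "2 / (\<bar>\<tau>\<bar> * \<tau>\<^sup>2) \<le> 2 / (1 * \<tau>\<^sup>2)"
      using \<tau> by (intro divide_left_mono mult_right_mono) auto
    finally show ?thesis by simp
  qed
  have "parabola_hat \<tau> = cis \<tau> * (2 * 1 / (\<i> * \<tau>)\<^sup>2 - 2 / (\<i> * \<tau>)^3) - cis (- \<tau>) * (2 * (-1) / (\<i> * \<tau>)\<^sup>2 - 2 / (\<i> * \<tau>)^3)"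
    unfolding parabola_hat_def using integral_unique[OF parabola_integral[OF \<tau>(1)]] by simp
  hence "cmod (parabola_hat \<tau>) \<le> 4 / \<tau>\<^sup>2 + 4 / \<tau>\<^sup>2"
    by (simp only:) (intro order_trans[OF norm_triangle_ineq4] add_mono *, simp_all)
  also have "\<dots> \<le> 16 / (1 + \<tau>\<^sup>2)"
  proof -
    have "1 \<le> \<tau>\<^sup>2" using \<tau> abs_square_le_1[of \<tau>] by linarith
    hence "16 / (2 * \<tau>\<^sup>2) \<le> 16 / (1 + \<tau>\<^sup>2)"
      using \<tau> by (intro divide_left_mono mult_pos_pos) (auto intro: add_pos_nonneg)
    thus ?thesis by simp
  qed
  finally show ?thesis .
qed

lemma norm_parabola_hat_uminus: "cmod (parabola_hat (- \<tau>)) = cmod (parabola_hat \<tau>)"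
proof -
  have "parabola_hat (- \<tau>) = cnj (parabola_hat \<tau>)"
    unfolding parabola_hat_def integral_cnj by (simp add: cis_cnj)
  thus ?thesis by simp
qed

lemma sum_inverse_square_int_le:
  fixes J :: "int set" assumes "finite J"
  shows "(\<Sum>j\<in>J. 1 / (1 + (of_int j)\<^sup>2 :: real)) \<le> 6"
proof -
  \<comment> \<open>A telescoping bound: 1 / (1 + (n + 1)^2) is at most 2 / (n + 1) - 2 / (n + 2).
    The offset 3 makes n = 0 an equality.\<close>
  have *: "(\<Sum>k\<le>n. 1 / (1 + (real k)\<^sup>2)) \<le> 3 - 2 / (real n + 1)" for n
  proof (induction n)
    case (Suc n)
    have "1 / (1 + (real (Suc n))\<^sup>2) = 2 * 1 / (2 * (1 + (real (Suc n))\<^sup>2))"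
      by (rule mult_divide_mult_cancel_left[symmetric]) simp
    also have "\<dots> \<le> 2 * 1 / ((real n + 1) * (real n + 2))"
      by (rule divide_left_mono) (auto simp: power2_eq_square algebra_simps add_pos_nonneg)
    also have "\<dots> = 2 / (real n + 1) - 2 / (real n + 2)" by (simp add: field_simps)
    finally show ?case using Suc by (simp only: sum.atMost_Suc of_nat_Suc) (simp add: add.commute)
  qed simp
  define n where "n = Max (insert 0 ((\<lambda>j. nat \<bar>j\<bar>) ` J))"
  have n: "nat \<bar>j\<bar> \<le> n" if "j \<in> J" for j using that assms by (auto simp: n_def)
  \<comment> \<open>Two copies of an initial segment of the naturals cover \<open>J\<close>. Zero is
    counted twice, and each copy contributes at most 3.\<close>
  have "J \<subseteq> int ` {..n} \<union> (\<lambda>k. - int k) ` {..n}"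
  proof
    fix j assume "j \<in> J"
    hence "nat \<bar>j\<bar> \<in> {..n}" using n by simp
    moreover have "j = int (nat \<bar>j\<bar>) \<or> j = - int (nat \<bar>j\<bar>)" by linarith
    ultimately show "j \<in> int ` {..n} \<union> (\<lambda>k. - int k) ` {..n}" by blast
  qed
  hence "(\<Sum>j\<in>J. 1 / (1 + (of_int j)\<^sup>2 :: real)) \<le> (\<Sum>j\<in>int ` {..n} \<union> (\<lambda>k. - int k) ` {..n}. 1 / (1 + (of_int j)\<^sup>2))"
    by (intro sum_mono2) auto
  also have "\<dots> \<le> (\<Sum>j\<in>int ` {..n}. 1 / (1 + (of_int j)\<^sup>2)) + (\<Sum>j\<in>(\<lambda>k. - int k) ` {..n}. 1 / (1 + (of_int j)\<^sup>2))"
    by (subst sum.union_inter[symmetric]) (auto intro!: sum_nonneg)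
  also have "\<dots> = (\<Sum>k\<le>n. 1 / (1 + (real k)\<^sup>2)) + (\<Sum>k\<le>n. 1 / (1 + (real k)\<^sup>2))"
    by (simp add: sum.reindex inj_on_def)
  also have "\<dots> \<le> 3 + 3"
  proof -
    have "0 \<le> 2 / (real n + 1)" by simp
    with *[of n] show ?thesis by linarith
  qed
  finally show ?thesis by simp
qed

text \<open>Schur's test: the points are sorted into unit intervals.\<close>

lemma schur_sum_le:
  fixes k :: "'a \<Rightarrow> real"
  assumes fin: "finite S" and K: "\<And>x. real (card {m \<in> S. x \<le> k m \<and> k m \<le> x + 1}) \<le> K"
  shows "(\<Sum>m\<in>S. cmod (parabola_hat (k m - y))) \<le> 288 * K"
proof -
  let ?j = "\<lambda>m. \<lfloor>k m - y\<rfloor>"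
  have "0 \<le> K" using K[of 0] by linarith
  \<comment> \<open>Rounding down to an integer costs a factor 3, because (|\<tau>| + 1)^2 \<le> 2
    \<tau>^2 + 2. Thus 48 is 3 times 16, and the sum over the integers raises it by a factor 6 to
    288.\<close>
  have bnd: "cmod (parabola_hat \<tau>) \<le> 48 * (1 / (1 + (of_int \<lfloor>\<tau>\<rfloor>)\<^sup>2))" for \<tau>
  proof -
    have "\<bar>real_of_int \<lfloor>\<tau>\<rfloor>\<bar> \<le> \<bar>\<tau>\<bar> + 1" by linarith
    hence "(real_of_int \<lfloor>\<tau>\<rfloor>)\<^sup>2 \<le> (\<bar>\<tau>\<bar> + 1)\<^sup>2" by (metis abs_ge_zero power2_abs power_mono)
    also have "\<dots> \<le> 2 * \<tau>\<^sup>2 + 2" using zero_le_power2[of "\<bar>\<tau>\<bar> - 1"] by (simp add: power2_eq_square algebra_simps)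
    finally have "1 + (real_of_int \<lfloor>\<tau>\<rfloor>)\<^sup>2 \<le> 3 * (1 + \<tau>\<^sup>2)" by (smt (verit) zero_le_power2)
    hence "48 / (3 * (1 + \<tau>\<^sup>2)) \<le> 48 / (1 + (real_of_int \<lfloor>\<tau>\<rfloor>)\<^sup>2)"
      by (intro divide_left_mono) (auto intro!: mult_pos_pos add_pos_nonneg)
    moreover have "3 * 16 / (3 * (1 + \<tau>\<^sup>2)) = 16 / (1 + \<tau>\<^sup>2)"
      by (rule mult_divide_mult_cancel_left) simp
    ultimately show ?thesis using parabola_hat_bound[of \<tau>] by simp
  qed
  have "(\<Sum>m\<in>S. cmod (parabola_hat (k m - y))) \<le> (\<Sum>m\<in>S. 48 * (1 / (1 + (of_int (?j m))\<^sup>2)))"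
    by (intro sum_mono bnd)
  also have "\<dots> = (\<Sum>j\<in>?j ` S. \<Sum>m\<in>{m \<in> S. ?j m = j}. 48 * (1 / (1 + (of_int (?j m))\<^sup>2)))"
    by (rule sum.image_gen[OF fin])
  also have "\<dots> = (\<Sum>j\<in>?j ` S. real (card {m \<in> S. ?j m = j}) * (48 * (1 / (1 + (of_int j)\<^sup>2))))"
    by (intro sum.cong refl) auto
  also have "\<dots> \<le> (\<Sum>j\<in>?j ` S. K * (48 * (1 / (1 + (of_int j)\<^sup>2))))"
  proof (intro sum_mono mult_right_mono)
    fix j
    have "card {m \<in> S. ?j m = j} \<le> card {m \<in> S. y + of_int j \<le> k m \<and> k m \<le> y + of_int j + 1}"
      using fin by (intro card_mono) (auto simp: floor_eq_iff)
    thus "real (card {m \<in> S. ?j m = j}) \<le> K" using K[of "y + of_int j"] by linarith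
  qed auto
  also have "\<dots> = 48 * K * (\<Sum>j\<in>?j ` S. 1 / (1 + (of_int j)\<^sup>2))"
    by (simp add: sum_distrib_left mult_ac)
  also have "\<dots> \<le> 48 * K * 6"
    using fin \<open>0 \<le> K\<close> by (intro mult_left_mono sum_inverse_square_int_le) auto
  finally show ?thesis by simp
qed

text \<open>Expanding the square gives a quadratic form in the coefficients with kernel
  \<open>parabola_hat (k m - k n)\<close>. Its row sums are O(K), because a unit interval contains
  at most \<open>K\<close> of the numbers \<open>k m\<close>; Schur's test concludes.\<close>

lemma large_sieve_unit:
  fixes k :: "'a \<Rightarrow> real" and c :: "'a \<Rightarrow> complex"
  assumes fin: "finite S" and K: "\<And>x. real (card {m \<in> S. x \<le> k m \<and> k m \<le> x + 1}) \<le> K"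
  shows "integral {-1..1} (\<lambda>t. (1 - t\<^sup>2) * (cmod (\<Sum>m\<in>S. c m * cis (k m * t)))\<^sup>2)
    \<le> 288 * K * (\<Sum>m\<in>S. (cmod (c m))\<^sup>2)"
proof -
  let ?F = "\<lambda>t. \<Sum>m\<in>S. c m * cis (k m * t)"
  have exp: "complex_of_real ((1 - t\<^sup>2) * (cmod (?F t))\<^sup>2)
      = (\<Sum>m\<in>S. \<Sum>n\<in>S. c m * cnj (c n) * (complex_of_real (1 - t\<^sup>2) * cis ((k m - k n) * t)))" for t
  proof -
    have "complex_of_real ((1 - t\<^sup>2) * (cmod (?F t))\<^sup>2) = complex_of_real (1 - t\<^sup>2) * (?F t * cnj (?F t))"
      by (simp only: of_real_mult complex_norm_square)
    also have "?F t * cnj (?F t) = (\<Sum>m\<in>S. \<Sum>n\<in>S. (c m * cis (k m * t)) * cnj (c n * cis (k n * t)))"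
      by (simp add: sum_product cnj_sum)
    also have "\<dots> = (\<Sum>m\<in>S. \<Sum>n\<in>S. c m * cnj (c n) * cis ((k m - k n) * t))"
    proof (intro sum.cong refl)
      fix m n
      have "cis (k m * t) * cnj (cis (k n * t)) = cis ((k m - k n) * t)"
        by (simp add: cis_cnj cis_mult left_diff_distrib)
      thus "(c m * cis (k m * t)) * cnj (c n * cis (k n * t)) = c m * cnj (c n) * cis ((k m - k n) * t)"
        by (metis complex_cnj_mult mult.assoc mult.left_commute)
    qed
    finally show ?thesis by (simp add: sum_distrib_left mult_ac)
  qed
  have int: "(\<lambda>t. complex_of_real (1 - t\<^sup>2) * cis (\<tau> * t)) integrable_on {-1..1}" for \<tau>
    by (intro integrable_continuous_real continuous_intros)
  have "complex_of_real (integral {-1..1} (\<lambda>t. (1 - t\<^sup>2) * (cmod (?F t))\<^sup>2))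
     = integral {-1..1} (\<lambda>t. complex_of_real ((1 - t\<^sup>2) * (cmod (?F t))\<^sup>2))"
    by (intro integral_unique[symmetric] has_integral_of_real integrable_integral integrable_continuous_real continuous_intros)
  also have "\<dots> = (\<Sum>m\<in>S. \<Sum>n\<in>S. c m * cnj (c n) * parabola_hat (k m - k n))"
    unfolding exp parabola_hat_def
    by (simp only: integral_sum[OF fin] integral_mult_right integrable_sum[OF fin] integrable_on_mult_right[OF int])
  finally have eq: "complex_of_real (integral {-1..1} (\<lambda>t. (1 - t\<^sup>2) * (cmod (?F t))\<^sup>2))
     = (\<Sum>m\<in>S. \<Sum>n\<in>S. c m * cnj (c n) * parabola_hat (k m - k n))" .
  have "integral {-1..1} (\<lambda>t. (1 - t\<^sup>2) * (cmod (?F t))\<^sup>2)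
    \<le> cmod (complex_of_real (integral {-1..1} (\<lambda>t. (1 - t\<^sup>2) * (cmod (?F t))\<^sup>2)))" by simp
  also have "\<dots> \<le> (\<Sum>m\<in>S. \<Sum>n\<in>S. cmod (c m) * cmod (c n) * cmod (parabola_hat (k m - k n)))"
    unfolding eq by (intro sum_norm_le) (simp add: norm_mult)
  \<comment> \<open>The kernel is symmetric in modulus, so after the arithmetic-geometric mean
    inequality both halves are equal and involve only row sums.\<close>
  also have "\<dots> \<le> (\<Sum>m\<in>S. \<Sum>n\<in>S. ((cmod (c m))\<^sup>2 / 2 + (cmod (c n))\<^sup>2 / 2) * cmod (parabola_hat (k m - k n)))"
  proof (intro sum_mono mult_right_mono)
    fix m n show "cmod (c m) * cmod (c n) \<le> (cmod (c m))\<^sup>2 / 2 + (cmod (c n))\<^sup>2 / 2"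
      using sum_squares_bound[of "cmod (c m)" "cmod (c n)"] by simp
  qed simp
  also have "\<dots> = (\<Sum>m\<in>S. \<Sum>n\<in>S. (cmod (c m))\<^sup>2 / 2 * cmod (parabola_hat (k m - k n)))
    + (\<Sum>n\<in>S. \<Sum>m\<in>S. (cmod (c n))\<^sup>2 / 2 * cmod (parabola_hat (k m - k n)))"
    by (subst (2) sum.swap) (simp add: sum.distrib distrib_right)
  also have "\<dots> = (\<Sum>m\<in>S. (cmod (c m))\<^sup>2 * (\<Sum>n\<in>S. cmod (parabola_hat (k n - k m))))"
  proof -
    have "cmod (parabola_hat (k m - k n)) = cmod (parabola_hat (k n - k m))" for m n
      using norm_parabola_hat_uminus[of "k n - k m"] by simp
    thus ?thesis by (simp only: sum_distrib_left sum.distrib[symmetric]) simp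
  qed
  also have "\<dots> \<le> (\<Sum>m\<in>S. (cmod (c m))\<^sup>2 * (288 * K))"
    by (intro sum_mono mult_left_mono schur_sum_le[OF fin K]) auto
  also have "\<dots> = 288 * K * (\<Sum>m\<in>S. (cmod (c m))\<^sup>2)"
    by (subst sum_distrib_left) (simp only: mult_ac)
  finally show ?thesis .
qed

section \<open>Primitives of bounded functions\<close>

text \<open>The forcing is merely bounded and measurable in time, so y' = g is expressed by an
  integral identity. Both functions are bounded Borel functions on the whole line, which keeps
  products integrable on bounded intervals, while the identity is confined to the open interval
  where the equation holds.\<close>

definition is_primitive :: "real \<Rightarrow> (real \<Rightarrow> complex) \<Rightarrow> (real \<Rightarrow> complex) \<Rightarrow> bool" where
  "is_primitive T y g \<longleftrightarrow>
     y \<in> borel_measurable borel \<and> bounded (range y) \<and> g \<in> borel_measurable borel \<and> bounded (range g) \<and>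
     (\<forall>s t. 0 < s \<longrightarrow> s \<le> t \<longrightarrow> t < T \<longrightarrow> y t - y s = (LINT x:{s..t}|lborel. g x))"

lemma set_integrable_bounded_borel:
  fixes g :: "real \<Rightarrow> complex"
  assumes [measurable]: "g \<in> borel_measurable borel" and "bounded (range g)"
  shows "set_integrable lborel {s..t} g"
proof -
  obtain B where "\<And>x. norm (g x) \<le> B" using assms(2) by (auto simp: bounded_iff)
  thus ?thesis unfolding set_integrable_def
    by (intro integrableI_bounded_set_indicator[where B = B]) (auto simp: emeasure_lborel_Icc_eq)
qed

lemma is_primitive_cis: "is_primitive T (\<lambda>t. cis (w * t)) (\<lambda>t. \<i> * of_real w * cis (w * t))"
  unfolding is_primitive_def
proof (intro conjI allI impI)
  fix s t :: real assume "s \<le> t"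
  have "((\<lambda>t::real. cis (w * t)) has_vector_derivative \<i> * of_real w * cis (w * x)) (at x within {s..t})" for x
    unfolding cis_conv_exp
    by (auto intro!: derivative_eq_intros has_vector_derivative_real_field simp: algebra_simps)
  from integral_FTC_atLeastAtMost[OF \<open>s \<le> t\<close> this]
  show "cis (w * t) - cis (w * s) = (LINT x:{s..t}|lborel. \<i> * of_real w * cis (w * x))"
    unfolding set_lebesgue_integral_def by (simp add: continuous_intros)
next
  show "(\<lambda>t. cis (w * t)) \<in> borel_measurable borel" "(\<lambda>t. \<i> * of_real w * cis (w * t)) \<in> borel_measurable borel"
    by (intro borel_measurable_continuous_onI continuous_intros)+
qed (auto simp: bounded_iff norm_mult)

lemma is_primitive_cmult:
  assumes "is_primitive T y g" shows "is_primitive T (\<lambda>t. k * y t) (\<lambda>t. k * g t)"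
proof -
  have bnd: "bounded (range (\<lambda>t. k * f t))" if "bounded (range f)" for f :: "real \<Rightarrow> complex"
    using bounded_linear_image[OF that bounded_linear_mult_right[of k]] by (simp add: image_image)
  show ?thesis using assms unfolding is_primitive_def
    by (auto intro: bnd simp: right_diff_distrib[symmetric])
qed

lemma bounded_range_mult:
  fixes f g :: "'a \<Rightarrow> 'b::real_normed_algebra"
  assumes "bounded (range f)" "bounded (range g)"
  shows "bounded (range (\<lambda>x. f x * g x))"
proof -
  obtain A B where "\<And>x. norm (f x) \<le> A" "\<And>x. norm (g x) \<le> B" using assms by (auto simp: bounded_iff)
  hence "norm (f x * g x) \<le> A * B" for x
    by (meson mult_mono norm_ge_zero norm_mult_ineq order_trans)
  thus ?thesis by (auto simp: bounded_iff)
qed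

lemma bounded_range_add:
  fixes f g :: "'a \<Rightarrow> 'b::real_normed_vector"
  assumes "bounded (range f)" "bounded (range g)"
  shows "bounded (range (\<lambda>x. f x + g x))"
  using bounded_plus_comp[OF assms] .

lemma is_primitive_add:
  assumes "is_primitive T y1 g1" "is_primitive T y2 g2"
  shows "is_primitive T (\<lambda>t. y1 t + y2 t) (\<lambda>t. g1 t + g2 t)"
proof -
  have *: "set_integrable lborel {s..t} g1" "set_integrable lborel {s..t} g2" for s t
    using assms by (auto simp: is_primitive_def intro: set_integrable_bounded_borel)
  show ?thesis using assms unfolding is_primitive_def
    by (auto intro!: bounded_range_add simp: set_integral_add(2)[OF *])
       (metis add_diff_add)
qed

lemma is_primitive_sum:
  assumes "finite S" "\<And>m. m \<in> S \<Longrightarrow> is_primitive T (y m) (g m)"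
  shows "is_primitive T (\<lambda>t. \<Sum>m\<in>S. y m t) (\<lambda>t. \<Sum>m\<in>S. g m t)"
  using assms
proof (induction S rule: finite_induct)
  case empty
  thus ?case by (auto simp: is_primitive_def bounded_iff)
qed (simp add: is_primitive_add)

text \<open>The product rule without pointwise derivatives. The function g1(x) g2(y) is integrated
  over the triangle s \<le> x \<le> y \<le> t in both orders: \<open>inner1\<close> integrates first
  in x, \<open>inner2\<close> first in y. Equating the results by Fubini is integration by
  parts.\<close>

lemma is_primitive_mult:
  assumes 1: "is_primitive T y1 g1" and 2: "is_primitive T y2 g2"
  shows "is_primitive T (\<lambda>t. y1 t * y2 t) (\<lambda>t. g1 t * y2 t + y1 t * g2 t)"
  unfolding is_primitive_def
proof (intro conjI allI impI)
  have [measurable]: "y1 \<in> borel_measurable borel" "y2 \<in> borel_measurable borel"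
      "g1 \<in> borel_measurable borel" "g2 \<in> borel_measurable borel"
    and bnd: "bounded (range y1)" "bounded (range y2)" "bounded (range g1)" "bounded (range g2)"
    using 1 2 by (auto simp: is_primitive_def)
  show "(\<lambda>t. y1 t * y2 t) \<in> borel_measurable borel"
    "(\<lambda>t. g1 t * y2 t + y1 t * g2 t) \<in> borel_measurable borel" by measurable
  show "bounded (range (\<lambda>t. y1 t * y2 t))" "bounded (range (\<lambda>t. g1 t * y2 t + y1 t * g2 t))"
    by (intro bounded_range_add bounded_range_mult bnd)+
  fix s t :: real assume st: "0 < s" "s \<le> t" "t < T"
  let ?I = "\<lambda>x::real. indicator {s..t} x :: real"
  let ?G1 = "\<lambda>x. ?I x *\<^sub>R g1 x" and ?G2 = "\<lambda>x. ?I x *\<^sub>R g2 x"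
  let ?f = "\<lambda>(x, y). indicator {p. fst p \<le> snd p} (x, y) *\<^sub>R (?G1 x * ?G2 y)"
  have int: "integrable lborel (\<lambda>x. ?I x *\<^sub>R f x)" if "f \<in> borel_measurable borel" "bounded (range f)" for f :: "real \<Rightarrow> complex"
    using set_integrable_bounded_borel[OF that] by (simp add: set_integrable_def)
  obtain B1 B2 where B: "\<And>x. norm (g1 x) \<le> B1" "\<And>x. norm (g2 x) \<le> B2"
    using bnd by (auto simp: bounded_iff)
  have "integrable (lborel \<Otimes>\<^sub>M lborel) ?f"
  proof (rule integrableI_bounded_set[where A = "{s..t} \<times> {s..t}" and B = "B1 * B2"])
    show "emeasure (lborel \<Otimes>\<^sub>M lborel) ({s..t} \<times> {s..t}) < \<infinity>"
      by (subst lborel.emeasure_pair_measure_Times) (auto simp: ennreal_mult_less_top emeasure_lborel_Icc_eq)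
    show "AE x in lborel \<Otimes>\<^sub>M lborel. x \<in> {s..t} \<times> {s..t} \<longrightarrow> norm (?f x) \<le> B1 * B2"
    proof (intro AE_I2 impI)
      fix z :: "real \<times> real"
      obtain x y where z: "z = (x, y)" by fastforce
      have "norm (?f z) \<le> norm (g1 x) * norm (g2 y)"
        by (auto simp: z norm_mult indicator_def)
      also have "\<dots> \<le> B1 * B2"
        by (intro mult_mono B) (auto intro: order_trans[OF norm_ge_zero B(1)])
      finally show "norm (?f z) \<le> B1 * B2" .
    qed
    show "AE x in lborel \<Otimes>\<^sub>M lborel. x \<notin> {s..t} \<times> {s..t} \<longrightarrow> ?f x = 0"
      by (intro AE_I2) (auto simp: indicator_def split: if_splits)
  qed measurable
  from lborel_pair.Fubini_integral[OF this]
  have fub: "(LINT y|lborel. LINT x|lborel. ?f (x, y)) = (LINT x|lborel. LINT y|lborel. ?f (x, y))" by simp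
  have inner1: "(LINT x|lborel. ?f (x, y)) = ?I y *\<^sub>R ((y1 y - y1 s) * g2 y)" for y
  proof (cases "y \<in> {s..t}")
    case True
    have "(LINT x|lborel. ?f (x, y)) = (LINT x|lborel. (indicator {s..y} x *\<^sub>R g1 x) * g2 y)"
      using True by (intro Bochner_Integration.integral_cong) (auto split: split_indicator)
    also have "\<dots> = (LINT x:{s..y}|lborel. g1 x) * g2 y"
      unfolding set_lebesgue_integral_def by (rule integral_mult_left_zero)
    also have "(LINT x:{s..y}|lborel. g1 x) = y1 y - y1 s"
      using 1 st True by (auto simp: is_primitive_def)
    finally show ?thesis using True by simp
  qed simp
  have inner2: "(LINT y|lborel. ?f (x, y)) = ?I x *\<^sub>R (g1 x * (y2 t - y2 x))" for x
  proof (cases "x \<in> {s..t}")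
    case True
    have "(LINT y|lborel. ?f (x, y)) = (LINT y|lborel. g1 x * (indicator {x..t} y *\<^sub>R g2 y))"
      using True by (intro Bochner_Integration.integral_cong) (auto split: split_indicator)
    also have "\<dots> = g1 x * (LINT y:{x..t}|lborel. g2 y)"
      unfolding set_lebesgue_integral_def by (rule integral_mult_right_zero)
    also have "(LINT y:{x..t}|lborel. g2 y) = y2 t - y2 x"
      using 2 st True by (auto simp: is_primitive_def)
    finally show ?thesis using True by simp
  qed simp
  let ?L = "\<lambda>f. LINT x|lborel. ?I x *\<^sub>R f x"
  have L1: "(LINT x|lborel. ?I x *\<^sub>R ((y1 x - y1 s) * g2 x)) = ?L (\<lambda>x. y1 x * g2 x) - y1 s * ?L g2"
  proof -
    have "(LINT x|lborel. ?I x *\<^sub>R ((y1 x - y1 s) * g2 x)) = (LINT x|lborel. ?I x *\<^sub>R (y1 x * g2 x) - y1 s * (?I x *\<^sub>R g2 x))"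
      by (intro Bochner_Integration.integral_cong) (auto simp: algebra_simps)
    also have "\<dots> = ?L (\<lambda>x. y1 x * g2 x) - (LINT x|lborel. y1 s * (?I x *\<^sub>R g2 x))"
      by (intro Bochner_Integration.integral_diff int integrable_mult_right bounded_range_mult bnd) measurable
    finally show ?thesis by (simp only: integral_mult_right_zero)
  qed
  have L2: "(LINT x|lborel. ?I x *\<^sub>R (g1 x * (y2 t - y2 x))) = ?L g1 * y2 t - ?L (\<lambda>x. g1 x * y2 x)"
  proof -
    have "(LINT x|lborel. ?I x *\<^sub>R (g1 x * (y2 t - y2 x))) = (LINT x|lborel. (?I x *\<^sub>R g1 x) * y2 t - ?I x *\<^sub>R (g1 x * y2 x))"
      by (intro Bochner_Integration.integral_cong) (auto simp: algebra_simps)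
    also have "\<dots> = (LINT x|lborel. (?I x *\<^sub>R g1 x) * y2 t) - ?L (\<lambda>x. g1 x * y2 x)"
      by (intro Bochner_Integration.integral_diff int integrable_mult_left bounded_range_mult bnd) measurable
    finally show ?thesis by (simp only: integral_mult_left_zero)
  qed
  have P: "?L g1 = y1 t - y1 s" "?L g2 = y2 t - y2 s"
    using 1 2 st by (auto simp: is_primitive_def set_lebesgue_integral_def)
  have "(LINT x:{s..t}|lborel. g1 x * y2 x + y1 x * g2 x) = ?L (\<lambda>x. g1 x * y2 x) + ?L (\<lambda>x. y1 x * g2 x)"
    unfolding set_lebesgue_integral_def scaleR_add_right
    by (intro Bochner_Integration.integral_add int bounded_range_mult bnd) measurable
  also have "?L (\<lambda>x. y1 x * g2 x) = ?L g1 * y2 t - ?L (\<lambda>x. g1 x * y2 x) + y1 s * ?L g2"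
    using fub unfolding inner1 inner2 L1 L2 by (simp add: algebra_simps)
  finally show "y1 t * y2 t - y1 s * y2 s = (LINT x:{s..t}|lborel. g1 x * y2 x + y1 x * g2 x)"
    unfolding P by (simp add: algebra_simps)
qed

section \<open>Sums with time-dependent coefficients\<close>

abbreviation ivl :: "real \<Rightarrow> real \<Rightarrow> real measure" where
  "ivl a b \<equiv> restrict_space lborel {a<..<b}"

lemma borel_measurable_ivl: "f \<in> borel_measurable borel \<Longrightarrow> f \<in> borel_measurable (ivl a b)"
  by (intro measurable_restrict_space1) simp

lemma nn_integral_ivl: "(\<integral>\<^sup>+x. f x \<partial>ivl a b) = (\<integral>\<^sup>+x\<in>{a<..<b}. f x \<partial>lborel)"
  by (rule nn_integral_restrict_space) simp

lemma nn_integral_ivl_split: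
  assumes [measurable]: "f \<in> borel_measurable borel" and "a \<le> b" "b \<le> c"
  shows "(\<integral>\<^sup>+x. f x \<partial>ivl a c) = (\<integral>\<^sup>+x. f x \<partial>ivl a b) + (\<integral>\<^sup>+x. f x \<partial>ivl b c)"
proof -
  have "(\<integral>\<^sup>+x. f x \<partial>ivl a c) = (\<integral>\<^sup>+x. f x * indicator {a<..<b} x + f x * indicator {b<..<c} x \<partial>lborel)"
    unfolding nn_integral_ivl
  proof (rule nn_integral_cong_AE, rule eventually_mono[OF AE_lborel_singleton[of b]])
    fix x assume "x \<noteq> b"
    with assms(2,3) show "f x * indicator {a<..<c} x = f x * indicator {a<..<b} x + f x * indicator {b<..<c} x"
      by (cases "x < b") (auto simp: indicator_def)
  qed
  also have "\<dots> = (\<integral>\<^sup>+x. f x \<partial>ivl a b) + (\<integral>\<^sup>+x. f x \<partial>ivl b c)"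
    unfolding nn_integral_ivl by (rule nn_integral_add) measurable
  finally show ?thesis .
qed

lemma nn_integral_ivl_chop:
  assumes "f \<in> borel_measurable borel" "g \<in> borel_measurable borel" "0 \<le> \<delta>"
    and "\<And>k. k < n \<Longrightarrow> (\<integral>\<^sup>+x. f x \<partial>ivl (real k * \<delta>) (real k * \<delta> + \<delta>)) \<le> (\<integral>\<^sup>+x. g x \<partial>ivl (real k * \<delta>) (real k * \<delta> + \<delta>))"
  shows "(\<integral>\<^sup>+x. f x \<partial>ivl 0 (real n * \<delta>)) \<le> (\<integral>\<^sup>+x. g x \<partial>ivl 0 (real n * \<delta>))"
  using assms(4)
proof (induction n)
  case 0
  show ?case by (simp add: nn_integral_empty)
next
  case (Suc n)
  have "real (Suc n) * \<delta> = real n * \<delta> + \<delta>" by (simp add: algebra_simps)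
  moreover have "0 \<le> real n * \<delta>" using assms by simp
  ultimately show ?case
    using Suc assms by (simp add: nn_integral_ivl_split[of _ 0 "real n * \<delta>" "real n * \<delta> + \<delta>"] add_mono)
qed

text \<open>The interval is mapped affinely onto ]-1/2, 1/2[, where 1 - x^2 \<ge> 3/4; the factor
  4/3 turns 288 into 384. Recentring multiplies each coefficient by a number of modulus one, and
  windows of length \<open>1 / \<delta>\<close> for \<open>h\<close> become unit windows for
  \<open>\<delta> * h\<close>.\<close>

lemma large_sieve_interval:
  fixes h :: "'a \<Rightarrow> real" and c :: "'a \<Rightarrow> complex"
  assumes fin: "finite S" and \<delta>: "0 < \<delta>"
    and K: "\<And>x. real (card {m \<in> S. x \<le> h m \<and> h m \<le> x + 1 / \<delta>}) \<le> K"
  shows "(\<integral>\<^sup>+t. ennreal ((cmod (\<Sum>m\<in>S. c m * cis (h m * t)))\<^sup>2) \<partial>ivl a (a + \<delta>))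
    \<le> ennreal (384 * \<delta> * K * (\<Sum>m\<in>S. (cmod (c m))\<^sup>2))"
proof -
  define F where "F = (\<lambda>t. \<Sum>m\<in>S. c m * cis (h m * t))"
  define c' where "c' = (\<lambda>m. c m * cis (h m * (a + \<delta> / 2)))"
  define F' where "F' = (\<lambda>x. \<Sum>m\<in>S. c' m * cis ((\<delta> * h m) * x))"
  have cF: "continuous_on UNIV F" unfolding F_def by (intro continuous_intros)
  hence [measurable]: "F \<in> borel_measurable borel" by (rule borel_measurable_continuous_onI)
  have FF': "F ((a + \<delta> / 2) + \<delta> * x) = F' x" for x
    unfolding F_def F'_def c'_def
  proof (intro sum.cong refl)
    fix m
    have "h m * (a + \<delta> / 2 + \<delta> * x) = h m * (a + \<delta> / 2) + \<delta> * h m * x" by (simp add: algebra_simps)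
    thus "c m * cis (h m * (a + \<delta> / 2 + \<delta> * x)) = c m * cis (h m * (a + \<delta> / 2)) * cis (\<delta> * h m * x)"
      by (simp only: mult.assoc cis_mult)
  qed
  have K': "real (card {m \<in> S. x \<le> \<delta> * h m \<and> \<delta> * h m \<le> x + 1}) \<le> K" for x
  proof -
    have "x \<le> \<delta> * h m \<longleftrightarrow> x / \<delta> \<le> h m" "\<delta> * h m \<le> x + 1 \<longleftrightarrow> h m \<le> x / \<delta> + 1 / \<delta>" for m
      using \<delta> by (simp_all add: divide_le_eq le_divide_eq mult.commute flip: add_divide_distrib)
    thus ?thesis using K[of "x / \<delta>"] by simp
  qed
  let ?I = "integral {-1..1} (\<lambda>t. (1 - t\<^sup>2) * (cmod (F' t))\<^sup>2)"
  have I: "?I \<le> 288 * K * (\<Sum>m\<in>S. (cmod (c m))\<^sup>2)"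
    using large_sieve_unit[OF fin K', of c'] by (simp add: F'_def c'_def norm_mult)
  have "(\<integral>\<^sup>+t. ennreal ((cmod (F t))\<^sup>2) \<partial>ivl a (a + \<delta>))
      = ennreal \<delta> * (\<integral>\<^sup>+x. ennreal ((cmod (F' x))\<^sup>2) * indicator {a<..<a + \<delta>} (a + \<delta> / 2 + \<delta> * x) \<partial>lborel)"
    unfolding nn_integral_ivl FF'[symmetric]
    using \<delta> by (subst nn_integral_real_affine[where c = \<delta> and t = "a + \<delta> / 2"]) auto
  also have "\<dots> \<le> ennreal \<delta> * (\<integral>\<^sup>+x. ennreal (4 / 3 * ((1 - x\<^sup>2) * (cmod (F' x))\<^sup>2)) * indicator {-1..1} x \<partial>lborel)"
  proof (intro mult_left_mono nn_integral_mono)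
    fix x :: real
    show "ennreal ((cmod (F' x))\<^sup>2) * indicator {a<..<a + \<delta>} (a + \<delta> / 2 + \<delta> * x)
        \<le> ennreal (4 / 3 * ((1 - x\<^sup>2) * (cmod (F' x))\<^sup>2)) * indicator {-1..1} x"
    proof (cases "a + \<delta> / 2 + \<delta> * x \<in> {a<..<a + \<delta>}")
      case True
      hence "\<delta> * x < \<delta> / 2" "- \<delta> / 2 < \<delta> * x"
        unfolding greaterThanLessThan_iff by linarith+
      hence "\<delta> * x < \<delta> * (1 / 2)" "\<delta> * (- 1 / 2) < \<delta> * x" by (simp_all only: mult_1_right mult_minus_right times_divide_eq_right)
      hence x: "x < 1 / 2" "- 1 / 2 < x" by (simp_all only: mult_less_cancel_left_pos[OF \<delta>])
      hence "\<bar>x\<bar> \<le> 1 / 2" by auto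
      hence "\<bar>x\<bar>\<^sup>2 \<le> (1 / 2)\<^sup>2" by (intro power_mono) auto
      hence "1 \<le> 4 / 3 * (1 - x\<^sup>2)" by (simp add: power2_eq_square)
      from mult_right_mono[OF this zero_le_power2[of "cmod (F' x)"]]
      have "(cmod (F' x))\<^sup>2 \<le> 4 / 3 * ((1 - x\<^sup>2) * (cmod (F' x))\<^sup>2)" by (simp only: mult_1_left mult.assoc)
      moreover have "x \<in> {-1..1}" using x by simp
      ultimately show ?thesis using True by (simp only: indicator_simps mult_1_right ennreal_leI)
    qed simp
  qed simp
  also have "\<dots> = ennreal \<delta> * ennreal (4 / 3 * ?I)"
  proof -
    have "((\<lambda>x. 4 / 3 * ((1 - x\<^sup>2) * (cmod (F' x))\<^sup>2)) has_integral 4 / 3 * ?I) {-1..1}"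
      unfolding F'_def
      by (intro has_integral_mult_right integrable_integral integrable_continuous_real continuous_intros)
    moreover have "0 \<le> 4 / 3 * ((1 - x\<^sup>2) * (cmod (F' x))\<^sup>2)" if "x \<in> {-1..1}" for x
      using that abs_square_le_1[of x] by auto
    ultimately have "(\<integral>\<^sup>+x. ennreal (4 / 3 * ((1 - x\<^sup>2) * (cmod (F' x))\<^sup>2)) * indicator {-1..1} x \<partial>lborel) = ennreal (4 / 3 * ?I)"
      by (intro nn_integral_has_integral_lebesgue')
    thus ?thesis by (simp only:)
  qed
  also have "\<dots> \<le> ennreal (384 * \<delta> * K * (\<Sum>m\<in>S. (cmod (c m))\<^sup>2))"
    using I \<delta> by (subst ennreal_mult'[symmetric]) (auto intro!: ennreal_leI simp: mult_ac)
  finally show ?thesis by (simp add: F_def)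
qed

lemma ennreal_norm_integral_sq_le:
  fixes g :: "real \<Rightarrow> complex"
  assumes [measurable]: "g \<in> borel_measurable borel" and "bounded (range g)"
    and "{s..t} \<subseteq> {a<..<b}"
  shows "ennreal ((cmod (LINT x:{s..t}|lborel. g x))\<^sup>2)
    \<le> ennreal (b - a) * (\<integral>\<^sup>+x. ennreal ((cmod (g x))\<^sup>2) \<partial>ivl a b)"
proof (cases "a \<le> b")
  case True
  have "ennreal (cmod (LINT x:{s..t}|lborel. g x)) \<le> (\<integral>\<^sup>+x. ennreal (cmod (indicator {s..t} x *\<^sub>R g x)) \<partial>lborel)"
    unfolding set_lebesgue_integral_def
    using set_integrable_bounded_borel[OF assms(1,2)] unfolding set_integrable_def
    by (rule integral_norm_bound_ennreal)
  also have "\<dots> \<le> (\<integral>\<^sup>+x. ennreal (cmod (g x)) * indicator {a<..<b} x * indicator {a<..<b} x \<partial>lborel)"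
    using assms(3) by (intro nn_integral_mono) (auto split: split_indicator)
  finally have "(ennreal (cmod (LINT x:{s..t}|lborel. g x)))\<^sup>2
    \<le> (\<integral>\<^sup>+x. ennreal (cmod (g x)) * indicator {a<..<b} x * indicator {a<..<b} x \<partial>lborel)\<^sup>2"
    by (intro power_mono) auto
  also have "\<dots> \<le> (\<integral>\<^sup>+x. (ennreal (cmod (g x)) * indicator {a<..<b} x)\<^sup>2 \<partial>lborel) * (\<integral>\<^sup>+x. (indicator {a<..<b} x)\<^sup>2 \<partial>lborel)"
    by (rule Cauchy_Schwarz_nn_integral) measurable
  also have "(\<integral>\<^sup>+x. (indicator {a<..<b} x)\<^sup>2 \<partial>lborel) = (\<integral>\<^sup>+x. indicator {a<..<b} x \<partial>lborel)"
    by (intro nn_integral_cong) (auto split: split_indicator)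
  also have "\<dots> = ennreal (b - a)" using True by simp
  also have "(\<integral>\<^sup>+x. (ennreal (cmod (g x)) * indicator {a<..<b} x)\<^sup>2 \<partial>lborel) = (\<integral>\<^sup>+x. ennreal ((cmod (g x))\<^sup>2) \<partial>ivl a b)"
    unfolding nn_integral_ivl
    by (intro nn_integral_cong) (auto simp: ennreal_power split: split_indicator)
  finally show ?thesis by (simp add: ennreal_power mult.commute)
next
  case False
  hence "\<not> s \<le> t" using assms(3) by auto
  thus ?thesis by (simp add: set_lebesgue_integral_def)
qed

lemma is_primitive_diff_sq_le:
  assumes "is_primitive T y g" "0 \<le> a" "b \<le> T" "s \<in> {a<..<b}" "t \<in> {a<..<b}"
  shows "ennreal ((cmod (y t - y s))\<^sup>2) \<le> ennreal (b - a) * (\<integral>\<^sup>+x. ennreal ((cmod (g x))\<^sup>2) \<partial>ivl a b)"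
proof -
  have *: "ennreal ((cmod (y t - y s))\<^sup>2) \<le> ennreal (b - a) * (\<integral>\<^sup>+x. ennreal ((cmod (g x))\<^sup>2) \<partial>ivl a b)"
    if "s \<le> t" "s \<in> {a<..<b}" "t \<in> {a<..<b}" for s t
  proof -
    have "y t - y s = (LINT x:{s..t}|lborel. g x)" using that assms by (auto simp: is_primitive_def)
    moreover have "g \<in> borel_measurable borel" "bounded (range g)" using assms by (auto simp: is_primitive_def)
    moreover have "{s..t} \<subseteq> {a<..<b}" using that by auto
    ultimately show ?thesis using ennreal_norm_integral_sq_le by metis
  qed
  show ?thesis using *[of s t] *[of t s] assms by (cases "s \<le> t") (auto simp: norm_minus_commute)
qed

text \<open>
  Freezing the coefficients at a time \<open>s\<close> and averaging over \<open>s\<close> costs one time derivative, as in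
  the Sobolev embedding of \<open>H\<^sup>1\<close> into \<open>L\<^sup>\<infinity>\<close>; the large sieve handles the frozen sums.
\<close>

lemma sobolev_sieve:
  fixes h :: "'a \<Rightarrow> real" and c d :: "'a \<Rightarrow> real \<Rightarrow> complex"
  assumes fin: "finite S" and \<delta>: "0 < \<delta>" and a: "0 \<le> a" "a + \<delta> \<le> T"
    and prim: "\<And>m. m \<in> S \<Longrightarrow> is_primitive T (c m) (d m)"
    and K: "\<And>x. real (card {m \<in> S. x \<le> h m \<and> h m \<le> x + 1 / \<delta>}) \<le> K"
  shows "(\<integral>\<^sup>+t. ennreal ((cmod (\<Sum>m\<in>S. c m t * cis (h m * t)))\<^sup>2) \<partial>ivl a (a + \<delta>))
    \<le> ennreal (768 * K) * (\<integral>\<^sup>+t. ennreal ((\<Sum>m\<in>S. (cmod (c m t))\<^sup>2) + \<delta>\<^sup>2 * (\<Sum>m\<in>S. (cmod (d m t))\<^sup>2)) \<partial>ivl a (a + \<delta>))"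
proof -
  let ?M = "ivl a (a + \<delta>)"
  have "0 \<le> K" using K[of 0] by linarith
  interpret M: sigma_finite_measure ?M
    by (rule sigma_finite_measure_restrict_space) (auto intro: lborel.sigma_finite_measure_axioms)
  interpret MM: pair_sigma_finite ?M ?M ..
  have eM: "emeasure ?M (space ?M) = ennreal \<delta>"
    using \<delta> by (simp add: emeasure_restrict_space space_restrict_space)
  have cd: "c m \<in> borel_measurable borel" "d m \<in> borel_measurable borel" if "m \<in> S" for m
    using prim[OF that] by (auto simp: is_primitive_def)
  \<comment> \<open>Two independent times: \<open>t\<close> in the exponentials and \<open>s\<close>
    in the coefficients. The sum to be estimated is the diagonal \<open>F t t\<close>, and
    \<open>D t\<close> is the derivative of \<open>F t\<close> in the second time.\<close>
  define F where "F = (\<lambda>t s. \<Sum>m\<in>S. c m s * cis (h m * t))"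
  define D where "D = (\<lambda>t s. \<Sum>m\<in>S. d m s * cis (h m * t))"
  have cis_meas: "(\<lambda>t::real. cis (w * t)) \<in> borel_measurable borel" for w
    by (intro borel_measurable_continuous_onI continuous_intros)
  have meas2: "(\<lambda>(t, s). ennreal ((cmod (\<Sum>m\<in>S. f m s * cis (h m * t)))\<^sup>2)) \<in> borel_measurable (?M \<Otimes>\<^sub>M ?M)"
    if f: "\<And>m. m \<in> S \<Longrightarrow> f m \<in> borel_measurable borel" for f
  proof -
    have 1: "(\<lambda>z. cis (h m * fst z)) \<in> borel_measurable (?M \<Otimes>\<^sub>M ?M)" for m
      by (rule measurable_compose[OF measurable_fst]) (intro measurable_restrict_space1, simp add: cis_meas)
    have 2: "(\<lambda>z. f m (snd z)) \<in> borel_measurable (?M \<Otimes>\<^sub>M ?M)" if "m \<in> S" for m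
      by (rule measurable_compose[OF measurable_snd]) (intro measurable_restrict_space1, simp add: f that)
    have "(\<lambda>z. \<Sum>m\<in>S. f m (snd z) * cis (h m * fst z)) \<in> borel_measurable (?M \<Otimes>\<^sub>M ?M)"
      by (intro borel_measurable_sum borel_measurable_times 1 2)
    thus ?thesis by (simp add: split_beta)
  qed
  \<comment> \<open>After Tonelli the integral in \<open>t\<close> is the inner one. The
    coefficients at time \<open>s\<close> are then constants, and the large sieve applies with a
    \<open>K\<close> that does not depend on \<open>s\<close>.\<close>
  have sieve: "(\<integral>\<^sup>+t. (\<integral>\<^sup>+s. ennreal ((cmod (\<Sum>m\<in>S. f m s * cis (h m * t)))\<^sup>2) \<partial>?M) \<partial>?M)
      \<le> (\<integral>\<^sup>+s. ennreal (384 * \<delta> * K * (\<Sum>m\<in>S. (cmod (f m s))\<^sup>2)) \<partial>?M)"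
    if f: "\<And>m. m \<in> S \<Longrightarrow> f m \<in> borel_measurable borel" for f
  proof -
    have "(\<integral>\<^sup>+t. (\<integral>\<^sup>+s. ennreal ((cmod (\<Sum>m\<in>S. f m s * cis (h m * t)))\<^sup>2) \<partial>?M) \<partial>?M)
       = (\<integral>\<^sup>+s. (\<integral>\<^sup>+t. ennreal ((cmod (\<Sum>m\<in>S. f m s * cis (h m * t)))\<^sup>2) \<partial>?M) \<partial>?M)"
      using MM.Fubini'[OF meas2[OF f]] by simp
    also have "\<dots> \<le> (\<integral>\<^sup>+s. ennreal (384 * \<delta> * K * (\<Sum>m\<in>S. (cmod (f m s))\<^sup>2)) \<partial>?M)"
      by (intro nn_integral_mono large_sieve_interval fin \<delta> K)
    finally show ?thesis .
  qed
  define J where "J = (\<lambda>t. \<integral>\<^sup>+s. ennreal ((cmod (D t s))\<^sup>2) \<partial>?M)"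
  define G where "G = (\<lambda>t. \<integral>\<^sup>+s. ennreal ((cmod (F t s))\<^sup>2) \<partial>?M)"
  have JG[measurable]: "J \<in> borel_measurable ?M" "G \<in> borel_measurable ?M"
    unfolding J_def D_def G_def F_def using cd
    by (auto intro!: M.borel_measurable_nn_integral meas2)
  \<comment> \<open>The price of moving the coefficients from time \<open>t\<close> to time
    \<open>s\<close>. The factor 2 from squaring a sum of two terms later doubles 384 to
    768.\<close>
  have pt: "ennreal ((cmod (F t t))\<^sup>2) \<le> 2 * ennreal ((cmod (F t s))\<^sup>2) + 2 * (ennreal \<delta> * J t)"
    if ts: "t \<in> {a<..<a + \<delta>}" "s \<in> {a<..<a + \<delta>}" for t s
  proof -
    have "is_primitive T (\<lambda>s. \<Sum>m\<in>S. cis (h m * t) * c m s) (\<lambda>s. \<Sum>m\<in>S. cis (h m * t) * d m s)"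
      by (intro is_primitive_sum is_primitive_cmult fin prim)
    hence "is_primitive T (F t) (D t)" by (simp add: F_def D_def mult.commute)
    from is_primitive_diff_sq_le[OF this a ts(2,1)]
    have diff: "ennreal ((cmod (F t t - F t s))\<^sup>2) \<le> ennreal \<delta> * J t" by (simp add: J_def)
    have "cmod (F t t) \<le> cmod (F t s) + cmod (F t t - F t s)"
      by (metis add.commute diff_add_cancel norm_triangle_ineq)
    hence "(cmod (F t t))\<^sup>2 \<le> (cmod (F t s) + cmod (F t t - F t s))\<^sup>2" by (intro power_mono) auto
    also have "\<dots> \<le> 2 * (cmod (F t s))\<^sup>2 + 2 * (cmod (F t t - F t s))\<^sup>2"
      using sum_squares_bound[of "cmod (F t s)" "cmod (F t t - F t s)"] by (simp add: power2_sum)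
    finally have "ennreal ((cmod (F t t))\<^sup>2) \<le> ennreal (2 * (cmod (F t s))\<^sup>2 + 2 * (cmod (F t t - F t s))\<^sup>2)"
      by (rule ennreal_leI)
    also have "\<dots> = 2 * ennreal ((cmod (F t s))\<^sup>2) + 2 * ennreal ((cmod (F t t - F t s))\<^sup>2)"
      by (simp add: ennreal_plus ennreal_mult)
    also have "\<dots> \<le> 2 * ennreal ((cmod (F t s))\<^sup>2) + 2 * (ennreal \<delta> * J t)"
      by (intro add_left_mono mult_left_mono diff) auto
    finally show ?thesis .
  qed
  \<comment> \<open>Integration over \<open>s\<close> produces the factor \<delta> on the left; it
    is cancelled at the end against the \<delta> gained in the large sieve.\<close>
  have avg: "ennreal \<delta> * ennreal ((cmod (F t t))\<^sup>2) \<le> 2 * G t + 2 * ennreal \<delta> * ennreal \<delta> * J t"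
    if t: "t \<in> {a<..<a + \<delta>}" for t
  proof -
    have [measurable]: "(\<lambda>s. ennreal ((cmod (F t s))\<^sup>2)) \<in> borel_measurable ?M"
      using cd unfolding F_def by (intro measurable_restrict_space1) auto
    have "ennreal \<delta> * ennreal ((cmod (F t t))\<^sup>2) = (\<integral>\<^sup>+s. ennreal ((cmod (F t t))\<^sup>2) \<partial>?M)"
      by (subst nn_integral_const) (simp only: eM mult.commute)
    also have "\<dots> \<le> (\<integral>\<^sup>+s. 2 * ennreal ((cmod (F t s))\<^sup>2) + 2 * (ennreal \<delta> * J t) \<partial>?M)"
      by (intro nn_integral_mono pt t) (simp add: space_restrict_space)
    also have "\<dots> = (\<integral>\<^sup>+s. 2 * ennreal ((cmod (F t s))\<^sup>2) \<partial>?M) + (\<integral>\<^sup>+s. 2 * (ennreal \<delta> * J t) \<partial>?M)"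
      by (rule nn_integral_add) measurable
    also have "\<dots> = 2 * G t + 2 * (ennreal \<delta> * J t) * ennreal \<delta>"
      unfolding G_def by (simp only: nn_integral_const eM) (subst nn_integral_cmult, measurable)
    finally show ?thesis by (simp add: mult_ac)
  qed
  let ?R = "\<integral>\<^sup>+t. ennreal ((\<Sum>m\<in>S. (cmod (c m t))\<^sup>2) + \<delta>\<^sup>2 * (\<Sum>m\<in>S. (cmod (d m t))\<^sup>2)) \<partial>?M"
  have Smeas[measurable]: "(\<lambda>s. ennreal (\<Sum>m\<in>S. (cmod (f m s))\<^sup>2)) \<in> borel_measurable ?M"
    if "\<And>m. m \<in> S \<Longrightarrow> f m \<in> borel_measurable borel" for f :: "'a \<Rightarrow> real \<Rightarrow> complex"
    using that by (intro measurable_restrict_space1) auto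
  have [measurable]: "(\<lambda>t. ennreal ((cmod (F t t))\<^sup>2)) \<in> borel_measurable ?M"
    using cd cis_meas unfolding F_def by (intro measurable_restrict_space1) auto
  have "ennreal \<delta> * (\<integral>\<^sup>+t. ennreal ((cmod (F t t))\<^sup>2) \<partial>?M) = (\<integral>\<^sup>+t. ennreal \<delta> * ennreal ((cmod (F t t))\<^sup>2) \<partial>?M)"
    by (rule nn_integral_cmult[symmetric]) measurable
  also have "\<dots> \<le> (\<integral>\<^sup>+t. 2 * G t + 2 * ennreal \<delta> * ennreal \<delta> * J t \<partial>?M)"
    by (intro nn_integral_mono avg) (simp add: space_restrict_space)
  also have "\<dots> = 2 * (\<integral>\<^sup>+t. G t \<partial>?M) + 2 * ennreal \<delta> * ennreal \<delta> * (\<integral>\<^sup>+t. J t \<partial>?M)"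
    by (simp add: nn_integral_add nn_integral_cmult)
  also have "\<dots> \<le> 2 * (\<integral>\<^sup>+s. ennreal (384 * \<delta> * K * (\<Sum>m\<in>S. (cmod (c m s))\<^sup>2)) \<partial>?M)
      + 2 * ennreal \<delta> * ennreal \<delta> * (\<integral>\<^sup>+s. ennreal (384 * \<delta> * K * (\<Sum>m\<in>S. (cmod (d m s))\<^sup>2)) \<partial>?M)"
    unfolding G_def J_def F_def D_def by (intro add_mono mult_left_mono sieve cd) auto
  also have "\<dots> = ennreal (384 * \<delta> * K) * (2 * (\<integral>\<^sup>+s. ennreal (\<Sum>m\<in>S. (cmod (c m s))\<^sup>2) \<partial>?M)
      + 2 * ennreal \<delta> * ennreal \<delta> * (\<integral>\<^sup>+s. ennreal (\<Sum>m\<in>S. (cmod (d m s))\<^sup>2) \<partial>?M))"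
  proof -
    have "(\<integral>\<^sup>+s. ennreal (384 * \<delta> * K * (\<Sum>m\<in>S. (cmod (f m s))\<^sup>2)) \<partial>?M)
        = ennreal (384 * \<delta> * K) * (\<integral>\<^sup>+s. ennreal (\<Sum>m\<in>S. (cmod (f m s))\<^sup>2) \<partial>?M)"
      if "\<And>m. m \<in> S \<Longrightarrow> f m \<in> borel_measurable borel" for f :: "'a \<Rightarrow> real \<Rightarrow> complex"
      using Smeas[OF that] \<delta> \<open>0 \<le> K\<close>
      by (subst nn_integral_cmult[symmetric]) (auto simp: ennreal_mult sum_nonneg)
    thus ?thesis using cd by (simp only: distrib_left mult_ac)
  qed
  also have "\<dots> = ennreal (384 * \<delta> * K) * (2 * ?R)"
  proof -
    have "?R = (\<integral>\<^sup>+t. ennreal (\<Sum>m\<in>S. (cmod (c m t))\<^sup>2) + ennreal \<delta> * ennreal \<delta> * ennreal (\<Sum>m\<in>S. (cmod (d m t))\<^sup>2) \<partial>?M)"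
      using \<delta> by (intro nn_integral_cong) (simp add: ennreal_plus ennreal_mult sum_nonneg power2_eq_square)
    also have "\<dots> = (\<integral>\<^sup>+s. ennreal (\<Sum>m\<in>S. (cmod (c m s))\<^sup>2) \<partial>?M)
      + ennreal \<delta> * ennreal \<delta> * (\<integral>\<^sup>+s. ennreal (\<Sum>m\<in>S. (cmod (d m s))\<^sup>2) \<partial>?M)"
      using cd by (subst nn_integral_add) (auto simp: nn_integral_cmult Smeas)
    finally show ?thesis by (simp add: distrib_left mult_ac)
  qed
  also have "\<dots> = ennreal \<delta> * (ennreal (768 * K) * ?R)"
  proof -
    have "ennreal (384 * \<delta> * K) * 2 = ennreal \<delta> * ennreal (768 * K)"
      using \<delta> \<open>0 \<le> K\<close> by (simp add: ennreal_mult''[symmetric] ennreal_numeral[symmetric] mult_ac del: ennreal_numeral)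
    thus ?thesis by (simp add: mult.assoc[symmetric])
  qed
  finally have "ennreal \<delta> * (\<integral>\<^sup>+t. ennreal ((cmod (F t t))\<^sup>2) \<partial>?M) \<le> ennreal \<delta> * (ennreal (768 * K) * ?R)" .
  hence "(\<integral>\<^sup>+t. ennreal ((cmod (F t t))\<^sup>2) \<partial>?M) \<le> ennreal (768 * K) * ?R"
    using \<delta> by (subst (asm) ennreal_mult_le_mult_iff) auto
  thus ?thesis by (simp add: F_def)
qed

section \<open>The bilinear estimate for Fourier coefficients\<close>

text \<open>The map (\<xi>, n) to (n, \<xi> - n) is injective, so summing over output modes meets
  every pair of inputs at most once.\<close>

lemma sum_convolution_le:
  fixes f g :: "int \<Rightarrow> real"
  assumes fin: "finite Z1" "finite Z2" "finite X"
    and nonneg: "\<And>n. 0 \<le> f n" "\<And>n. 0 \<le> g n"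
  shows "(\<Sum>\<xi>\<in>X. \<Sum>n | n \<in> Z1 \<and> \<xi> - n \<in> Z2. f n * g (\<xi> - n)) \<le> (\<Sum>n\<in>Z1. f n) * (\<Sum>n\<in>Z2. g n)"
proof -
  let ?S = "\<lambda>\<xi>. {n. n \<in> Z1 \<and> \<xi> - n \<in> Z2}"
  let ?i = "\<lambda>(\<xi>, n). (n, \<xi> - n)"
  have "(\<Sum>\<xi>\<in>X. \<Sum>n\<in>?S \<xi>. f n * g (\<xi> - n)) = (\<Sum>z\<in>Sigma X ?S. f (snd z) * g (fst z - snd z))"
    using fin by (subst sum.Sigma) (auto simp: split_beta)
  also have "\<dots> = (\<Sum>(n, m)\<in>?i ` Sigma X ?S. f n * g m)"
    by (subst sum.reindex) (auto simp: inj_on_def split_beta)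
  also have "\<dots> \<le> (\<Sum>(n, m)\<in>Z1 \<times> Z2. f n * g m)"
    using fin nonneg by (intro sum_mono2) auto
  finally show ?thesis by (simp add: sum_product sum.cartesian_product)
qed

lemma norm_sum_sq_le:
  fixes f g :: "'a \<Rightarrow> complex"
  shows "(cmod (\<Sum>n\<in>S. f n * g n))\<^sup>2 \<le> (\<Sum>n\<in>S. (cmod (f n))\<^sup>2) * (\<Sum>n\<in>S. (cmod (g n))\<^sup>2)"
proof -
  have "cmod (\<Sum>n\<in>S. f n * g n) \<le> (\<Sum>n\<in>S. cmod (f n) * cmod (g n))"
    by (rule sum_norm_le) (simp add: norm_mult)
  hence "(cmod (\<Sum>n\<in>S. f n * g n))\<^sup>2 \<le> (\<Sum>n\<in>S. cmod (f n) * cmod (g n))\<^sup>2"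
    by (intro power_mono) auto
  also have "\<dots> \<le> (\<Sum>n\<in>S. (cmod (f n))\<^sup>2) * (\<Sum>n\<in>S. (cmod (g n))\<^sup>2)"
    by (rule Cauchy_Schwarz_ineq_sum)
  finally show ?thesis .
qed

context convex_symbol
begin

text \<open>The constant of \<open>card_opposite_sign\<close> for M = N/2: its coefficient
  \<open>c / 2 * (M / 2) powr (\<alpha> - 1)\<close> equals \<open>\<kappa>\<close> times
  N^(\<alpha>-1).\<close>

definition \<kappa> :: real where "\<kappa> = c / 2 * (1 / 4) powr (\<alpha> - 1)"
text \<open>The bound of \<open>card_window\<close> for D = (1/\<kappa> + 1) Q, divided by Q after
  its constant terms have been enlarged by the factor Q \<ge> 1.\<close>

definition card_const :: real where "card_const = 6 * (1 / \<kappa> + 1) + 4 * \<xi>\<^sub>0 + 8"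

lemma \<kappa>_pos: "0 < \<kappa>" using c_pos by (simp add: \<kappa>_def)

lemma card_const_pos: "0 < card_const" using \<kappa>_pos \<xi>\<^sub>0_pos by (simp add: card_const_def add_pos_pos)

text \<open>The window length is N/T = N^(\<alpha>-1) Q^2. For D = E Q both conditions of
  \<open>card_window\<close> lose their powers of N and Q and become lower bounds on E; for opposite
  signs, Q \<le> |\<xi>| supplies the missing factor Q.\<close>

lemma card_phase_window:
  fixes N T Q :: real
  assumes N: "0 < N" and T: "0 < T" and Q: "1 \<le> Q" "Q\<^sup>2 = N powr (2 - \<alpha>) / T" "Q \<le> \<bar>of_int \<xi>\<bar>"
    and fin: "finite S" and S: "\<And>n. n \<in> S \<Longrightarrow> N / 2 \<le> max \<bar>of_int n\<bar> \<bar>of_int (\<xi> - n)\<bar>"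
  shows "real (card {n \<in> S. x \<le> phase \<xi> n \<and> phase \<xi> n \<le> x + N / T}) \<le> card_const * Q"
proof -
  \<comment> \<open>The summand \<open>1 / \<kappa>\<close> ensures \<kappa> E \<ge> 1, and the
    summand 1 ensures E \<ge> 1, so that E \<le> E^2 in the quadratic condition.\<close>
  define E where "E = 1 / \<kappa> + 1"
  have E: "1 \<le> E" "1 / \<kappa> \<le> E" using \<kappa>_pos by (auto simp: E_def)
  have R: "N / T = N powr (\<alpha> - 1) * Q\<^sup>2"
    using N by (simp add: Q(2) powr_add[symmetric])
  have "0 < Q" using Q by simp
  have "\<kappa> * E \<ge> 1" using E(2) \<kappa>_pos by (simp add: divide_le_eq mult.commute)
  have pw: "(N / 2 / 2) powr (\<alpha> - 1) = (1 / 4) powr (\<alpha> - 1) * N powr (\<alpha> - 1)"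
    "(N / 2) powr (\<alpha> - 1) = (1 / 2) powr (\<alpha> - 1) * N powr (\<alpha> - 1)"
    using N powr_mult[of "1/4" N "\<alpha> - 1"] powr_mult[of "1/2" N "\<alpha> - 1"] by simp_all
  have "real (card {n \<in> S. x \<le> phase \<xi> n \<and> phase \<xi> n \<le> x + N / T}) \<le> 6 * (E * Q) + 4 * \<xi>\<^sub>0 + 8"
  proof (rule card_window[of _ "N / 2" "N / T" \<xi> x])
    show "2 * (N / T) \<le> c * (N / 2) powr (\<alpha> - 1) * (E * Q)\<^sup>2"
    proof -
      have "1 \<le> c / 2 * (1 / 2) powr (\<alpha> - 1) * E"
      proof -
        have "\<kappa> \<le> c / 2 * (1 / 2) powr (\<alpha> - 1)"
          unfolding \<kappa>_def using c_pos \<alpha>_ge by (intro mult_left_mono powr_mono2) auto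
        from mult_right_mono[OF this, of E] show ?thesis using \<open>\<kappa> * E \<ge> 1\<close> E by linarith
      qed
      also have "\<dots> \<le> c / 2 * (1 / 2) powr (\<alpha> - 1) * E\<^sup>2"
        using E c_pos by (intro mult_left_mono) (auto simp: power2_eq_square)
      finally have "2 \<le> c * (1 / 2) powr (\<alpha> - 1) * E\<^sup>2" by simp
      from mult_right_mono[OF this, of "N powr (\<alpha> - 1) * Q\<^sup>2"]
      show ?thesis unfolding R pw by (simp add: power_mult_distrib mult_ac)
    qed
    show "N / T \<le> c / 2 * (N / 2 / 2) powr (\<alpha> - 1) * \<bar>real_of_int \<xi>\<bar> * (E * Q)"
    proof -
      have "Q\<^sup>2 \<le> \<bar>real_of_int \<xi>\<bar> * Q"
        unfolding power2_eq_square using Q(1,3) by (intro mult_right_mono) auto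
      hence "N powr (\<alpha> - 1) * Q\<^sup>2 * 1 \<le> N powr (\<alpha> - 1) * (\<bar>real_of_int \<xi>\<bar> * Q) * (\<kappa> * E)"
        using \<open>0 < Q\<close> \<open>\<kappa> * E \<ge> 1\<close> by (intro mult_mono mult_left_mono) auto
      thus ?thesis unfolding R pw \<kappa>_def by (simp add: mult_ac)
    qed
  qed (use assms E \<open>0 < Q\<close> in \<open>auto simp: window_def\<close>)
  also have "\<dots> \<le> 6 * (E * Q) + 4 * \<xi>\<^sub>0 * Q + 8 * Q"
    using Q(1) \<xi>\<^sub>0_pos by (intro add_mono mult_left_le_one_le) (auto simp: mult_le_cancel_left1)
  also have "\<dots> = card_const * Q" by (simp add: card_const_def E_def algebra_simps)
  finally show ?thesis .
qed

text \<open>Multiplication by the inverse phase cancels the terms with \<open>w1\<close> and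
  \<open>w2\<close>. Only the forcing survives, at the price of the factors \<open>k1\<close> and
  \<open>k2\<close> coming from the space derivative.\<close>

lemma profile_primitive:
  assumes 1: "is_primitive T y1 (\<lambda>t. \<i> * of_real w1 * y1 t - \<i> * of_real k1 * g1 t)"
    and 2: "is_primitive T y2 (\<lambda>t. \<i> * of_real w2 * y2 t - \<i> * of_real k2 * g2 t)"
  shows "is_primitive T (\<lambda>t. b * (cis (- (w1 + w2) * t) * (y1 t * y2 t)))
    (\<lambda>t. - \<i> * b * cis (- (w1 + w2) * t) * (of_real k1 * g1 t * y2 t + of_real k2 * y1 t * g2 t))"
proof -
  have "is_primitive T (\<lambda>t. b * (cis (- (w1 + w2) * t) * (y1 t * y2 t)))
    (\<lambda>t. b * (\<i> * of_real (- (w1 + w2)) * cis (- (w1 + w2) * t) * (y1 t * y2 t)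
      + cis (- (w1 + w2) * t) * ((\<i> * of_real w1 * y1 t - \<i> * of_real k1 * g1 t) * y2 t
      + y1 t * (\<i> * of_real w2 * y2 t - \<i> * of_real k2 * g2 t))))"
    by (intro is_primitive_cmult is_primitive_mult is_primitive_cis 1 2)
  also have "(\<lambda>t. b * (\<i> * of_real (- (w1 + w2)) * cis (- (w1 + w2) * t) * (y1 t * y2 t)
      + cis (- (w1 + w2) * t) * ((\<i> * of_real w1 * y1 t - \<i> * of_real k1 * g1 t) * y2 t
      + y1 t * (\<i> * of_real w2 * y2 t - \<i> * of_real k2 * g2 t))))
    = (\<lambda>t. - \<i> * b * cis (- (w1 + w2) * t) * (of_real k1 * g1 t * y2 t + of_real k2 * y1 t * g2 t))"
    by (rule ext) (simp add: ring_distribs mult_ac)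
  finally show ?thesis .
qed

end

lemma profile_derivative_bound:
  fixes z y1 y2 g1 g2 b :: complex and k1 k2 N A w :: real
  assumes b: "cmod b \<le> A" and k: "\<bar>k1\<bar> \<le> 2 * N" "\<bar>k2\<bar> \<le> 2 * N"
  shows "(cmod (- \<i> * b * cis w * (of_real k1 * g1 * y2 + of_real k2 * y1 * g2)))\<^sup>2
    \<le> A\<^sup>2 * (8 * N\<^sup>2) * ((cmod g1)\<^sup>2 * (cmod y2)\<^sup>2 + (cmod y1)\<^sup>2 * (cmod g2)\<^sup>2)"
proof -
  have "0 \<le> A" using b norm_ge_zero order_trans by blast
  let ?p = "cmod g1 * cmod y2" and ?q = "cmod y1 * cmod g2"
  have "cmod (of_real k1 * g1 * y2 + of_real k2 * y1 * g2) \<le> \<bar>k1\<bar> * ?p + \<bar>k2\<bar> * ?q"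
    by (rule order_trans[OF norm_triangle_ineq]) (simp add: norm_mult)
  also have "\<dots> \<le> 2 * N * ?p + 2 * N * ?q"
    by (intro add_mono mult_right_mono k) auto
  finally have "cmod (of_real k1 * g1 * y2 + of_real k2 * y1 * g2) \<le> 2 * N * (?p + ?q)"
    by (simp add: algebra_simps)
  hence "cmod b * cmod (of_real k1 * g1 * y2 + of_real k2 * y1 * g2) \<le> A * (2 * N * (?p + ?q))"
    using b \<open>0 \<le> A\<close> by (intro mult_mono) auto
  hence "cmod (- \<i> * b * cis w * (of_real k1 * g1 * y2 + of_real k2 * y1 * g2)) \<le> A * (2 * N * (?p + ?q))"
    by (simp add: norm_mult)
  hence "(cmod (- \<i> * b * cis w * (of_real k1 * g1 * y2 + of_real k2 * y1 * g2)))\<^sup>2 \<le> (A * (2 * N * (?p + ?q)))\<^sup>2"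
    by (intro power_mono) auto
  also have "\<dots> = A\<^sup>2 * (4 * N\<^sup>2) * (?p + ?q)\<^sup>2" by (simp add: power_mult_distrib)
  also have "\<dots> \<le> A\<^sup>2 * (4 * N\<^sup>2) * (2 * (?p\<^sup>2 + ?q\<^sup>2))"
    using sum_squares_bound[of ?p ?q] by (intro mult_left_mono) (auto simp: power2_sum)
  also have "\<dots> = A\<^sup>2 * (8 * N\<^sup>2) * (?p\<^sup>2 + ?q\<^sup>2)" by simp
  finally show ?thesis by (simp only: power_mult_distrib)
qed

context convex_symbol
begin

text \<open>As N is a natural number, ]0, T[ splits into exactly \<open>n0\<close> pieces of length
  T/N, up to a null set. On each piece \<open>sobolev_sieve\<close> asks for a count in windows of
  length N/T, which \<open>card_phase_window\<close> provides. Its derivative term puts the forcing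
  next to the solution on the right.\<close>

lemma bilinear_estimate_fixed_frequency:
  fixes U1 U2 G1 G2 :: "real \<Rightarrow> int \<Rightarrow> complex" and n0 :: nat
  defines "N \<equiv> real n0"
  assumes n0: "1 \<le> n0" and T: "0 < T" "T < 1"
    and Q: "1 \<le> Q" "Q\<^sup>2 = N powr (2 - \<alpha>) / T" "Q \<le> \<bar>of_int \<xi>\<bar>"
    and fin: "finite Z1"
    and Z: "\<And>n. n \<in> Z1 \<Longrightarrow> \<bar>of_int n\<bar> \<le> 2 * N" "\<And>n. n \<in> Z2 \<Longrightarrow> \<bar>of_int n\<bar> \<le> 2 * N"
      "\<And>m n. m \<in> Z1 \<Longrightarrow> n \<in> Z2 \<Longrightarrow> N / 2 \<le> max \<bar>of_int m\<bar> \<bar>of_int n\<bar>"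
    and meas: "\<And>n. n \<in> Z1 \<Longrightarrow> (\<lambda>t. G1 t n) \<in> borel_measurable borel"
      "\<And>n. n \<in> Z2 \<Longrightarrow> (\<lambda>t. G2 t n) \<in> borel_measurable borel"
    and prim: "\<And>n. n \<in> Z1 \<Longrightarrow> is_primitive T (\<lambda>t. U1 t n) (\<lambda>t. \<i> * of_real (p (of_int n)) * U1 t n - \<i> * of_real (of_int n) * G1 t n)"
      "\<And>n. n \<in> Z2 \<Longrightarrow> is_primitive T (\<lambda>t. U2 t n) (\<lambda>t. \<i> * of_real (p (of_int n)) * U2 t n - \<i> * of_real (of_int n) * G2 t n)"
    and a: "\<And>m n. cmod (a m n) \<le> A"
  shows "(\<integral>\<^sup>+t. ennreal ((cmod (\<Sum>n | n \<in> Z1 \<and> \<xi> - n \<in> Z2. a n (\<xi> - n) * U1 t n * U2 t (\<xi> - n)))\<^sup>2) \<partial>ivl 0 T)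
    \<le> ennreal (6144 * card_const * A\<^sup>2 * Q) * (\<integral>\<^sup>+t. ennreal (\<Sum>n | n \<in> Z1 \<and> \<xi> - n \<in> Z2.
        ((cmod (U1 t n))\<^sup>2 + (cmod (G1 t n))\<^sup>2) * ((cmod (U2 t (\<xi> - n)))\<^sup>2 + (cmod (G2 t (\<xi> - n)))\<^sup>2)) \<partial>ivl 0 T)"
proof -
  let ?S = "{n. n \<in> Z1 \<and> \<xi> - n \<in> Z2}"
  define \<delta> where "\<delta> = T / N"
  have N: "0 < N" "1 \<le> N" using n0 by (auto simp: N_def)
  have \<delta>: "0 < \<delta>" "1 / \<delta> = N / T" "N * \<delta> = T" using N T by (auto simp: \<delta>_def)
  define c where "c = (\<lambda>n t. a n (\<xi> - n) * (cis (- phase \<xi> n * t) * (U1 t n * U2 t (\<xi> - n))))"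
  define d where "d = (\<lambda>n t. - \<i> * a n (\<xi> - n) * cis (- phase \<xi> n * t)
    * (of_real (of_int n) * G1 t n * U2 t (\<xi> - n) + of_real (of_int (\<xi> - n)) * U1 t n * G2 t (\<xi> - n)))"
  define g where "g = (\<lambda>n t. ((cmod (U1 t n))\<^sup>2 + (cmod (G1 t n))\<^sup>2) * ((cmod (U2 t (\<xi> - n)))\<^sup>2 + (cmod (G2 t (\<xi> - n)))\<^sup>2))"
  have finS: "finite ?S" using fin by auto
  have prim_c: "is_primitive T (c n) (d n)" if "n \<in> ?S" for n
    unfolding c_def d_def phase_def
    by (rule profile_primitive[OF prim(1)[of n] prim(2)[of "\<xi> - n"]]) (use that in auto)
  have cF: "c n t * cis (phase \<xi> n * t) = a n (\<xi> - n) * U1 t n * U2 t (\<xi> - n)" for n t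
  proof -
    have "cis (- phase \<xi> n * t) * cis (phase \<xi> n * t) = 1" by (simp add: cis_mult)
    thus ?thesis unfolding c_def by (metis mult.commute mult.left_commute mult_1_right)
  qed
  \<comment> \<open>The factor N^2 from differentiating the profile is absorbed by \<delta>^2,
    because N \<delta> = T < 1. The 8 obtained here times 768 is 6144.\<close>
  have pt: "(\<Sum>n\<in>?S. (cmod (c n t))\<^sup>2) + \<delta>\<^sup>2 * (\<Sum>n\<in>?S. (cmod (d n t))\<^sup>2) \<le> 8 * A\<^sup>2 * (\<Sum>n\<in>?S. g n t)" for t
  proof -
    have "(cmod (c n t))\<^sup>2 + \<delta>\<^sup>2 * (cmod (d n t))\<^sup>2 \<le> 8 * A\<^sup>2 * g n t" if n: "n \<in> ?S" for n
    proof -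
      let ?u1 = "(cmod (U1 t n))\<^sup>2" and ?u2 = "(cmod (U2 t (\<xi> - n)))\<^sup>2"
        and ?g1 = "(cmod (G1 t n))\<^sup>2" and ?g2 = "(cmod (G2 t (\<xi> - n)))\<^sup>2"
      have "(cmod (c n t))\<^sup>2 = (cmod (a n (\<xi> - n)))\<^sup>2 * (?u1 * ?u2)"
        by (simp add: c_def norm_mult power_mult_distrib)
      also have "\<dots> \<le> A\<^sup>2 * (?u1 * ?u2)" by (intro mult_right_mono power_mono a) auto
      also have "\<dots> \<le> A\<^sup>2 * (8 * (?u1 * ?u2))" by (intro mult_left_mono) auto
      finally have 1: "(cmod (c n t))\<^sup>2 \<le> A\<^sup>2 * (8 * (?u1 * ?u2))" .
      have kn: "\<bar>real_of_int n\<bar> \<le> 2 * N" "\<bar>real_of_int (\<xi> - n)\<bar> \<le> 2 * N" using Z(1,2) n by blast+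
      have "\<delta>\<^sup>2 * (cmod (d n t))\<^sup>2 \<le> \<delta>\<^sup>2 * (A\<^sup>2 * (8 * N\<^sup>2) * (?g1 * ?u2 + ?u1 * ?g2))"
        unfolding d_def by (intro mult_left_mono profile_derivative_bound a kn) auto
      also have "\<dots> = (N * \<delta>)\<^sup>2 * (8 * A\<^sup>2 * (?g1 * ?u2 + ?u1 * ?g2))"
        by (simp only: power_mult_distrib mult_ac)
      also have "\<dots> \<le> 1 * (8 * A\<^sup>2 * (?g1 * ?u2 + ?u1 * ?g2))"
        unfolding \<delta>(3) using T by (intro mult_right_mono power_le_one) auto
      finally have 2: "\<delta>\<^sup>2 * (cmod (d n t))\<^sup>2 \<le> 8 * A\<^sup>2 * (?g1 * ?u2 + ?u1 * ?g2)" by simp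
      have "0 \<le> 8 * A\<^sup>2 * (?g1 * ?g2)" by simp
      moreover have "8 * A\<^sup>2 * g n t = A\<^sup>2 * (8 * (?u1 * ?u2)) + 8 * A\<^sup>2 * (?g1 * ?u2 + ?u1 * ?g2) + 8 * A\<^sup>2 * (?g1 * ?g2)"
        unfolding g_def by algebra
      ultimately show ?thesis using 1 2 by linarith
    qed
    hence "(\<Sum>n\<in>?S. (cmod (c n t))\<^sup>2 + \<delta>\<^sup>2 * (cmod (d n t))\<^sup>2) \<le> (\<Sum>n\<in>?S. 8 * A\<^sup>2 * g n t)"
      by (rule sum_mono)
    thus ?thesis by (simp only: sum.distrib sum_distrib_left)
  qed
  have mU: "(\<lambda>t. U1 t n) \<in> borel_measurable borel" "(\<lambda>t. U2 t (\<xi> - n)) \<in> borel_measurable borel"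
    "(\<lambda>t. G1 t n) \<in> borel_measurable borel" "(\<lambda>t. G2 t (\<xi> - n)) \<in> borel_measurable borel" if "n \<in> ?S" for n
    using that prim meas by (auto simp: is_primitive_def)
  have mL: "(\<lambda>t. ennreal ((cmod (\<Sum>n\<in>?S. a n (\<xi> - n) * U1 t n * U2 t (\<xi> - n)))\<^sup>2)) \<in> borel_measurable borel"
  proof -
    have [measurable]: "(\<lambda>t. \<Sum>n\<in>?S. a n (\<xi> - n) * U1 t n * U2 t (\<xi> - n)) \<in> borel_measurable borel"
      by (intro borel_measurable_sum borel_measurable_times borel_measurable_const mU)
    show ?thesis by measurable
  qed
  have mg: "(\<lambda>t. ennreal (\<Sum>n\<in>?S. g n t)) \<in> borel_measurable borel"
  proof -
    have [measurable]: "(\<lambda>t. g n t) \<in> borel_measurable borel" if n: "n \<in> ?S" for n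
      unfolding g_def using mU[OF n] by measurable
    show ?thesis by measurable
  qed
  let ?C = "ennreal (6144 * card_const * A\<^sup>2 * Q)"
  have "(\<integral>\<^sup>+t. ennreal ((cmod (\<Sum>n\<in>?S. a n (\<xi> - n) * U1 t n * U2 t (\<xi> - n)))\<^sup>2) \<partial>ivl 0 (real n0 * \<delta>))
    \<le> (\<integral>\<^sup>+t. ?C * ennreal (\<Sum>n\<in>?S. g n t) \<partial>ivl 0 (real n0 * \<delta>))"
  proof (rule nn_integral_ivl_chop[OF mL])
    show "(\<lambda>t. ?C * ennreal (\<Sum>n\<in>?S. g n t)) \<in> borel_measurable borel"
      by (intro borel_measurable_times_ennreal mg) simp
    show "0 \<le> \<delta>" using \<delta> by simp
    fix k assume k: "k < n0"
    let ?I = "ivl (real k * \<delta>) (real k * \<delta> + \<delta>)"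
    have le: "real k * \<delta> + \<delta> \<le> T"
    proof -
      have "real k + 1 \<le> N" using k by (simp add: N_def)
      hence "(real k + 1) * \<delta> \<le> N * \<delta>" using \<delta> by (intro mult_right_mono) auto
      thus ?thesis using \<delta> by (simp add: algebra_simps)
    qed
    have "(\<integral>\<^sup>+t. ennreal ((cmod (\<Sum>n\<in>?S. a n (\<xi> - n) * U1 t n * U2 t (\<xi> - n)))\<^sup>2) \<partial>?I)
      = (\<integral>\<^sup>+t. ennreal ((cmod (\<Sum>n\<in>?S. c n t * cis (phase \<xi> n * t)))\<^sup>2) \<partial>?I)"
      by (simp only: cF)
    also have "\<dots> \<le> ennreal (768 * (card_const * Q)) * (\<integral>\<^sup>+t. ennreal ((\<Sum>n\<in>?S. (cmod (c n t))\<^sup>2) + \<delta>\<^sup>2 * (\<Sum>n\<in>?S. (cmod (d n t))\<^sup>2)) \<partial>?I)"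
    proof (rule sobolev_sieve[OF finS \<delta>(1) _ le])
      show "0 \<le> real k * \<delta>" using \<delta> by simp
      show "is_primitive T (c n) (d n)" if "n \<in> ?S" for n by (rule prim_c[OF that])
      show "real (card {m \<in> ?S. x \<le> phase \<xi> m \<and> phase \<xi> m \<le> x + 1 / \<delta>}) \<le> card_const * Q" for x
        unfolding \<delta>(2)
      proof (rule card_phase_window[OF N(1) T(1) Q finS])
        fix n assume "n \<in> ?S"
        thus "N / 2 \<le> max \<bar>of_int n\<bar> \<bar>of_int (\<xi> - n)\<bar>" using Z(3)[of n "\<xi> - n"] by simp
      qed
    qed
    also have "\<dots> \<le> ennreal (768 * (card_const * Q)) * (\<integral>\<^sup>+t. ennreal (8 * A\<^sup>2) * ennreal (\<Sum>n\<in>?S. g n t) \<partial>?I)"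
      by (intro mult_left_mono nn_integral_mono) (auto simp: ennreal_mult'[symmetric] intro!: ennreal_leI pt[simplified])
    also have "\<dots> = ennreal (768 * (card_const * Q)) * (ennreal (8 * A\<^sup>2) * (\<integral>\<^sup>+t. ennreal (\<Sum>n\<in>?S. g n t) \<partial>?I))"
      by (simp only: nn_integral_cmult[OF borel_measurable_ivl[OF mg]])
    also have "\<dots> = ?C * (\<integral>\<^sup>+t. ennreal (\<Sum>n\<in>?S. g n t) \<partial>?I)"
    proof -
      have "ennreal (768 * (card_const * Q)) * ennreal (8 * A\<^sup>2) = ?C"
        using card_const_pos Q by (subst ennreal_mult'[symmetric]) (auto simp: mult_ac)
      thus ?thesis by (simp only: mult.assoc[symmetric])
    qed
    also have "\<dots> = (\<integral>\<^sup>+t. ?C * ennreal (\<Sum>n\<in>?S. g n t) \<partial>?I)"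
      by (simp only: nn_integral_cmult[OF borel_measurable_ivl[OF mg]])
    finally show "(\<integral>\<^sup>+t. ennreal ((cmod (\<Sum>n\<in>?S. a n (\<xi> - n) * U1 t n * U2 t (\<xi> - n)))\<^sup>2) \<partial>?I)
      \<le> (\<integral>\<^sup>+t. ?C * ennreal (\<Sum>n\<in>?S. g n t) \<partial>?I)" .
  qed
  also have "\<dots> = ?C * (\<integral>\<^sup>+t. ennreal (\<Sum>n\<in>?S. g n t) \<partial>ivl 0 (real n0 * \<delta>))"
    by (simp only: nn_integral_cmult[OF borel_measurable_ivl[OF mg]])
  also have "real n0 * \<delta> = T" using \<delta>(3) by (simp add: N_def)
  finally show ?thesis by (simp only: g_def)
qed

end

lemma card_int_abs_less_le:
  fixes X :: "int set" assumes "finite X" "1 \<le> Q"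
  shows "real (card {\<xi> \<in> X. \<bar>of_int \<xi>\<bar> < Q}) \<le> 3 * Q"
proof -
  have "real (card {\<xi> \<in> X. \<bar>of_int \<xi>\<bar> < Q}) \<le> 2 * Q + 1"
  proof (rule card_le_of_diameter)
    fix m n assume "m \<in> {\<xi> \<in> X. \<bar>of_int \<xi>\<bar> < Q}" "n \<in> {\<xi> \<in> X. \<bar>of_int \<xi>\<bar> < Q}"
    hence "\<bar>real_of_int m\<bar> < Q" "\<bar>real_of_int n\<bar> < Q" by auto
    thus "of_int (n - m) \<le> 2 * Q" unfolding of_int_diff by linarith
  qed (use assms in auto)
  thus ?thesis using assms by linarith
qed

context convex_symbol
begin

lemma bilinear_estimate:
  fixes U1 U2 G1 G2 :: "real \<Rightarrow> int \<Rightarrow> complex" and n0 :: nat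
  defines "N \<equiv> real n0"
  assumes n0: "1 \<le> n0" and T: "0 < T" "T < 1"
    and Q: "1 \<le> Q" "Q\<^sup>2 = N powr (2 - \<alpha>) / T"
    and fin: "finite Z1" "finite Z2" "finite X"
    and Z: "\<And>n. n \<in> Z1 \<Longrightarrow> \<bar>of_int n\<bar> \<le> 2 * N" "\<And>n. n \<in> Z2 \<Longrightarrow> \<bar>of_int n\<bar> \<le> 2 * N"
      "\<And>m n. m \<in> Z1 \<Longrightarrow> n \<in> Z2 \<Longrightarrow> N / 2 \<le> max \<bar>of_int m\<bar> \<bar>of_int n\<bar>"
    and meas: "\<And>n. n \<in> Z1 \<Longrightarrow> (\<lambda>t. G1 t n) \<in> borel_measurable borel"
      "\<And>n. n \<in> Z2 \<Longrightarrow> (\<lambda>t. G2 t n) \<in> borel_measurable borel"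
    and prim: "\<And>n. n \<in> Z1 \<Longrightarrow> is_primitive T (\<lambda>t. U1 t n) (\<lambda>t. \<i> * of_real (p (of_int n)) * U1 t n - \<i> * of_real (of_int n) * G1 t n)"
      "\<And>n. n \<in> Z2 \<Longrightarrow> is_primitive T (\<lambda>t. U2 t n) (\<lambda>t. \<i> * of_real (p (of_int n)) * U2 t n - \<i> * of_real (of_int n) * G2 t n)"
    and a: "\<And>m n. cmod (a m n) \<le> A"
  shows "(\<integral>\<^sup>+t. ennreal (\<Sum>\<xi>\<in>X. (cmod (\<Sum>n | n \<in> Z1 \<and> \<xi> - n \<in> Z2. a n (\<xi> - n) * U1 t n * U2 t (\<xi> - n)))\<^sup>2) \<partial>ivl 0 T)
    \<le> ennreal ((6144 * card_const + 3) * A\<^sup>2 * Q) * (\<integral>\<^sup>+t. ennreal (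
        (\<Sum>n\<in>Z1. (cmod (U1 t n))\<^sup>2 + (cmod (G1 t n))\<^sup>2) * (\<Sum>n\<in>Z2. (cmod (U2 t n))\<^sup>2 + (cmod (G2 t n))\<^sup>2)) \<partial>ivl 0 T)"
proof -
  let ?S = "\<lambda>\<xi>. {n. n \<in> Z1 \<and> \<xi> - n \<in> Z2}"
  define F where "F = (\<lambda>\<xi> t. (cmod (\<Sum>n\<in>?S \<xi>. a n (\<xi> - n) * U1 t n * U2 t (\<xi> - n)))\<^sup>2)"
  define f1 where "f1 = (\<lambda>t n. (cmod (U1 t n))\<^sup>2 + (cmod (G1 t n))\<^sup>2)"
  define f2 where "f2 = (\<lambda>t n. (cmod (U2 t n))\<^sup>2 + (cmod (G2 t n))\<^sup>2)"
  define H where "H = (\<lambda>t. (\<Sum>n\<in>Z1. f1 t n) * (\<Sum>n\<in>Z2. f2 t n))"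
  have nonneg: "0 \<le> F \<xi> t" "0 \<le> f1 t n" "0 \<le> f2 t n" "0 \<le> H t" for \<xi> t n
    by (auto simp: F_def f1_def f2_def H_def intro!: sum_nonneg mult_nonneg_nonneg)
  have mU: "(\<lambda>t. U1 t n) \<in> borel_measurable borel" "(\<lambda>t. G1 t n) \<in> borel_measurable borel" if "n \<in> Z1" for n
    using that prim meas by (auto simp: is_primitive_def)
  have mV: "(\<lambda>t. U2 t n) \<in> borel_measurable borel" "(\<lambda>t. G2 t n) \<in> borel_measurable borel" if "n \<in> Z2" for n
    using that prim meas by (auto simp: is_primitive_def)
  have mF: "(\<lambda>t. ennreal (F \<xi> t)) \<in> borel_measurable (ivl 0 T)" for \<xi>
  proof -
    have [measurable]: "(\<lambda>t. \<Sum>n\<in>?S \<xi>. a n (\<xi> - n) * U1 t n * U2 t (\<xi> - n)) \<in> borel_measurable borel"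
    proof (rule borel_measurable_sum)
      fix n assume n: "n \<in> ?S \<xi>"
      have [measurable]: "(\<lambda>t. U1 t n) \<in> borel_measurable borel" "(\<lambda>t. U2 t (\<xi> - n)) \<in> borel_measurable borel"
        using n mU mV by auto
      show "(\<lambda>t. a n (\<xi> - n) * U1 t n * U2 t (\<xi> - n)) \<in> borel_measurable borel" by measurable
    qed
    show ?thesis unfolding F_def by (rule borel_measurable_ivl) measurable
  qed
  have mf: "(\<lambda>t. f1 t n) \<in> borel_measurable borel" if "n \<in> Z1" for n
    unfolding f1_def using mU[OF that] by measurable
  have mf': "(\<lambda>t. f2 t n) \<in> borel_measurable borel" if "n \<in> Z2" for n
    unfolding f2_def using mV[OF that] by measurable
  have mH: "(\<lambda>t. ennreal (H t)) \<in> borel_measurable (ivl 0 T)"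
    unfolding H_def
    by (intro borel_measurable_ivl measurable_compose[OF _ measurable_ennreal]
      borel_measurable_sum borel_measurable_times mf mf')
  have mfS: "(\<lambda>t. ennreal (\<Sum>n\<in>?S \<xi>. f1 t n * f2 t (\<xi> - n))) \<in> borel_measurable (ivl 0 T)" for \<xi>
    by (intro borel_measurable_ivl measurable_compose[OF _ measurable_ennreal]
      borel_measurable_sum borel_measurable_times mf mf') auto
  let ?lo = "{\<xi> \<in> X. \<bar>of_int \<xi>\<bar> < Q}" and ?hi = "{\<xi> \<in> X. Q \<le> \<bar>of_int \<xi>\<bar>}"
  let ?I = "\<integral>\<^sup>+t. ennreal (H t) \<partial>ivl 0 T"
  \<comment> \<open>Cauchy-Schwarz in n at a fixed time, for each \<xi> separately. It is summed
    only over \<open>?lo\<close>, where the number of modes is at most 3 Q.\<close>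
  have low: "F \<xi> t \<le> A\<^sup>2 * H t" for \<xi> t
  proof -
    have "F \<xi> t \<le> (\<Sum>n\<in>?S \<xi>. (cmod (a n (\<xi> - n) * U1 t n))\<^sup>2) * (\<Sum>n\<in>?S \<xi>. (cmod (U2 t (\<xi> - n)))\<^sup>2)"
      unfolding F_def by (rule norm_sum_sq_le)
    also have "\<dots> \<le> (A\<^sup>2 * (\<Sum>n\<in>Z1. f1 t n)) * (\<Sum>n\<in>Z2. f2 t n)"
    proof (intro mult_mono)
      have "(cmod (a n (\<xi> - n) * U1 t n))\<^sup>2 \<le> A\<^sup>2 * f1 t n" for n
        unfolding norm_mult power_mult_distrib f1_def by (intro mult_mono power_mono a) auto
      hence "(\<Sum>n\<in>?S \<xi>. (cmod (a n (\<xi> - n) * U1 t n))\<^sup>2) \<le> (\<Sum>n\<in>?S \<xi>. A\<^sup>2 * f1 t n)" by (intro sum_mono)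
      also have "\<dots> \<le> (\<Sum>n\<in>Z1. A\<^sup>2 * f1 t n)" using fin nonneg by (intro sum_mono2) auto
      finally show "(\<Sum>n\<in>?S \<xi>. (cmod (a n (\<xi> - n) * U1 t n))\<^sup>2) \<le> A\<^sup>2 * (\<Sum>n\<in>Z1. f1 t n)"
        by (simp only: sum_distrib_left)
      have "(\<Sum>n\<in>?S \<xi>. (cmod (U2 t (\<xi> - n)))\<^sup>2) \<le> (\<Sum>n\<in>?S \<xi>. f2 t (\<xi> - n))"
        by (intro sum_mono) (auto simp: f2_def)
      also have "\<dots> = (\<Sum>n\<in>(\<lambda>n. \<xi> - n) ` ?S \<xi>. f2 t n)"
        by (subst sum.reindex) (auto simp: inj_on_def)
      also have "\<dots> \<le> (\<Sum>n\<in>Z2. f2 t n)" using fin nonneg by (intro sum_mono2) auto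
      finally show "(\<Sum>n\<in>?S \<xi>. (cmod (U2 t (\<xi> - n)))\<^sup>2) \<le> (\<Sum>n\<in>Z2. f2 t n)" .
    qed (auto intro!: sum_nonneg mult_nonneg_nonneg nonneg)
    finally show ?thesis by (simp only: H_def mult.assoc)
  qed
  have "(\<integral>\<^sup>+t. ennreal (\<Sum>\<xi>\<in>?lo. F \<xi> t) \<partial>ivl 0 T) \<le> (\<integral>\<^sup>+t. ennreal (3 * Q * A\<^sup>2) * ennreal (H t) \<partial>ivl 0 T)"
  proof (intro nn_integral_mono)
    fix t
    have "(\<Sum>\<xi>\<in>?lo. F \<xi> t) \<le> real (card ?lo) * (A\<^sup>2 * H t)"
      by (rule sum_bounded_above) (rule low)
    also have "\<dots> \<le> 3 * Q * (A\<^sup>2 * H t)"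
      using nonneg Q fin by (intro mult_right_mono card_int_abs_less_le) auto
    finally show "ennreal (\<Sum>\<xi>\<in>?lo. F \<xi> t) \<le> ennreal (3 * Q * A\<^sup>2) * ennreal (H t)"
      using Q by (subst ennreal_mult'[symmetric]) (auto intro!: ennreal_leI simp: mult.assoc)
  qed
  also have "\<dots> = ennreal (3 * Q * A\<^sup>2) * ?I" by (rule nn_integral_cmult[OF mH])
  finally have 1: "(\<integral>\<^sup>+t. ennreal (\<Sum>\<xi>\<in>?lo. F \<xi> t) \<partial>ivl 0 T) \<le> ennreal (3 * Q * A\<^sup>2) * ?I" .
  let ?C = "6144 * card_const * A\<^sup>2 * Q"
  \<comment> \<open>For high modes the loss Q already sits in the estimate of a single mode, so the
    sum over \<xi> must not cost anything more; \<open>sum_convolution_le\<close> provides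
    this.\<close>
  have "(\<integral>\<^sup>+t. ennreal (\<Sum>\<xi>\<in>?hi. F \<xi> t) \<partial>ivl 0 T) = (\<Sum>\<xi>\<in>?hi. \<integral>\<^sup>+t. ennreal (F \<xi> t) \<partial>ivl 0 T)"
    by (simp add: nn_integral_sum[OF mF] nonneg flip: sum_ennreal)
  also have "\<dots> \<le> (\<Sum>\<xi>\<in>?hi. ennreal ?C * (\<integral>\<^sup>+t. ennreal (\<Sum>n\<in>?S \<xi>. f1 t n * f2 t (\<xi> - n)) \<partial>ivl 0 T))"
    unfolding F_def f1_def f2_def
    by (intro sum_mono bilinear_estimate_fixed_frequency[OF n0 T Q(1) Q(2)[unfolded N_def] _ fin(1)])
      (use Z meas prim a in \<open>auto simp: N_def\<close>)
  also have "\<dots> = ennreal ?C * (\<integral>\<^sup>+t. ennreal (\<Sum>\<xi>\<in>?hi. \<Sum>n\<in>?S \<xi>. f1 t n * f2 t (\<xi> - n)) \<partial>ivl 0 T)"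
  proof -
    have "(\<integral>\<^sup>+t. ennreal (\<Sum>\<xi>\<in>?hi. \<Sum>n\<in>?S \<xi>. f1 t n * f2 t (\<xi> - n)) \<partial>ivl 0 T)
        = (\<integral>\<^sup>+t. (\<Sum>\<xi>\<in>?hi. ennreal (\<Sum>n\<in>?S \<xi>. f1 t n * f2 t (\<xi> - n))) \<partial>ivl 0 T)"
      by (intro nn_integral_cong sum_ennreal[symmetric] sum_nonneg mult_nonneg_nonneg nonneg)
    also have "\<dots> = (\<Sum>\<xi>\<in>?hi. \<integral>\<^sup>+t. ennreal (\<Sum>n\<in>?S \<xi>. f1 t n * f2 t (\<xi> - n)) \<partial>ivl 0 T)"
      by (rule nn_integral_sum[OF mfS])
    finally show ?thesis by (simp only: sum_distrib_left)
  qed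
  also have "\<dots> \<le> ennreal ?C * ?I"
    unfolding H_def using fin nonneg by (intro mult_left_mono nn_integral_mono ennreal_leI sum_convolution_le) auto
  finally have 2: "(\<integral>\<^sup>+t. ennreal (\<Sum>\<xi>\<in>?hi. F \<xi> t) \<partial>ivl 0 T) \<le> ennreal ?C * ?I" .
  have split: "(\<Sum>\<xi>\<in>X. F \<xi> t) = (\<Sum>\<xi>\<in>?lo. F \<xi> t) + (\<Sum>\<xi>\<in>?hi. F \<xi> t)" for t
    using fin by (subst sum.union_disjoint[symmetric]) (auto intro!: sum.cong)
  have "(\<integral>\<^sup>+t. ennreal (\<Sum>\<xi>\<in>X. F \<xi> t) \<partial>ivl 0 T)
    = (\<integral>\<^sup>+t. ennreal (\<Sum>\<xi>\<in>?lo. F \<xi> t) + ennreal (\<Sum>\<xi>\<in>?hi. F \<xi> t) \<partial>ivl 0 T)"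
    unfolding split by (intro nn_integral_cong ennreal_plus sum_nonneg nonneg)
  also have "\<dots> = (\<integral>\<^sup>+t. ennreal (\<Sum>\<xi>\<in>?lo. F \<xi> t) \<partial>ivl 0 T) + (\<integral>\<^sup>+t. ennreal (\<Sum>\<xi>\<in>?hi. F \<xi> t) \<partial>ivl 0 T)"
    using mF by (intro nn_integral_add) (simp_all add: nonneg flip: sum_ennreal)
  also have "\<dots> \<le> ennreal (3 * Q * A\<^sup>2) * ?I + ennreal ?C * ?I" by (intro add_mono 1 2)
  also have "\<dots> = ennreal ((6144 * card_const + 3) * A\<^sup>2 * Q) * ?I"
    using Q card_const_pos
    by (simp add: distrib_right[symmetric] ennreal_plus[symmetric] del: ennreal_plus) (simp add: algebra_simps)
  finally show ?thesis by (simp only: F_def H_def f1_def f2_def)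
qed

end

section \<open>Fourier coefficients on the torus\<close>

lemma ennsqrt_ennreal: "0 \<le> r \<Longrightarrow> ennsqrt (ennreal r) = ennreal (sqrt r)"
  by (simp add: ennsqrt_def)

lemma ennsqrt_power2: "(ennsqrt x)\<^sup>2 = x"
proof (cases x)
  case (real r) thus ?thesis by (simp add: ennsqrt_ennreal ennreal_power)
next
  case top thus ?thesis by (simp add: ennsqrt_def power2_eq_square ennreal_top_mult)
qed

lemma ennsqrt_mono: "x \<le> y \<Longrightarrow> ennsqrt x \<le> ennsqrt y"
  by (cases x; cases y) (auto simp: ennsqrt_ennreal ennsqrt_def top_unique)

lemma ennsqrt_of_power2: "ennsqrt (x\<^sup>2) = x"
proof (cases x)
  case (real r) thus ?thesis by (simp add: ennsqrt_ennreal ennreal_power)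
next
  case top thus ?thesis by (simp add: ennsqrt_def power2_eq_square ennreal_top_mult)
qed

section \<open>Characters, Fourier coefficients and Parseval's identity\<close>

lemma emeasure_torus: "emeasure torus (space torus) = ennreal (2 * pi)"
  by (simp add: emeasure_restrict_space space_restrict_space)

lemma finite_measure_torus: "finite_measure torus"
  by (intro finite_measureI) (simp only: emeasure_torus ennreal_neq_top not_False_eq_True infinity_ennreal_def)

lemma borel_measurable_torus_continuous:
  fixes f :: "real \<Rightarrow> 'a::topological_space"
  assumes "continuous_on UNIV f" shows "f \<in> borel_measurable torus"
  by (intro measurable_restrict_space1 measurable_completion) (use assms in \<open>auto intro: borel_measurable_continuous_onI\<close>)

lemma integrable_torus_continuous:
  fixes f :: "real \<Rightarrow> 'a::{banach, second_countable_topology}"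
  assumes "continuous_on UNIV f" shows "integrable torus f"
proof -
  interpret finite_measure torus by (rule finite_measure_torus)
  have "compact (f ` {0..2*pi})" using assms by (intro compact_continuous_image continuous_on_subset[OF assms]) auto
  then obtain B where "\<And>x. x \<in> {0..2*pi} \<Longrightarrow> norm (f x) \<le> B"
    using compact_imp_bounded bounded_iff by (metis imageI)
  thus ?thesis
    by (intro integrable_const_bound[of _ B] borel_measurable_torus_continuous assms AE_I2) (auto simp: space_restrict_space)
qed

lemma integral_torus_cis: "(LINT x|torus. cis (of_int k * x)) = (if k = 0 then 2 * pi else 0)"
proof (cases "k = 0")
  case True
  thus ?thesis using emeasure_torus by (simp add: measure_def scaleR_conv_of_real)
next
  case False
  let ?A = "\<lambda>x. cis (of_int k * x) / (\<i> * of_int k)"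
  have "((\<lambda>x. cis (of_int k * x)) has_integral (?A (2*pi) - ?A 0)) {0..2*pi}"
  proof (rule fundamental_theorem_of_calculus)
    fix x :: real
    have "((\<lambda>x. cis (of_int k * x)) has_vector_derivative \<i> * of_int k * cis (of_int k * x)) (at x within {0..2*pi})"
      unfolding cis_conv_exp by (auto intro!: derivative_eq_intros has_vector_derivative_real_field simp: algebra_simps)
    from has_vector_derivative_mult_right[OF this, of "1 / (\<i> * of_int k)"]
    show "(?A has_vector_derivative cis (of_int k * x)) (at x within {0..2*pi})"
      using False by simp
  qed simp
  moreover have "cis (of_int k * (2 * pi)) = 1"
    using cis_multiple_2pi[of "of_int k"] by (simp add: mult_ac)
  ultimately have "((\<lambda>x. cis (of_int k * x)) has_integral 0) {0..2*pi}" by simp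
  \<comment> \<open>The half-open fundamental domain differs from the closed interval by one
    point.\<close>
  hence "((\<lambda>x. cis (of_int k * x)) has_integral 0) {0..<2*pi}"
    by (subst has_integral_spike_set_eq[of _ "{0..2*pi}"]) (auto intro: negligible_subset[of "{2*pi}"])
  moreover have "integrable torus (\<lambda>x. cis (of_int k * x))"
    by (intro integrable_torus_continuous continuous_intros)
  ultimately show ?thesis using False
    by (simp add: lebesgue_integral_eq_integral integral_unique)
qed

lemma nn_integral_norm_torus_le:
  assumes "v \<in> borel_measurable torus"
  shows "(\<integral>\<^sup>+x. ennreal (cmod (v x)) \<partial>torus)\<^sup>2 \<le> ennreal (2 * pi) * (L2norm v)\<^sup>2"
proof -
  note assms[measurable]
  have "(\<integral>\<^sup>+x. ennreal (cmod (v x)) * 1 \<partial>torus)\<^sup>2 \<le> (\<integral>\<^sup>+x. (ennreal (cmod (v x)))\<^sup>2 \<partial>torus) * (\<integral>\<^sup>+x. 1\<^sup>2 \<partial>torus)"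
    by (rule Cauchy_Schwarz_nn_integral) measurable
  also have "(\<integral>\<^sup>+x. 1\<^sup>2 \<partial>torus) = ennreal (2 * pi)"
    by (subst power_one) (simp only: nn_integral_const emeasure_torus mult_1_left)
  also have "(\<integral>\<^sup>+x. (ennreal (cmod (v x)))\<^sup>2 \<partial>torus) = (L2norm v)\<^sup>2"
    by (simp add: L2norm_def ennsqrt_power2 ennreal_power)
  finally show ?thesis by (simp add: mult.commute)
qed

lemma memL2_integrable:
  assumes "memL2 v" shows "integrable torus (\<lambda>x. v x * cis (w * x))"
proof -
  have [measurable]: "v \<in> borel_measurable torus" and L: "L2norm v < top" using assms by (auto simp: memL2_def)
  have [measurable]: "(\<lambda>x. cis (w * x)) \<in> borel_measurable torus"
    by (intro borel_measurable_torus_continuous continuous_intros)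
  let ?X = "\<integral>\<^sup>+x. ennreal (cmod (v x)) \<partial>torus"
  obtain r where r: "0 \<le> r" "L2norm v = ennreal r" using L by (cases "L2norm v") auto
  have "?X\<^sup>2 \<le> ennreal (2 * pi) * (L2norm v)\<^sup>2" by (rule nn_integral_norm_torus_le) measurable
  also have "\<dots> = ennreal (2 * pi * r\<^sup>2)" using r by (simp add: ennreal_power ennreal_mult)
  finally have "?X\<^sup>2 \<noteq> top" by (metis ennreal_neq_top top_unique)
  hence "?X \<noteq> top" by (metis ennreal_top_mult power2_eq_square top_neq_ennreal ennreal_mult_eq_top_iff)
  moreover have "(\<integral>\<^sup>+x. ennreal (norm (v x * cis (w * x))) \<partial>torus) = ?X"
    by (simp only: norm_mult norm_cis mult_1_right)
  ultimately have "(\<integral>\<^sup>+x. ennreal (norm (v x * cis (w * x))) \<partial>torus) < \<infinity>"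
    by (simp add: less_top)
  thus ?thesis by (intro integrableI_bounded) measurable
qed

text \<open>Cauchy-Schwarz on a set of measure 2 pi. It transfers convergence in L^2 to each
  coefficient, for the continuity of \<open>u\<close> and the measurability of \<open>f\<close> in
  time.\<close>

lemma norm_fourier_le:
  assumes "v \<in> borel_measurable torus"
  shows "ennreal (cmod (fourier v n)) \<le> L2norm v"
proof -
  let ?g = "\<lambda>x. v x * cis (- (of_int n * x))"
  have "ennreal (cmod (LINT x|torus. ?g x)) \<le> (\<integral>\<^sup>+x. ennreal (cmod (?g x)) \<partial>torus)"
  \<comment> \<open>A function that is not integrable has Bochner integral 0, so the bound is
    trivial in that case.\<close>
  proof (cases "integrable torus ?g")
    case True thus ?thesis by (rule integral_norm_bound_ennreal)
  qed (simp add: not_integrable_integral_eq)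
  hence "(ennreal (cmod (LINT x|torus. ?g x)))\<^sup>2 \<le> (\<integral>\<^sup>+x. ennreal (cmod (v x)) \<partial>torus)\<^sup>2"
    by (simp only: norm_mult norm_cis mult_1_right) (rule power_mono, simp_all)
  also note nn_integral_norm_torus_le[OF assms]
  finally have *: "(ennreal (cmod (LINT x|torus. ?g x)))\<^sup>2 \<le> ennreal (2 * pi) * (L2norm v)\<^sup>2" .
  have "cmod (fourier v n) = 1 / (2 * pi) * cmod (LINT x|torus. ?g x)"
    by (simp add: fourier_def norm_mult norm_divide)
  hence "ennreal (cmod (fourier v n)) = ennreal (1 / (2 * pi)) * ennreal (cmod (LINT x|torus. ?g x))"
    using ennreal_mult[of "1 / (2 * pi)" "cmod (LINT x|torus. ?g x)"] by simp
  hence "(ennreal (cmod (fourier v n)))\<^sup>2 = ennreal ((1 / (2 * pi))\<^sup>2) * (ennreal (cmod (LINT x|torus. ?g x)))\<^sup>2"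
    by (simp only: power_mult_distrib) (simp add: ennreal_power)
  also have "\<dots> \<le> ennreal ((1 / (2 * pi))\<^sup>2) * (ennreal (2 * pi) * (L2norm v)\<^sup>2)"
    by (intro mult_left_mono *) auto
  also have "\<dots> = ennreal (1 / (2 * pi)) * (L2norm v)\<^sup>2"
    by (simp add: mult.assoc[symmetric] ennreal_mult'[symmetric] power2_eq_square)
  also have "\<dots> \<le> 1 * (L2norm v)\<^sup>2"
  proof (rule mult_right_mono)
    have "1 / (2 * pi) \<le> 1" using pi_ge_two by (simp add: divide_le_eq)
    thus "ennreal (1 / (2 * pi)) \<le> 1" by (metis ennreal_1 ennreal_leI)
  qed simp
  finally have "(ennreal (cmod (fourier v n)))\<^sup>2 \<le> (L2norm v)\<^sup>2" by simp
  from ennsqrt_mono[OF this] show ?thesis by (simp only: ennsqrt_of_power2)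
qed

lemma fourier_diff:
  assumes "memL2 v" "memL2 w"
  shows "fourier (\<lambda>x. v x - w x) n = fourier v n - fourier w n"
  using memL2_integrable[OF assms(1), of "- of_int n"] memL2_integrable[OF assms(2), of "- of_int n"]
  by (simp add: fourier_def left_diff_distrib right_diff_distrib)

lemma fourier_character: "fourier (\<lambda>x. k * cis (of_int m * x)) n = (if m = n then k else 0)"
proof -
  have "k * cis (of_int m * x) * cis (- (of_int n * x)) = k * cis (of_int (m - n) * x)" for x
    by (simp add: mult.assoc cis_mult left_diff_distrib)
  hence "fourier (\<lambda>x. k * cis (of_int m * x)) n = of_real (1 / (2*pi)) * (k * (LINT x|torus. cis (of_int (m - n) * x)))"
    by (simp only: fourier_def integral_mult_right_zero)
  thus ?thesis by (simp only: integral_torus_cis) simp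
qed

lemma inv_fourier_finite:
  assumes "finite S" "\<And>\<xi>. \<xi> \<notin> S \<Longrightarrow> c \<xi> = 0"
  shows "inv_fourier c x = (\<Sum>\<xi>\<in>S. c \<xi> * cis (of_int \<xi> * x))"
proof -
  have "inv_fourier c x = (\<Sum>\<^sub>\<infinity>\<xi>\<in>S. c \<xi> * cis (of_int \<xi> * x))"
    unfolding inv_fourier_def using assms(2) by (intro infsum_cong_neutral) auto
  thus ?thesis using assms(1) by simp
qed

lemma fourier_inv_fourier:
  assumes "finite S" "\<And>\<xi>. \<xi> \<notin> S \<Longrightarrow> c \<xi> = 0"
  shows "fourier (inv_fourier c) n = c n"
proof -
  have int: "integrable torus (\<lambda>x. c \<xi> * cis (of_int \<xi> * x) * cis (- (of_int n * x)))" for \<xi>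
    by (intro integrable_torus_continuous continuous_intros)
  have inv: "inv_fourier c = (\<lambda>x. \<Sum>\<xi>\<in>S. c \<xi> * cis (of_int \<xi> * x))"
    by (rule ext) (rule inv_fourier_finite[OF assms])
  have "fourier (inv_fourier c) n = (\<Sum>\<xi>\<in>S. fourier (\<lambda>x. c \<xi> * cis (of_int \<xi> * x)) n)"
    unfolding fourier_def inv sum_distrib_right
    by (subst Bochner_Integration.integral_sum) (use int in \<open>auto simp: sum_distrib_left\<close>)
  also have "\<dots> = c n" using assms by (simp add: fourier_character)
  finally show ?thesis .
qed

lemma parseval_inv_fourier:
  assumes "finite S" "\<And>\<xi>. \<xi> \<notin> S \<Longrightarrow> c \<xi> = 0"
  shows "(L2norm (inv_fourier c))\<^sup>2 = ennreal (2 * pi * (\<Sum>\<xi>\<in>S. (cmod (c \<xi>))\<^sup>2))"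
proof -
  define P where "P = inv_fourier c"
  have P: "P x = (\<Sum>\<xi>\<in>S. c \<xi> * cis (of_int \<xi> * x))" for x
    unfolding P_def by (rule inv_fourier_finite[OF assms])
  have cP: "continuous_on UNIV P" unfolding P[abs_def] by (intro continuous_intros)
  have "complex_of_real (LINT x|torus. (cmod (P x))\<^sup>2) = (LINT x|torus. complex_of_real ((cmod (P x))\<^sup>2))"
    by (rule integral_complex_of_real[symmetric])
  \<comment> \<open>Only the conjugate factor is expanded, so that each term is a Fourier
    coefficient of \<open>P\<close> itself.\<close>
  also have "\<dots> = (LINT x|torus. (\<Sum>\<xi>\<in>S. cnj (c \<xi>) * (P x * cis (- (of_int \<xi> * x)))))"
    by (intro Bochner_Integration.integral_cong refl)
      (simp only: complex_norm_square, subst (2) P, simp add: cnj_sum cis_cnj sum_distrib_left mult_ac)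
  also have "\<dots> = (\<Sum>\<xi>\<in>S. cnj (c \<xi>) * (LINT x|torus. P x * cis (- (of_int \<xi> * x))))"
    by (subst Bochner_Integration.integral_sum) (auto intro!: integrable_torus_continuous continuous_intros cP)
  also have "\<dots> = (\<Sum>\<xi>\<in>S. cnj (c \<xi>) * (2 * pi * fourier P \<xi>))"
    by (simp add: fourier_def)
  also have "\<dots> = complex_of_real (2 * pi * (\<Sum>\<xi>\<in>S. (cmod (c \<xi>))\<^sup>2))"
  proof -
    have "fourier P \<xi> = c \<xi>" for \<xi> unfolding P_def by (rule fourier_inv_fourier[OF assms])
    thus ?thesis unfolding of_real_mult of_real_sum complex_norm_square
      by (simp add: sum_distrib_left mult_ac)
  qed
  finally have eq: "(LINT x|torus. (cmod (P x))\<^sup>2) = 2 * pi * (\<Sum>\<xi>\<in>S. (cmod (c \<xi>))\<^sup>2)"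
    by (simp only: of_real_eq_iff)
  have "integrable torus (\<lambda>x. (cmod (P x))\<^sup>2)" 
    by (intro integrable_torus_continuous continuous_intros cP)
  hence "(\<integral>\<^sup>+x. ennreal ((cmod (P x))\<^sup>2) \<partial>torus) = ennreal (2 * pi * (\<Sum>\<xi>\<in>S. (cmod (c \<xi>))\<^sup>2))"
    unfolding eq[symmetric] by (intro nn_integral_eq_integral) auto
  thus ?thesis by (simp add: L2norm_def ennsqrt_power2 P_def)
qed

section \<open>Frequency-localised functions as trigonometric polynomials\<close>

definition freqs :: "(real \<Rightarrow> real) \<Rightarrow> real \<Rightarrow> int set" where
  "freqs \<eta> N = {n. phi \<eta> N (of_int n) \<noteq> 0}"

definition coef :: "(real \<Rightarrow> real) \<Rightarrow> real \<Rightarrow> (real \<Rightarrow> complex) \<Rightarrow> int \<Rightarrow> complex" where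
  "coef \<eta> N u n = complex_of_real (phi \<eta> N (of_int n)) * fourier u n"

lemma coef_eq_0: "n \<notin> freqs \<eta> N \<Longrightarrow> coef \<eta> N u n = 0"
  by (simp add: coef_def freqs_def)

lemma cutoff_eq_0: "cutoff \<eta> \<Longrightarrow> 2 < \<bar>x\<bar> \<Longrightarrow> \<eta> x = 0"
  unfolding cutoff_def using closure_subset[of "{x. \<eta> x \<noteq> 0}"] by force

lemma cutoff_eq_1: "cutoff \<eta> \<Longrightarrow> \<bar>x\<bar> \<le> 1 \<Longrightarrow> \<eta> x = 1"
  unfolding cutoff_def by (auto simp: abs_le_iff)

text \<open>Below N/2 both cutoffs in \<open>phi\<close> equal 1, above 2N both equal 0; in either
  case they cancel.\<close>

lemma freqs_bounds:
  assumes "cutoff \<eta>" "0 < N" "n \<in> freqs \<eta> N"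
  shows "N / 2 \<le> \<bar>of_int n\<bar>" "\<bar>of_int n\<bar> \<le> 2 * N"
proof -
  have ne: "\<eta> (of_int n / N) \<noteq> \<eta> (2 * (of_int n / N))" using assms(3) by (simp add: freqs_def phi_def)
  show "N / 2 \<le> \<bar>of_int n\<bar>"
  proof (rule ccontr)
    assume "\<not> ?thesis"
    hence "\<bar>of_int n / N\<bar> \<le> 1" "\<bar>2 * (of_int n / N)\<bar> \<le> 1" using assms(2) by (auto simp: abs_mult)
    thus False using ne cutoff_eq_1[OF assms(1)] by metis
  qed
  show "\<bar>of_int n\<bar> \<le> 2 * N"
  proof (rule ccontr)
    assume "\<not> ?thesis"
    hence "2 < \<bar>of_int n / N\<bar>" "2 < \<bar>2 * (of_int n / N)\<bar>" using assms(2) by (auto simp: abs_mult field_simps)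
    thus False using ne cutoff_eq_0[OF assms(1)] by metis
  qed
qed

lemma finite_freqs:
  assumes "cutoff \<eta>" "0 < N" shows "finite (freqs \<eta> N)"
proof (rule finite_subset)
  show "freqs \<eta> N \<subseteq> {- \<lfloor>2 * N\<rfloor>..\<lfloor>2 * N\<rfloor>}"
  proof
    fix n assume "n \<in> freqs \<eta> N"
    hence "real_of_int \<bar>n\<bar> \<le> 2 * N" using freqs_bounds(2)[OF assms] by simp
    hence "\<bar>n\<bar> \<le> \<lfloor>2 * N\<rfloor>" by (simp only: le_floor_iff)
    thus "n \<in> {- \<lfloor>2 * N\<rfloor>..\<lfloor>2 * N\<rfloor>}" by auto
  qed
qed simp

lemma L2norm_proj:
  assumes "cutoff \<eta>" "0 < N"
  shows "(L2norm (proj \<eta> N u))\<^sup>2 = ennreal (2 * pi * (\<Sum>n\<in>freqs \<eta> N. (cmod (coef \<eta> N u n))\<^sup>2))"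
  unfolding proj_def coef_def[symmetric] by (rule parseval_inv_fourier[OF finite_freqs[OF assms] coef_eq_0])

lemma fourier_proj:
  assumes "cutoff \<eta>" "0 < N"
  shows "fourier (proj \<eta> N u) n = coef \<eta> N u n"
  unfolding proj_def coef_def[symmetric] by (rule fourier_inv_fourier[OF finite_freqs[OF assms] coef_eq_0])

lemma L2norm_Lam_proj:
  assumes "cutoff \<eta>" "0 < N1" "0 < N2"
  shows "(L2norm (Lam a (proj \<eta> N1 u) (proj \<eta> N2 v)))\<^sup>2
    = ennreal (2 * pi * (\<Sum>\<xi>\<in>(\<lambda>(m, n). m + n) ` (freqs \<eta> N1 \<times> freqs \<eta> N2).
        (cmod (\<Sum>n | n \<in> freqs \<eta> N1 \<and> \<xi> - n \<in> freqs \<eta> N2.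
          a (of_int n) (of_int (\<xi> - n)) * coef \<eta> N1 u n * coef \<eta> N2 v (\<xi> - n)))\<^sup>2))"
proof -
  let ?S = "\<lambda>\<xi>. {n. n \<in> freqs \<eta> N1 \<and> \<xi> - n \<in> freqs \<eta> N2}"
  let ?X = "(\<lambda>(m, n). m + n) ` (freqs \<eta> N1 \<times> freqs \<eta> N2)"
  have fin: "finite (freqs \<eta> N1)" "finite (freqs \<eta> N2)" using finite_freqs assms by auto
  have hat: "Lam_hat a (proj \<eta> N1 u) (proj \<eta> N2 v) \<xi>
      = (\<Sum>n\<in>?S \<xi>. a (of_int n) (of_int (\<xi> - n)) * coef \<eta> N1 u n * coef \<eta> N2 v (\<xi> - n))" for \<xi>
  proof -
    have "Lam_hat a (proj \<eta> N1 u) (proj \<eta> N2 v) \<xi>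
      = (\<Sum>\<^sub>\<infinity>n\<in>?S \<xi>. a (of_int n) (of_int (\<xi> - n)) * coef \<eta> N1 u n * coef \<eta> N2 v (\<xi> - n))"
      unfolding Lam_hat_def fourier_proj[OF assms(1,2)] fourier_proj[OF assms(1,3)]
      by (intro infsum_cong_neutral) (auto simp: coef_eq_0)
    thus ?thesis using fin by simp
  qed
  have "Lam_hat a (proj \<eta> N1 u) (proj \<eta> N2 v) \<xi> = 0" if "\<xi> \<notin> ?X" for \<xi>
  proof -
    have "?S \<xi> = {}" using that by (force simp: image_iff)
    thus ?thesis by (simp only: hat sum.empty)
  qed
  from parseval_inv_fourier[OF _ this] show ?thesis
    using fin unfolding Lam_def hat by simp
qed

section \<open>The equation for the Fourier coefficients\<close>

lemma cutoff_deriv: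
  assumes "cutoff \<eta>"
  shows "((deriv ^^ m) \<eta> has_real_derivative (deriv ^^ Suc m) \<eta> x) (at x)"
  using assms by (simp add: cutoff_def DERIV_deriv_iff_real_differentiable)

lemma deriv_funpow_locally_const:
  fixes f :: "real \<Rightarrow> real"
  assumes "open S" "\<And>x. x \<in> S \<Longrightarrow> f x = k" "x \<in> S"
  shows "(deriv ^^ m) f x = (if m = 0 then k else 0)"
  using assms(3)
proof (induction m arbitrary: x)
  case 0
  thus ?case using assms(2) by simp
next
  case (Suc m)
  have "((deriv ^^ m) f has_real_derivative 0) (at x)"
    by (rule has_field_derivative_transform_within_open[OF DERIV_const assms(1) Suc.prems])
      (use Suc.IH in auto)
  thus ?case by (simp add: DERIV_imp_deriv)
qed

lemma cutoff_plateau: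
  assumes "cutoff \<eta>" "\<bar>x\<bar> < 1" shows "(deriv ^^ m) \<eta> x = (if m = 0 then 1 else 0)"
  by (rule deriv_funpow_locally_const[of "{-1<..<1}"]) (use assms cutoff_eq_1 in auto)

lemma cutoff_tail:
  assumes "cutoff \<eta>" "2 < \<bar>x\<bar>" shows "(deriv ^^ m) \<eta> x = 0"
proof -
  have "open {x::real. 2 < \<bar>x\<bar>}" by (intro open_Collect_less continuous_intros)
  from deriv_funpow_locally_const[OF this, of \<eta> 0 x m] show ?thesis
    using assms cutoff_eq_0 by (cases "m = 0") auto
qed

text \<open>The \<open>m\<close>-th derivative of a smooth approximation of the indicator function of \<open>[s,t]\<close>.\<close>

definition bump :: "(real \<Rightarrow> real) \<Rightarrow> real \<Rightarrow> real \<Rightarrow> real \<Rightarrow> nat \<Rightarrow> real \<Rightarrow> real" where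
  "bump \<eta> s t \<epsilon> m x =
     (if x \<le> s then (deriv ^^ m) \<eta> ((x - s) / \<epsilon>) / \<epsilon> ^ m
      else if x \<le> t then (if m = 0 then 1 else 0)
      else (deriv ^^ m) \<eta> ((x - t) / \<epsilon>) / \<epsilon> ^ m)"

text \<open>The branches join smoothly because \<eta> is 1 on [-1, 1]: the bump is constant on ]s -
  \<epsilon>, t + \<epsilon>[, a neighbourhood of both junctions, and every formula for a higher
  derivative vanishes there.\<close>

lemma bump_deriv:
  assumes "cutoff \<eta>" "0 < \<epsilon>" "s < t"
  shows "(bump \<eta> s t \<epsilon> m has_real_derivative bump \<eta> s t \<epsilon> (Suc m) x) (at x)"
proof -
  have side: "((\<lambda>x. (deriv ^^ m) \<eta> ((x - r) / \<epsilon>) / \<epsilon> ^ m) has_real_derivative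
      (deriv ^^ Suc m) \<eta> ((x - r) / \<epsilon>) / \<epsilon> ^ Suc m) (at x)" for r x
    using assms(2) by (auto intro!: derivative_eq_intros DERIV_chain2[OF cutoff_deriv[OF assms(1)]] simp: field_simps)
  consider "x < s" | "t < x" | "s \<le> x" "x \<le> t" by linarith
  thus ?thesis
  proof cases
    case 1
    have "(bump \<eta> s t \<epsilon> m has_real_derivative (deriv ^^ Suc m) \<eta> ((x - s) / \<epsilon>) / \<epsilon> ^ Suc m) (at x)"
      by (rule has_field_derivative_transform_within_open[OF side[of s], of "{..<s}"]) (use 1 in \<open>auto simp: bump_def\<close>)
    thus ?thesis using 1 by (simp add: bump_def)
  next
    case 2
    have "(bump \<eta> s t \<epsilon> m has_real_derivative (deriv ^^ Suc m) \<eta> ((x - t) / \<epsilon>) / \<epsilon> ^ Suc m) (at x)"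
      by (rule has_field_derivative_transform_within_open[OF side[of t], of "{t<..}"]) (use 2 assms in \<open>auto simp: bump_def\<close>)
    thus ?thesis using 2 assms by (simp add: bump_def)
  next
    case 3
    have eq: "bump \<eta> s t \<epsilon> m' y = (if m' = 0 then 1 else 0)" if "y \<in> {s - \<epsilon><..<t + \<epsilon>}" for y m'
    proof -
      have "(deriv ^^ m') \<eta> ((y - s) / \<epsilon>) / \<epsilon> ^ m' = (if m' = 0 then 1 else 0)" if "y \<le> s"
      proof -
        have "\<bar>(y - s) / \<epsilon>\<bar> < 1" using that \<open>y \<in> _\<close> assms by (auto simp: abs_if field_simps)
        thus ?thesis by (simp only: cutoff_plateau[OF assms(1)]) simp
      qed
      note left = this
      have "(deriv ^^ m') \<eta> ((y - t) / \<epsilon>) / \<epsilon> ^ m' = (if m' = 0 then 1 else 0)" if "t < y"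
      proof -
        have "\<bar>(y - t) / \<epsilon>\<bar> < 1" using that \<open>y \<in> _\<close> assms by (auto simp: abs_if field_simps)
        thus ?thesis by (simp only: cutoff_plateau[OF assms(1)]) simp
      qed
      note right = this
      show ?thesis
      proof (cases "y \<le> s")
        case True
        thus ?thesis by (simp only: bump_def left if_True)
      next
        case False
        show ?thesis
        proof (cases "y \<le> t")
          case True
          thus ?thesis using False by (simp only: bump_def if_True if_False)
        next
          case False
          thus ?thesis using \<open>\<not> y \<le> s\<close> right[unfolded not_le[symmetric]] by (simp only: bump_def if_False simp_thms)
        qed
      qed
    qed
    have "(bump \<eta> s t \<epsilon> m has_real_derivative 0) (at x)"
      by (rule has_field_derivative_transform_within_open[of "\<lambda>_. if m = 0 then 1 else 0" _ _ "{s - \<epsilon><..<t + \<epsilon>}"])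
        (use 3 assms eq in auto)
    thus ?thesis using eq[of x "Suc m"] 3 assms by simp
  qed
qed

lemma bump_eq_0:
  assumes "cutoff \<eta>" "0 < \<epsilon>" "s < t" "x < s - 2 * \<epsilon> \<or> t + 2 * \<epsilon> < x"
  shows "bump \<eta> s t \<epsilon> m x = 0"
proof -
  have "2 < \<bar>(x - s) / \<epsilon>\<bar>" if "x \<le> s" using that assms by (auto simp: abs_if field_simps)
  moreover have "2 < \<bar>(x - t) / \<epsilon>\<bar>" if "t < x" using that assms by (auto simp: abs_if field_simps)
  moreover have "x \<le> s \<or> t < x" using assms by auto
  ultimately show ?thesis unfolding bump_def using cutoff_tail[OF assms(1)] assms by auto
qed

lemma continuous_on_bump:
  assumes "cutoff \<eta>" "0 < \<epsilon>" "s < t" shows "continuous_on A (bump \<eta> s t \<epsilon> m)"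
  using bump_deriv[OF assms] by (intro continuous_at_imp_continuous_on ballI) (rule DERIV_isCont)

text \<open>Under the bilinear pairing the character with frequency -n selects the n-th Fourier
  coefficient; each x-derivative multiplies it by -in.\<close>

definition bump_test :: "(real \<Rightarrow> real) \<Rightarrow> real \<Rightarrow> real \<Rightarrow> real \<Rightarrow> int \<Rightarrow> nat \<Rightarrow> nat \<Rightarrow> real \<Rightarrow> real \<Rightarrow> complex" where
  "bump_test \<eta> s t \<epsilon> n m k \<tau> x =
     of_real (bump \<eta> s t \<epsilon> m \<tau>) * (- \<i> * of_int n) ^ k * cis (- (of_int n * x))"

lemma test_function_bump_test:
  assumes \<eta>: "cutoff \<eta>" and \<epsilon>: "0 < \<epsilon>" and st: "0 < s - 2 * \<epsilon>" "s < t" "t + 2 * \<epsilon> < T"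
  shows "test_function T (bump_test \<eta> s t \<epsilon> n)"
  unfolding test_function_def
proof (intro conjI allI)
  fix m k
  have cb: "continuous_on UNIV (\<lambda>z :: real \<times> real. bump \<eta> s t \<epsilon> m (fst z))"
    by (rule continuous_on_compose2[OF continuous_on_bump[OF \<eta> \<epsilon> st(2)]]) (auto intro: continuous_intros)
  show "continuous_on UNIV (\<lambda>(\<tau>, x). bump_test \<eta> s t \<epsilon> n m k \<tau> x)"
    unfolding bump_test_def split_beta by (intro continuous_intros cb)
  fix \<tau> x
  have "((\<lambda>\<tau>. complex_of_real (bump \<eta> s t \<epsilon> m \<tau>)) has_vector_derivative complex_of_real (bump \<eta> s t \<epsilon> (Suc m) \<tau>)) (at \<tau>)"
    using bump_deriv[OF \<eta> \<epsilon> st(2), of m \<tau>]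
    by (intro has_vector_derivative_of_real) (simp add: has_real_derivative_iff_has_vector_derivative)
  from has_vector_derivative_mult_left[OF this, of "(- \<i> * of_int n) ^ k * cis (- (of_int n * x))"]
  show "((\<lambda>\<sigma>. bump_test \<eta> s t \<epsilon> n m k \<sigma> x) has_vector_derivative bump_test \<eta> s t \<epsilon> n (Suc m) k \<tau> x) (at \<tau>)"
    by (simp only: bump_test_def mult.assoc)
  have "((\<lambda>x. cis (- (of_int n * x))) has_vector_derivative (- \<i> * of_int n) * cis (- (of_int n * x))) (at x)"
    unfolding cis_conv_exp by (auto intro!: derivative_eq_intros has_vector_derivative_real_field simp: algebra_simps)
  from has_vector_derivative_mult_right[OF this, of "of_real (bump \<eta> s t \<epsilon> m \<tau>) * (- \<i> * of_int n) ^ k"]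
  show "((\<lambda>y. bump_test \<eta> s t \<epsilon> n m k \<tau> y) has_vector_derivative bump_test \<eta> s t \<epsilon> n m (Suc k) \<tau> x) (at x)"
    by (simp only: bump_test_def power_Suc mult_ac)
next
  fix \<tau> x
  have "cis (- (of_int n * (x + 2 * pi))) = cis (- (of_int n * x)) * cis (2 * pi * of_int (- n))"
    by (simp add: cis_mult algebra_simps)
  also have "cis (2 * pi * of_int (- n)) = 1" by (rule cis_multiple_2pi) simp
  finally show "bump_test \<eta> s t \<epsilon> n 0 0 \<tau> (x + 2 * pi) = bump_test \<eta> s t \<epsilon> n 0 0 \<tau> x"
    by (simp only: bump_test_def mult_1_right)
next
  show "\<exists>a b. 0 < a \<and> b < T \<and> (\<forall>\<tau> x. \<tau> \<notin> {a..b} \<longrightarrow> bump_test \<eta> s t \<epsilon> n 0 0 \<tau> x = 0)"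
    using st bump_eq_0[OF \<eta> \<epsilon> st(2)]
    by (intro exI[of _ "s - 2 * \<epsilon>"] exI[of _ "t + 2 * \<epsilon>"]) (auto simp: bump_test_def not_le)
qed

text \<open>This is the weak form of y' = i p(n) y - i n g, where y and g are the n-th coefficients
  of \<open>u\<close> and \<open>f\<close>, tested with the bump in time.\<close>

lemma solves_bump_test:
  assumes \<eta>: "cutoff \<eta>" and \<epsilon>: "0 < \<epsilon>" and st: "0 < s - 2 * \<epsilon>" "s < t" "t + 2 * \<epsilon> < T"
    and sol: "solves p T u f"
  shows "(LINT \<tau>|time T. of_real (bump \<eta> s t \<epsilon> 1 \<tau>) * fourier (u \<tau>) n)
    = - (\<i> * of_real (p (of_int n))) * (LINT \<tau>|time T. of_real (bump \<eta> s t \<epsilon> 0 \<tau>) * fourier (u \<tau>) n)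
      + \<i> * of_int n * (LINT \<tau>|time T. of_real (bump \<eta> s t \<epsilon> 0 \<tau>) * fourier (f \<tau>) n)"
proof -
  let ?b = "\<lambda>m \<tau>. complex_of_real (bump \<eta> s t \<epsilon> m \<tau>)"
  have pair: "(LINT x|torus. v x * bump_test \<eta> s t \<epsilon> n m k \<tau> x) = 2 * pi * (- \<i> * of_int n) ^ k * (?b m \<tau> * fourier v n)" for v m k \<tau>
  proof -
    have "(LINT x|torus. v x * bump_test \<eta> s t \<epsilon> n m k \<tau> x)
        = (LINT x|torus. (?b m \<tau> * (- \<i> * of_int n) ^ k) * (v x * cis (- (of_int n * x))))"
      by (intro Bochner_Integration.integral_cong refl) (simp only: bump_test_def mult_ac)
    also have "\<dots> = (?b m \<tau> * (- \<i> * of_int n) ^ k) * (LINT x|torus. v x * cis (- (of_int n * x)))"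
      by (rule integral_mult_right_zero)
    finally show ?thesis by (simp add: fourier_def)
  qed
  \<comment> \<open>The test function has a single Fourier mode, so the pairing reduces to the term
    \<xi> = n.\<close>
  have dist: "dist_pairing (L_hat p v) (bump_test \<eta> s t \<epsilon> n 0 0 \<tau>)
      = 2 * pi * (- (\<i> * of_real (p (of_int n)))) * (?b 0 \<tau> * fourier v n)" for v \<tau>
  proof -
    have b: "bump_test \<eta> s t \<epsilon> n 0 0 \<tau> = (\<lambda>x. ?b 0 \<tau> * cis (of_int (- n) * x))"
      by (rule ext) (simp add: bump_test_def)
    have "(\<Sum>\<^sub>\<infinity>\<xi>. L_hat p v \<xi> * fourier (bump_test \<eta> s t \<epsilon> n 0 0 \<tau>) (- \<xi>)) = (\<Sum>\<^sub>\<infinity>\<xi>\<in>{n}. L_hat p v \<xi> * ?b 0 \<tau>)"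
      unfolding b fourier_character by (intro infsum_cong_neutral) auto
    thus ?thesis by (simp add: dist_pairing_def L_hat_def)
  qed
  have "- (LINT \<tau>|time T. (LINT x|torus. u \<tau> x * bump_test \<eta> s t \<epsilon> n 1 0 \<tau> x))
        + (LINT \<tau>|time T. dist_pairing (L_hat p (u \<tau>)) (bump_test \<eta> s t \<epsilon> n 0 0 \<tau>))
        - (LINT \<tau>|time T. (LINT x|torus. f \<tau> x * bump_test \<eta> s t \<epsilon> n 0 1 \<tau> x)) = 0"
    using sol test_function_bump_test[OF \<eta> \<epsilon> st] unfolding solves_def by blast
  hence "2 * of_real pi * (- (LINT \<tau>|time T. ?b 1 \<tau> * fourier (u \<tau>) n)
     - (\<i> * of_real (p (of_int n))) * (LINT \<tau>|time T. ?b 0 \<tau> * fourier (u \<tau>) n)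
      + \<i> * of_int n * (LINT \<tau>|time T. ?b 0 \<tau> * fourier (f \<tau>) n)) = 0"
    unfolding pair dist integral_mult_right_zero by (simp add: algebra_simps)
  moreover have "2 * of_real pi \<noteq> (0 :: complex)" by simp
  ultimately have "- (LINT \<tau>|time T. ?b 1 \<tau> * fourier (u \<tau>) n)
     - (\<i> * of_real (p (of_int n))) * (LINT \<tau>|time T. ?b 0 \<tau> * fourier (u \<tau>) n)
      + \<i> * of_int n * (LINT \<tau>|time T. ?b 0 \<tau> * fourier (f \<tau>) n) = 0"
    using mult_eq_0_iff by blast
  thus ?thesis by (simp only: add_eq_0_iff2 diff_conv_add_uminus) (simp add: algebra_simps)
qed

section \<open>Regularity of the coefficients in time\<close>

lemma borel_measurable_time: "f \<in> borel_measurable borel \<Longrightarrow> f \<in> borel_measurable (time T)"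
  by (intro measurable_restrict_space1 measurable_completion) simp

text \<open>The equation is integrated against completed Lebesgue measure on ]0, T[, whereas the
  calculus of primitives uses Borel functions on the line. A Borel representative that vanishes off
  the interval has the same integral.\<close>

lemma integral_time_eq_lborel:
  fixes \<phi> \<psi> :: "real \<Rightarrow> complex"
  assumes "\<phi> \<in> borel_measurable (time T)" and \<psi>[measurable]: "\<psi> \<in> borel_measurable borel"
    and "AE t in time T. \<phi> t = \<psi> t" and zero: "\<And>t. t \<notin> {0<..<T} \<Longrightarrow> \<psi> t = 0"
  shows "(LINT t|time T. \<phi> t) = (LINT t|lborel. \<psi> t)"
proof -
  have "(LINT t|time T. \<phi> t) = (LINT t|time T. \<psi> t)"
    by (rule integral_cong_AE[OF assms(1) borel_measurable_time[OF \<psi>] assms(3)])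
  also have "\<dots> = (LINT t|lebesgue. indicator {0<..<T} t *\<^sub>R \<psi> t)"
    by (rule integral_restrict_space) simp
  also have "\<dots> = (LINT t|lebesgue. \<psi> t)"
    by (intro Bochner_Integration.integral_cong refl) (auto simp: zero indicator_def)
  also have "\<dots> = (LINT t|lborel. \<psi> t)" by (rule integral_completion) measurable
  finally show ?thesis .
qed

lemma AE_time_iff: "(AE t in time T. P t) \<longleftrightarrow> (AE t in lborel. t \<in> {0<..<T} \<longrightarrow> P t)"
  by (subst AE_restrict_space_iff) (auto simp: AE_completion_iff)

lemma borel_representative:
  fixes \<phi> :: "real \<Rightarrow> complex"
  assumes "\<phi> \<in> borel_measurable lebesgue"
  obtains g where "g \<in> borel_measurable borel" "AE t in lborel. \<phi> t = g t"
proof -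
  have "(\<lambda>t. Re (\<phi> t)) \<in> borel_measurable lebesgue" "(\<lambda>t. Im (\<phi> t)) \<in> borel_measurable lebesgue"
    using assms by measurable
  from this[THEN completion_ex_borel_measurable_real]
  obtain g1 g2 where [measurable]: "g1 \<in> borel_measurable lborel" "g2 \<in> borel_measurable lborel"
    and g: "AE t in lborel. Re (\<phi> t) = g1 t" "AE t in lborel. Im (\<phi> t) = g2 t"
    by blast
  have "(\<lambda>t. complex_of_real (g1 t) + \<i> * complex_of_real (g2 t)) \<in> borel_measurable borel" by measurable
  moreover have "AE t in lborel. \<phi> t = complex_of_real (g1 t) + \<i> * complex_of_real (g2 t)"
    using g by eventually_elim (simp add: complex_eq_iff)
  ultimately show thesis by (rule that)
qed

text \<open>The coefficients of the approximating simple functions are simple in time, and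
  \<open>norm_fourier_le\<close> makes them converge to those of \<open>f\<close> at almost every
  time.\<close>

lemma fourier_measurable:
  assumes f: "memLinfTL2 T f"
  shows "(\<lambda>t. if t \<in> {0<..<T} then fourier (f t) n else 0) \<in> borel_measurable lebesgue"
proof -
  have "strongly_measurable_L2 T f" using f by (simp add: memLinfTL2_def)
  then obtain s where s0: "\<forall>k. simple_function (time T) (s k) \<and> (\<forall>t\<in>{0<..<T}. memL2 (s k t))"
    and lim: "AE t in time T. (\<lambda>k. L2norm (\<lambda>x. s k t x - f t x)) \<longlonglongrightarrow> 0"
    unfolding strongly_measurable_L2_def by (elim exE conjE) (rule that)
  have s: "\<And>k. simple_function (time T) (s k)" "\<And>k t. t \<in> {0<..<T} \<Longrightarrow> memL2 (s k t)"
    using s0 by auto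
  define S where "S = (\<lambda>k t. if t \<in> {0<..<T} then fourier (s k t) n else 0)"
  have [measurable]: "S k \<in> borel_measurable lebesgue" for k
  proof -
    have "simple_function (time T) (\<lambda>t. fourier (s k t) n)"
      by (rule simple_function_compose1[OF s(1)])
    hence "(\<lambda>t. fourier (s k t) n) \<in> borel_measurable (time T)" by (rule borel_measurable_simple_function)
    thus ?thesis unfolding S_def by (rule borel_measurable_if_I) simp
  qed
  have conv: "(\<lambda>k. S k t) \<longlonglongrightarrow> (if t \<in> {0<..<T} then fourier (f t) n else 0)"
    if t: "t \<in> {0<..<T} \<longrightarrow> (\<lambda>k. L2norm (\<lambda>x. s k t x - f t x)) \<longlonglongrightarrow> 0" for t
  proof (cases "t \<in> {0<..<T}")
    case True
    have mf: "memL2 (f t)" using f True by (auto simp: memLinfTL2_def)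
    have "ennreal (cmod (fourier (s k t) n - fourier (f t) n)) \<le> L2norm (\<lambda>x. s k t x - f t x)" for k
    proof -
      have "(\<lambda>x. s k t x - f t x) \<in> borel_measurable torus"
        using mf s(2)[OF True, of k] unfolding memL2_def by (intro borel_measurable_diff) simp_all
      from norm_fourier_le[OF this] show ?thesis by (simp only: fourier_diff[OF s(2)[OF True] mf])
    qed
    hence "(\<lambda>k. ennreal (cmod (fourier (s k t) n - fourier (f t) n))) \<longlonglongrightarrow> 0"
      by (intro tendsto_sandwich[OF _ _ tendsto_const t[rule_format, OF True]] always_eventually allI) simp_all
    hence "(\<lambda>k. cmod (fourier (s k t) n - fourier (f t) n)) \<longlonglongrightarrow> 0"
      by (subst (asm) ennreal_tendsto_0_iff) auto
    thus ?thesis using True unfolding S_def by (simp add: LIM_zero_iff tendsto_norm_zero_iff)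
  next
    case False
    show ?thesis unfolding S_def by (simp only: False if_False tendsto_const)
  qed
  \<comment> \<open>\<open>lim\<close> has a value, and is measurable, also where the sequence
    diverges. Completeness of the measure then allows a change on a null set.\<close>
  have "(\<lambda>t. lim (\<lambda>k. S k t)) \<in> borel_measurable lebesgue" by measurable
  moreover have "AE t in lebesgue. lim (\<lambda>k. S k t) = (if t \<in> {0<..<T} then fourier (f t) n else 0)"
  proof -
    have "AE t in lebesgue. t \<in> {0<..<T} \<longrightarrow> (\<lambda>k. L2norm (\<lambda>x. s k t x - f t x)) \<longlonglongrightarrow> 0"
      using lim by (subst (asm) AE_restrict_space_iff) auto
    thus ?thesis by eventually_elim (intro limI conv)
  qed
  ultimately show ?thesis by (rule borel_measurable_AE)
qed

lemma fourier_forcing_representative: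
  assumes f: "memLinfTL2 T f"
  obtains g where "g \<in> borel_measurable borel" "bounded (range g)"
    "AE t in time T. fourier (f t) n = g t"
proof -
  obtain g0 where [measurable]: "g0 \<in> borel_measurable borel"
    and g0: "AE t in lborel. (if t \<in> {0<..<T} then fourier (f t) n else 0) = g0 t"
    using borel_representative[OF fourier_measurable[OF f]] by blast
  obtain B where B: "LinfTL2norm T f = ennreal B" "0 \<le> B"
    using f by (cases "LinfTL2norm T f") (auto simp: memLinfTL2_def)
  have "AE t in time T. cmod (fourier (f t) n) \<le> B"
  proof -
    have "AE t in time T. L2norm (f t) \<le> ennreal B"
      using esssup_AE[where M = "time T" and f = "\<lambda>t. L2norm (f t)"] B by (simp add: LinfTL2norm_def)
    moreover have "AE t in time T. ennreal (cmod (fourier (f t) n)) \<le> L2norm (f t)"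
      using f by (intro AE_I2 norm_fourier_le) (auto simp: memLinfTL2_def memL2_def space_restrict_space)
    ultimately show ?thesis
    proof eventually_elim
      case (elim t)
      have "ennreal (cmod (fourier (f t) n)) \<le> ennreal B" by (rule order_trans[OF elim(2) elim(1)])
      thus ?case using ennreal_le_iff[OF B(2)] by blast
    qed
  qed
  hence bnd: "AE t in lborel. t \<in> {0<..<T} \<longrightarrow> cmod (fourier (f t) n) \<le> B" by (simp only: AE_time_iff)
  \<comment> \<open>Truncation turns the essential bound into a bound at every point, as
    \<open>is_primitive\<close> demands, and alters \<open>g0\<close> on a null set only.\<close>
  define g where "g = (\<lambda>t. if cmod (g0 t) \<le> B then g0 t else 0)"
  have "g \<in> borel_measurable borel" unfolding g_def by measurable
  moreover have "bounded (range g)" using B(2) by (auto simp: bounded_iff g_def)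
  moreover have "AE t in time T. fourier (f t) n = g t"
    unfolding AE_time_iff using g0 bnd by eventually_elim (auto simp: g_def)
  ultimately show thesis by (rule that)
qed

lemma continuous_on_fourier:
  assumes u: "memCTL2 T u"
  shows "continuous_on {0..T} (\<lambda>t. fourier (u t) n)"
  unfolding continuous_on_def
proof
  fix t assume t: "t \<in> {0..T}"
  have mem: "memL2 (u s)" if "s \<in> {0..T}" for s using u that by (auto simp: memCTL2_def)
  have lim: "((\<lambda>s. L2norm (\<lambda>x. u s x - u t x)) \<longlongrightarrow> 0) (at t within {0..T})" using u t by (auto simp: memCTL2_def)
  have le: "ennreal (cmod (fourier (u s) n - fourier (u t) n)) \<le> L2norm (\<lambda>x. u s x - u t x)" if "s \<in> {0..T}" for s
  proof -
    have "(\<lambda>x. u s x - u t x) \<in> borel_measurable torus"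
      using mem[OF that] mem[OF t] unfolding memL2_def by (intro borel_measurable_diff) simp_all
    from norm_fourier_le[OF this] show ?thesis by (simp only: fourier_diff[OF mem[OF that] mem[OF t]])
  qed
  have "((\<lambda>s. ennreal (cmod (fourier (u s) n - fourier (u t) n))) \<longlongrightarrow> 0) (at t within {0..T})"
  proof (rule tendsto_sandwich[OF _ _ tendsto_const lim])
    have "\<forall>\<^sub>F s in at t within {0..T}. s \<in> {0..T}" by (simp add: eventually_at_filter)
    thus "\<forall>\<^sub>F s in at t within {0..T}. ennreal (cmod (fourier (u s) n - fourier (u t) n)) \<le> L2norm (\<lambda>x. u s x - u t x)"
      by (rule eventually_mono) (rule le)
  qed simp
  hence "((\<lambda>s. cmod (fourier (u s) n - fourier (u t) n)) \<longlongrightarrow> 0) (at t within {0..T})"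
    using tendsto_ennreal_iff[of "\<lambda>s. cmod (fourier (u s) n - fourier (u t) n)" "at t within {0..T}" 0] by simp
  thus "((\<lambda>s. fourier (u s) n) \<longlongrightarrow> fourier (u t) n) (at t within {0..T})"
    by (simp add: LIM_zero_iff tendsto_norm_zero_iff)
qed

section \<open>From the distributional equation to primitives\<close>

lemma cutoff_deriv_bounded:
  assumes \<eta>: "cutoff \<eta>"
  obtains D where "\<And>x. \<bar>deriv \<eta> x\<bar> \<le> D" "0 \<le> D"
proof -
  have cd: "continuous_on {-2..2} (deriv \<eta>)"
    using cutoff_deriv[OF \<eta>, of 1] by (intro continuous_at_imp_continuous_on ballI DERIV_isCont) auto
  have "compact (deriv \<eta> ` {-2..2})" by (intro compact_continuous_image cd) auto
  then obtain D where D: "\<And>x. x \<in> {-2..2} \<Longrightarrow> \<bar>deriv \<eta> x\<bar> \<le> D"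
    using compact_imp_bounded bounded_iff by (metis imageI real_norm_def)
  have D0: "0 \<le> D" using D[of 0] by (smt (verit) abs_ge_zero atLeastAtMost_iff)
  have "\<bar>deriv \<eta> x\<bar> \<le> D" for x
  proof (cases "x \<in> {-2..2}")
    case False
    hence "deriv \<eta> x = 0" using cutoff_tail[OF \<eta>, of x 1] by (auto simp: abs_if split: if_splits)
    thus ?thesis using D0 by simp
  qed (rule D)
  thus thesis using D0 by (rule that)
qed

text \<open>Rescaling turns the derivative of the cutoff into an approximation of the evaluation at \<open>r\<close>.\<close>

lemma cutoff_deriv_tendsto:
  fixes y :: "real \<Rightarrow> complex" and A :: "real set"
  assumes \<eta>: "cutoff \<eta>" and y: "continuous_on UNIV y" "bounded (range y)"
    and [measurable]: "A \<in> sets borel" and \<epsilon>: "\<And>k. 0 < \<epsilon> k" "\<epsilon> \<longlonglongrightarrow> 0"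
    and A: "\<And>x \<epsilon>. 0 < \<epsilon> \<Longrightarrow> r + \<epsilon> * x \<in> A \<longleftrightarrow> x \<in> A'" and [measurable]: "A' \<in> sets borel"
  shows "(\<lambda>k. LINT x|lborel. of_real (indicator A x * (deriv \<eta> ((x - r) / \<epsilon> k) / \<epsilon> k)) * y x)
    \<longlonglongrightarrow> (LINT x|lborel. of_real (indicator A' x * deriv \<eta> x)) * y r"
proof -
  have cd: "continuous_on UNIV (deriv \<eta>)"
    using cutoff_deriv[OF \<eta>, of 1] by (intro continuous_at_imp_continuous_on ballI DERIV_isCont) auto
  have [measurable]: "deriv \<eta> \<in> borel_measurable borel" "y \<in> borel_measurable borel"
    by (intro borel_measurable_continuous_onI cd y)+
  obtain B where B: "\<And>x. cmod (y x) \<le> B" using y(2) by (auto simp: bounded_iff)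
  obtain D where D: "\<And>x. \<bar>deriv \<eta> x\<bar> \<le> D" "0 \<le> D" using cutoff_deriv_bounded[OF \<eta>] by blast
  have tail: "deriv \<eta> x = 0" if "x \<notin> {-2..2}" for x
    using cutoff_tail[OF \<eta>, of x 1] that by (auto simp: abs_if split: if_splits)
  \<comment> \<open>The substitution centred at \<open>r\<close> absorbs the factor 1/\<epsilon>.
    The condition relating \<open>A\<close> and \<open>A'\<close>, satisfied by half-lines ending at
    \<open>r\<close>, makes the resulting set independent of \<epsilon>.\<close>
  have scale: "(LINT x|lborel. of_real (indicator A x * (deriv \<eta> ((x - r) / \<epsilon> k) / \<epsilon> k)) * y x)
     = (LINT x|lborel. of_real (indicator A' x * deriv \<eta> x) * y (r + \<epsilon> k * x))" for k
  proof -
    have "(LINT x|lborel. of_real (indicator A x * (deriv \<eta> ((x - r) / \<epsilon> k) / \<epsilon> k)) * y x)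
      = \<bar>\<epsilon> k\<bar> *\<^sub>R (LINT x|lborel. of_real (indicator A (r + \<epsilon> k * x) * (deriv \<eta> ((r + \<epsilon> k * x - r) / \<epsilon> k) / \<epsilon> k)) * y (r + \<epsilon> k * x))"
      using \<epsilon>(1)[of k] by (intro lborel_integral_real_affine) auto
    also have "\<dots> = (LINT x|lborel. \<bar>\<epsilon> k\<bar> *\<^sub>R (of_real (indicator A (r + \<epsilon> k * x) * (deriv \<eta> ((r + \<epsilon> k * x - r) / \<epsilon> k) / \<epsilon> k)) * y (r + \<epsilon> k * x)))"
      by (rule integral_scaleR_right[symmetric])
    also have "\<dots> = (LINT x|lborel. of_real (indicator A' x * deriv \<eta> x) * y (r + \<epsilon> k * x))"
      using \<epsilon>(1)[of k] A[OF \<epsilon>(1)[of k]]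
      by (intro Bochner_Integration.integral_cong refl) (auto simp: indicator_def scaleR_conv_of_real)
    finally show ?thesis .
  qed
  have "(\<lambda>k. LINT x|lborel. of_real (indicator A' x * deriv \<eta> x) * y (r + \<epsilon> k * x))
    \<longlonglongrightarrow> (LINT x|lborel. of_real (indicator A' x * deriv \<eta> x) * y r)"
  proof (rule integral_dominated_convergence[where w = "\<lambda>x. indicator {-2..2} x *\<^sub>R (D * B)"])
    show "integrable lborel (\<lambda>x. indicator {-2..2::real} x *\<^sub>R (D * B))"
      by (intro integrable_scaleR_left) (simp add: integrable_indicator_iff)
    show "AE x in lborel. (\<lambda>k. of_real (indicator A' x * deriv \<eta> x) * y (r + \<epsilon> k * x)) \<longlonglongrightarrow> of_real (indicator A' x * deriv \<eta> x) * y r"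
    proof (intro AE_I2 tendsto_mult tendsto_const)
      fix x
      have "(\<lambda>k. r + \<epsilon> k * x) \<longlonglongrightarrow> r + 0 * x" by (intro tendsto_intros \<epsilon>)
      thus "(\<lambda>k. y (r + \<epsilon> k * x)) \<longlonglongrightarrow> y r"
        using continuous_on_tendsto_compose[OF y(1), of "\<lambda>k. r + \<epsilon> k * x" r] by simp
    qed
    show "AE x in lborel. norm (of_real (indicator A' x * deriv \<eta> x) * y (r + \<epsilon> k * x)) \<le> indicator {-2..2} x *\<^sub>R (D * B)" for k
    proof (rule AE_I2)
      fix x
      show "norm (of_real (indicator A' x * deriv \<eta> x) * y (r + \<epsilon> k * x)) \<le> indicator {-2..2} x *\<^sub>R (D * B)"
      proof (cases "x \<in> {-2..2}")
        case True
        have "norm (of_real (indicator A' x * deriv \<eta> x) * y (r + \<epsilon> k * x)) \<le> \<bar>deriv \<eta> x\<bar> * cmod (y (r + \<epsilon> k * x))"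
          by (auto simp: norm_mult indicator_def)
        also have "\<dots> \<le> D * B" by (intro mult_mono D B) simp
        finally show ?thesis using True by simp
      qed (simp add: tail)
    qed
  qed measurable
  also have "(LINT x|lborel. of_real (indicator A' x * deriv \<eta> x) * y r) = (LINT x|lborel. of_real (indicator A' x * deriv \<eta> x)) * y r"
    by (rule integral_mult_left_zero)
  finally show ?thesis by (simp only: scale)
qed

text \<open>The cutoff goes from 0 to 1 on the left half-line and back to 0 on the right one. These
  masses become the signs of y(s) and y(t) in the limit. The points -3 and 3 lie outside the
  support.\<close>

lemma integral_cutoff_deriv:
  assumes \<eta>: "cutoff \<eta>"
  shows "(LINT x|lborel. complex_of_real (indicator {..0} x * deriv \<eta> x)) = 1"
    and "(LINT x|lborel. complex_of_real (indicator {0<..} x * deriv \<eta> x)) = - 1"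
proof -
  have cd: "continuous_on A (deriv \<eta>)" for A
    using cutoff_deriv[OF \<eta>, of 1] by (intro continuous_at_imp_continuous_on ballI DERIV_isCont) auto
  have dv: "(\<eta> has_vector_derivative deriv \<eta> x) (at x within A)" for x A
    using cutoff_deriv[OF \<eta>, of 0 x]
    by (auto simp: has_real_derivative_iff_has_vector_derivative intro: has_vector_derivative_at_within)
  have tail: "deriv \<eta> x = 0" if "2 < \<bar>x\<bar>" for x using cutoff_tail[OF \<eta> that, of 1] by simp
  have "(LINT x|lborel. indicator {..0} x * deriv \<eta> x) = (LINT x|lborel. indicator {-3..0} x *\<^sub>R deriv \<eta> x)"
    by (intro Bochner_Integration.integral_cong refl) (auto simp: indicator_def intro!: tail)
  also have "\<dots> = \<eta> 0 - \<eta> (- 3)" by (rule integral_FTC_atLeastAtMost[OF _ dv cd]) simp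
  finally have 1: "(LINT x|lborel. indicator {..0} x * deriv \<eta> x) = 1"
    using cutoff_eq_0[OF \<eta>] cutoff_eq_1[OF \<eta>] by simp
  \<comment> \<open>The closed interval contains 0 but the half-line does not; the integrands agree
    there because this derivative is zero.\<close>
  have "deriv \<eta> 0 = 0" using cutoff_plateau[OF \<eta>, of 0 1] by simp
  hence "(LINT x|lborel. indicator {0<..} x * deriv \<eta> x) = (LINT x|lborel. indicator {0..3} x *\<^sub>R deriv \<eta> x)"
  proof (intro Bochner_Integration.integral_cong refl)
    fix x :: real
    show "indicator {0<..} x * deriv \<eta> x = indicator {0..3} x *\<^sub>R deriv \<eta> x" if "deriv \<eta> 0 = 0"
      using that tail[of x] by (cases "x = 0") (auto simp: indicator_def)
  qed
  also have "\<dots> = \<eta> 3 - \<eta> 0" by (rule integral_FTC_atLeastAtMost[OF _ dv cd]) simp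
  finally have 2: "(LINT x|lborel. indicator {0<..} x * deriv \<eta> x) = - 1"
    using cutoff_eq_0[OF \<eta>] cutoff_eq_1[OF \<eta>] by simp
  show "(LINT x|lborel. complex_of_real (indicator {..0} x * deriv \<eta> x)) = 1"
    "(LINT x|lborel. complex_of_real (indicator {0<..} x * deriv \<eta> x)) = - 1"
    unfolding integral_complex_of_real 1 2 by simp_all
qed

lemma integrable_bounded_support:
  fixes f :: "real \<Rightarrow> 'a::{banach, second_countable_topology}"
  assumes "f \<in> borel_measurable borel" "\<And>x. x \<in> {a..b} \<Longrightarrow> norm (f x) \<le> B" "\<And>x. x \<notin> {a..b} \<Longrightarrow> f x = 0"
  shows "integrable lborel f"
  by (rule integrableI_bounded_set[of "{a..b}" _ _ B])
    (use assms in \<open>auto simp: emeasure_lborel_Icc_eq\<close>)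

lemma bump_range:
  assumes "cutoff \<eta>" shows "0 \<le> bump \<eta> s t \<epsilon> 0 x" "bump \<eta> s t \<epsilon> 0 x \<le> 1"
  using assms by (auto simp: bump_def cutoff_def)

text \<open>The lemma of du Bois-Reymond; the special test functions tend to the indicator function of \<open>[s,t]\<close>.\<close>

lemma distributional_primitive:
  fixes y H :: "real \<Rightarrow> complex"
  assumes \<eta>: "cutoff \<eta>" and y: "continuous_on UNIV y" "bounded (range y)"
    and H: "H \<in> borel_measurable borel" "bounded (range H)" and st: "0 < s" "s < t" "t < T"
    and eq: "\<And>\<epsilon>. 0 < \<epsilon> \<Longrightarrow> 0 < s - 2 * \<epsilon> \<Longrightarrow> t + 2 * \<epsilon> < T \<Longrightarrow>
      (LINT x|lborel. of_real (bump \<eta> s t \<epsilon> 1 x) * y x) = (LINT x|lborel. of_real (bump \<eta> s t \<epsilon> 0 x) * H x)"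
  shows "y s - y t = (LINT x:{s..t}|lborel. H x)"
proof -
  \<comment> \<open>The quarter gives 2 \<epsilon> \<le> s/2 and 2 \<epsilon> \<le> (T - t)/2, so
    the bump is supported strictly inside ]0, T[.\<close>
  define \<epsilon> where "\<epsilon> = (\<lambda>k. min s (T - t) / 4 / real (Suc k))"
  have \<epsilon>_pos: "0 < \<epsilon> k" for k using st by (simp add: \<epsilon>_def)
  have \<epsilon>_le: "\<epsilon> k \<le> min s (T - t) / 4" for k
  proof -
    have "min s (T - t) / 4 / real (Suc k) \<le> min s (T - t) / 4 / 1"
      using st by (intro divide_left_mono) auto
    thus ?thesis by (simp add: \<epsilon>_def)
  qed
  have \<epsilon>_st: "0 < s - 2 * \<epsilon> k" "t + 2 * \<epsilon> k < T" for k
  proof -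
    have "\<epsilon> k \<le> s / 4" "\<epsilon> k \<le> (T - t) / 4" using \<epsilon>_le[of k] by auto
    thus "0 < s - 2 * \<epsilon> k" "t + 2 * \<epsilon> k < T" using st by auto
  qed
  have \<epsilon>_lim: "\<epsilon> \<longlonglongrightarrow> 0"
    unfolding \<epsilon>_def by (rule lim_const_over_n[THEN LIMSEQ_Suc])
  note [measurable] = H(1)
  have [measurable]: "y \<in> borel_measurable borel" by (intro borel_measurable_continuous_onI y)
  have cd: "continuous_on UNIV (deriv \<eta>)"
    using cutoff_deriv[OF \<eta>, of 1] by (intro continuous_at_imp_continuous_on ballI DERIV_isCont) auto
  hence [measurable]: "deriv \<eta> \<in> borel_measurable borel" by (rule borel_measurable_continuous_onI)
  obtain B where B: "\<And>x. cmod (y x) \<le> B" using y(2) by (auto simp: bounded_iff)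
  obtain M where M: "\<And>x. cmod (H x) \<le> M" using H(2) by (auto simp: bounded_iff)
  obtain D where D: "\<And>x. \<bar>deriv \<eta> x\<bar> \<le> D" "0 \<le> D" using cutoff_deriv_bounded[OF \<eta>] by blast
  let ?P = "\<lambda>A r k x. of_real (indicator A x * (deriv \<eta> ((x - r) / \<epsilon> k) / \<epsilon> k)) * y x"
  have int: "integrable lborel (?P A r k)" if [measurable]: "A \<in> sets borel" for A r k
  proof (rule integrable_bounded_support[of _ "r - 2 * \<epsilon> k" "r + 2 * \<epsilon> k" "D / \<epsilon> k * B"])
    show "?P A r k \<in> borel_measurable borel" by measurable
    fix x
    have "norm (?P A r k x) \<le> \<bar>deriv \<eta> ((x - r) / \<epsilon> k)\<bar> / \<epsilon> k * cmod (y x)"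
      using \<epsilon>_pos[of k] by (auto simp: norm_mult norm_divide indicator_def)
    also have "\<dots> \<le> D / \<epsilon> k * B"
      using \<epsilon>_pos[of k] D by (intro mult_mono divide_right_mono B) auto
    finally show "norm (?P A r k x) \<le> D / \<epsilon> k * B" .
    assume "x \<notin> {r - 2 * \<epsilon> k..r + 2 * \<epsilon> k}"
    hence "2 < \<bar>(x - r) / \<epsilon> k\<bar>" using \<epsilon>_pos[of k] by (auto simp: abs_if field_simps)
    hence "deriv \<eta> ((x - r) / \<epsilon> k) = 0" using cutoff_tail[OF \<eta>, of _ 1] by simp
    thus "?P A r k x = 0" by simp
  qed
  \<comment> \<open>The derivative of the bump vanishes on the plateau and splits into two rescaled
    transitions, at \<open>s\<close> and at \<open>t\<close>.\<close>
  have "(LINT x|lborel. of_real (bump \<eta> s t (\<epsilon> k) 1 x) * y x)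
    = (LINT x|lborel. ?P {..s} s k x) + (LINT x|lborel. ?P {t<..} t k x)" for k
  proof -
    have "(LINT x|lborel. of_real (bump \<eta> s t (\<epsilon> k) 1 x) * y x) = (LINT x|lborel. ?P {..s} s k x + ?P {t<..} t k x)"
      using st(2) by (intro Bochner_Integration.integral_cong refl) (auto simp: bump_def indicator_def)
    also have "\<dots> = (LINT x|lborel. ?P {..s} s k x) + (LINT x|lborel. ?P {t<..} t k x)"
      by (intro Bochner_Integration.integral_add int) auto
    finally show ?thesis .
  qed
  moreover have "(\<lambda>k. (LINT x|lborel. ?P {..s} s k x) + (LINT x|lborel. ?P {t<..} t k x)) \<longlonglongrightarrow> 1 * y s + (- 1) * y t"
  proof (rule tendsto_add)
    show "(\<lambda>k. LINT x|lborel. ?P {..s} s k x) \<longlonglongrightarrow> 1 * y s"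
      unfolding integral_cutoff_deriv(1)[OF \<eta>, symmetric]
      by (rule cutoff_deriv_tendsto[OF \<eta> y _ \<epsilon>_pos \<epsilon>_lim]) (auto simp: mult_le_0_iff)
    show "(\<lambda>k. LINT x|lborel. ?P {t<..} t k x) \<longlonglongrightarrow> (- 1) * y t"
      unfolding integral_cutoff_deriv(2)[OF \<eta>, symmetric]
      by (rule cutoff_deriv_tendsto[OF \<eta> y _ \<epsilon>_pos \<epsilon>_lim]) (auto simp: zero_less_mult_iff)
  qed
  ultimately have L: "(\<lambda>k. LINT x|lborel. of_real (bump \<eta> s t (\<epsilon> k) 1 x) * y x) \<longlonglongrightarrow> y s - y t" by simp
  have R: "(\<lambda>k. LINT x|lborel. of_real (bump \<eta> s t (\<epsilon> k) 0 x) * H x) \<longlonglongrightarrow> (LINT x|lborel. indicator {s..t} x *\<^sub>R H x)"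
  proof (rule integral_dominated_convergence[where w = "\<lambda>x. indicator {0..T} x *\<^sub>R M"])
    show "integrable lborel (\<lambda>x. indicator {0..T} x *\<^sub>R M)"
      by (intro integrable_scaleR_left) (simp add: integrable_indicator_iff emeasure_lborel_Icc_eq)
    have [measurable]: "bump \<eta> s t (\<epsilon> k) 0 \<in> borel_measurable borel" for k
      by (intro borel_measurable_continuous_onI continuous_on_bump \<eta> \<epsilon>_pos st)
    show "(\<lambda>x. of_real (bump \<eta> s t (\<epsilon> k) 0 x) * H x) \<in> borel_measurable lborel" for k by measurable
    show "(\<lambda>x. indicator {s..t} x *\<^sub>R H x) \<in> borel_measurable lborel" by measurable
    show "AE x in lborel. norm (of_real (bump \<eta> s t (\<epsilon> k) 0 x) * H x) \<le> indicator {0..T} x *\<^sub>R M" for k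
    proof (rule AE_I2)
      fix x
      show "norm (of_real (bump \<eta> s t (\<epsilon> k) 0 x) * H x) \<le> indicator {0..T} x *\<^sub>R M"
      proof (cases "x \<in> {0..T}")
        case True
        have "norm (of_real (bump \<eta> s t (\<epsilon> k) 0 x) * H x) \<le> 1 * M"
          unfolding norm_mult norm_of_real using bump_range[OF \<eta>, of s t "\<epsilon> k" x] by (intro mult_mono M) auto
        thus ?thesis using True by simp
      next
        case False
        hence "x < s - 2 * \<epsilon> k \<or> t + 2 * \<epsilon> k < x" using \<epsilon>_st[of k] by auto
        thus ?thesis using False bump_eq_0[OF \<eta> \<epsilon>_pos st(2)] by simp
      qed
    qed
    show "AE x in lborel. (\<lambda>k. of_real (bump \<eta> s t (\<epsilon> k) 0 x) * H x) \<longlonglongrightarrow> indicator {s..t} x *\<^sub>R H x"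
    proof (rule AE_I2)
      fix x
      show "(\<lambda>k. of_real (bump \<eta> s t (\<epsilon> k) 0 x) * H x) \<longlonglongrightarrow> indicator {s..t} x *\<^sub>R H x"
      proof (cases "x \<in> {s..t}")
        case True
        hence "bump \<eta> s t (\<epsilon> k) 0 x = 1" for k using cutoff_eq_1[OF \<eta>, of 0] by (auto simp: bump_def)
        thus ?thesis using True by simp
      next
        case False
        \<comment> \<open>Off [s, t] the bump is eventually zero, namely once 2 \<epsilon> is
          smaller than the distance to the interval.\<close>
        hence pos: "0 < max (s - x) (x - t) / 2" by auto
        from order_tendstoD(2)[OF \<epsilon>_lim pos]
        have "\<forall>\<^sub>F k in sequentially. of_real (bump \<eta> s t (\<epsilon> k) 0 x) * H x = 0"
        proof eventually_elim
          case (elim k)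
          hence "x < s - 2 * \<epsilon> k \<or> t + 2 * \<epsilon> k < x" by auto
          thus ?case using bump_eq_0[OF \<eta> \<epsilon>_pos st(2)] by simp
        qed
        thus ?thesis using False by (simp add: tendsto_eventually)
      qed
    qed
  qed
  have "(LINT x|lborel. of_real (bump \<eta> s t (\<epsilon> k) 1 x) * y x) = (LINT x|lborel. of_real (bump \<eta> s t (\<epsilon> k) 0 x) * H x)" for k
    by (rule eq[OF \<epsilon>_pos \<epsilon>_st])
  with L R show ?thesis unfolding set_lebesgue_integral_def by (simp only:) (rule LIMSEQ_unique)
qed

text \<open>Clamping the time to [0, T] extends the coefficient of \<open>u\<close> to a bounded
  continuous function on the line, as \<open>distributional_primitive\<close> requires, and does not
  change it on the interval. The forcing enters through a Borel representative.\<close>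

lemma fourier_primitive:
  assumes \<eta>: "cutoff \<eta>" and T: "0 < T" and u: "memCTL2 T u" and f: "memLinfTL2 T f" and sol: "solves p T u f"
    and g: "g \<in> borel_measurable borel" "bounded (range g)" "AE t in time T. fourier (f t) n = g t"
  defines "y \<equiv> \<lambda>t. fourier (u (max 0 (min T t))) n"
  shows "is_primitive T y (\<lambda>t. \<i> * of_real (p (of_int n)) * y t - \<i> * of_real (of_int n) * g t)"
proof -
  note [measurable] = g(1)
  have cy: "continuous_on UNIV y"
    unfolding y_def
    by (rule continuous_on_compose2[OF continuous_on_fourier[OF u]]) (use T in \<open>auto intro!: continuous_intros\<close>)
  hence [measurable]: "y \<in> borel_measurable borel" by (rule borel_measurable_continuous_onI)
  have bdy: "bounded (range y)"
  proof -
    have "range y \<subseteq> (\<lambda>t. fourier (u t) n) ` {0..T}" using T by (auto simp: y_def)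
    moreover have "compact ((\<lambda>t. fourier (u t) n) ` {0..T})"
      by (intro compact_continuous_image continuous_on_fourier[OF u]) auto
    ultimately show ?thesis using bounded_subset compact_imp_bounded by blast
  qed
  have y_eq: "fourier (u t) n = y t" if "t \<in> {0<..<T}" for t using that by (simp add: y_def)
  have mu: "(\<lambda>t. fourier (u t) n) \<in> borel_measurable (time T)"
    using borel_measurable_time[of y T] by (subst measurable_cong[of _ _ y]) (auto simp: space_restrict_space y_eq)
  have mf: "(\<lambda>t. fourier (f t) n) \<in> borel_measurable (time T)"
    using measurable_restrict_space1[OF fourier_measurable[OF f, of n], of "{0<..<T}"]
    by (rule measurable_cong[THEN iffD1, rotated]) (auto simp: space_restrict_space)
  let ?G = "\<lambda>t. \<i> * of_real (p (of_int n)) * y t - \<i> * of_real (of_int n) * g t"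
  have bc: "bounded (range (\<lambda>t. k * h t))" if "bounded (range h)" for h :: "real \<Rightarrow> complex" and k
    using bounded_range_mult[of "\<lambda>_. k" h] that by (auto simp: bounded_iff)
  have bG: "bounded (range ?G)"
    using bounded_range_add[OF bc[OF bdy, of "\<i> * of_real (p (of_int n))"] bc[OF g(2), of "- \<i> * of_real (of_int n)"]] by simp
  \<comment> \<open>Testing moves the derivative onto the bump, hence the minus sign in front of
    \<open>?G\<close>.\<close>
  have main: "y s - y t = (LINT x:{s..t}|lborel. - ?G x)" if st: "0 < s" "s < t" "t < T" for s t
  proof (rule distributional_primitive[OF \<eta> cy bdy _ _ st])
    show "(\<lambda>x. - ?G x) \<in> borel_measurable borel" by measurable
    show "bounded (range (\<lambda>x. - ?G x))" using bc[OF bG, of "-1"] by simp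
    fix \<epsilon> assume \<epsilon>: "0 < \<epsilon>" "0 < s - 2 * \<epsilon>" "t + 2 * \<epsilon> < T"
    let ?b = "\<lambda>m x. complex_of_real (bump \<eta> s t \<epsilon> m x)"
    have [measurable]: "bump \<eta> s t \<epsilon> m \<in> borel_measurable borel" for m
      by (intro borel_measurable_continuous_onI continuous_on_bump \<eta> \<epsilon> st)
    have b0: "?b m x = 0" if "x \<notin> {0<..<T}" for m x
    proof -
      have "x < s - 2 * \<epsilon> \<or> t + 2 * \<epsilon> < x" using that \<epsilon> by auto
      thus ?thesis using bump_eq_0[OF \<eta> \<epsilon>(1) st(2)] by simp
    qed
    have mb: "(\<lambda>x. ?b m x) \<in> borel_measurable (time T)" for m by (rule borel_measurable_time) measurable
    have tu: "(LINT x|time T. ?b m x * fourier (u x) n) = (LINT x|lborel. ?b m x * y x)" for m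
      by (rule integral_time_eq_lborel) (auto simp: space_restrict_space y_eq b0 intro!: borel_measurable_times mb mu AE_I2)
    have tf: "(LINT x|time T. ?b 0 x * fourier (f x) n) = (LINT x|lborel. ?b 0 x * g x)"
    proof (rule integral_time_eq_lborel)
      show "AE x in time T. ?b 0 x * fourier (f x) n = ?b 0 x * g x" using g(3) by eventually_elim simp
    qed (auto simp: b0 intro!: borel_measurable_times mb mf)
    have int: "integrable lborel (\<lambda>x. ?b 0 x * h x)" if [measurable]: "h \<in> borel_measurable borel" and bh: "bounded (range h)" for h
    proof -
      obtain K where K: "\<And>x. cmod (h x) \<le> K" using bh by (auto simp: bounded_iff)
      show ?thesis
      proof (rule integrable_bounded_support[of _ 0 T K])
        show "(\<lambda>x. ?b 0 x * h x) \<in> borel_measurable borel" by measurable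
        show "norm (?b 0 x * h x) \<le> K" for x
        proof -
          have "norm (?b 0 x * h x) \<le> 1 * K"
            unfolding norm_mult norm_of_real using bump_range[OF \<eta>, of s t \<epsilon> x] by (intro mult_mono K) auto
          thus ?thesis by simp
        qed
        show "?b 0 x * h x = 0" if "x \<notin> {0..T}" for x using b0[of x 0] that by auto
      qed
    qed
    have "(LINT x|lborel. ?b 1 x * y x) = - (\<i> * of_real (p (of_int n))) * (LINT x|lborel. ?b 0 x * y x)
      + \<i> * of_int n * (LINT x|lborel. ?b 0 x * g x)"
      using solves_bump_test[OF \<eta> \<epsilon>(1,2) st(2) \<epsilon>(3) sol, of n] unfolding tu tf .
    also have "\<dots> = (LINT x|lborel. - (\<i> * of_real (p (of_int n))) * (?b 0 x * y x) + \<i> * of_int n * (?b 0 x * g x))"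
      by (subst Bochner_Integration.integral_add) (intro integrable_mult_right int bdy g; measurable | simp only: integral_mult_right_zero)+
    also have "\<dots> = (LINT x|lborel. ?b 0 x * - ?G x)"
      by (intro Bochner_Integration.integral_cong refl) (simp add: algebra_simps)
    finally show "(LINT x|lborel. ?b 1 x * y x) = (LINT x|lborel. ?b 0 x * - ?G x)" .
  qed
  show ?thesis unfolding is_primitive_def
  proof (intro conjI allI impI)
    show "y \<in> borel_measurable borel" "?G \<in> borel_measurable borel" by measurable
    show "bounded (range y)" "bounded (range ?G)" by (fact bdy bG)+
    fix s t :: real assume st: "0 < s" "s \<le> t" "t < T"
    show "y t - y s = (LINT x:{s..t}|lborel. ?G x)"
    proof (cases "s = t")
      case True
      have "(LINT x|lborel. indicator {t..t} x *\<^sub>R ?G x) = 0"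
        by (rule integral_eq_zero_AE, rule eventually_mono[OF AE_lborel_singleton[of t]]) auto
      thus ?thesis using True by (simp add: set_lebesgue_integral_def)
    next
      case False
      hence "y s - y t = - (LINT x:{s..t}|lborel. ?G x)"
        using main[of s t] st by (simp add: set_lebesgue_integral_def del: minus_diff_eq)
      thus ?thesis by (metis minus_diff_eq minus_minus)
    qed
  qed
qed

section \<open>The bilinear Strichartz estimate\<close>

lemma nn_integral_time_eq_ivl: "(\<integral>\<^sup>+t. f t \<partial>time T) = (\<integral>\<^sup>+t. f t \<partial>ivl 0 T)"
  by (simp add: nn_integral_restrict_space nn_integral_completion)

lemma AE_ivl_iff: "(AE t in ivl 0 T. P t) \<longleftrightarrow> (AE t in time T. P t)"
  by (subst AE_restrict_space_iff) (auto simp: AE_time_iff)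

text \<open>For \<open>u\<close> the coefficients agree at every time of the open interval, for
  \<open>f\<close> only almost everywhere, since a representative was chosen. As
  \<open>freqs\<close> is finite, one null set serves all modes.\<close>

lemma coef_primitive:
  assumes \<eta>: "cutoff \<eta>" and N: "0 < N" and T: "0 < T" and u: "memCTL2 T u" and f: "memLinfTL2 T f"
    and sol: "solves p T u f"
  obtains U G where
    "\<And>n. is_primitive T (\<lambda>t. U t n) (\<lambda>t. \<i> * of_real (p (of_int n)) * U t n - \<i> * of_real (of_int n) * G t n)"
    "\<And>n. (\<lambda>t. G t n) \<in> borel_measurable borel"
    "\<And>t n. t \<in> {0<..<T} \<Longrightarrow> coef \<eta> N (u t) n = U t n"
    "AE t in time T. \<forall>n\<in>freqs \<eta> N. coef \<eta> N (f t) n = G t n"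
proof -
  have "\<forall>n. \<exists>g. g \<in> borel_measurable borel \<and> bounded (range g) \<and> (AE t in time T. fourier (f t) n = g t)"
  proof
    fix n
    show "\<exists>g. g \<in> borel_measurable borel \<and> bounded (range g) \<and> (AE t in time T. fourier (f t) n = g t)"
      by (rule fourier_forcing_representative[OF f, of n]) blast
  qed
  then obtain g where g: "\<And>n. g n \<in> borel_measurable borel" "\<And>n. bounded (range (g n))"
      "\<And>n. AE t in time T. fourier (f t) n = g n t"
    by metis
  define \<phi> where "\<phi> = (\<lambda>n::int. complex_of_real (phi \<eta> N (of_int n)))"
  define y where "y = (\<lambda>t. u (max 0 (min T t)))"
  show thesis
  proof (rule that[of "\<lambda>t n. \<phi> n * fourier (y t) n" "\<lambda>t n. \<phi> n * g n t"])
    fix n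
    have "is_primitive T (\<lambda>t. \<phi> n * fourier (y t) n)
        (\<lambda>t. \<phi> n * (\<i> * of_real (p (of_int n)) * fourier (y t) n - \<i> * of_real (of_int n) * g n t))"
      unfolding y_def by (intro is_primitive_cmult fourier_primitive[OF \<eta> T u f sol g])
    thus "is_primitive T (\<lambda>t. \<phi> n * fourier (y t) n)
        (\<lambda>t. \<i> * of_real (p (of_int n)) * (\<phi> n * fourier (y t) n) - \<i> * of_real (of_int n) * (\<phi> n * g n t))"
      by (simp only: right_diff_distrib mult_ac)
    show "(\<lambda>t. \<phi> n * g n t) \<in> borel_measurable borel" using g(1)[of n] by measurable
  next
    fix t n assume "t \<in> {0<..<T}"
    thus "coef \<eta> N (u t) n = \<phi> n * fourier (y t) n" by (simp add: coef_def \<phi>_def y_def)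
  next
    have "AE t in time T. \<forall>n\<in>freqs \<eta> N. fourier (f t) n = g n t"
      by (intro AE_finite_allI finite_freqs[OF \<eta> N] g(3))
    thus "AE t in time T. \<forall>n\<in>freqs \<eta> N. coef \<eta> N (f t) n = \<phi> n * g n t"
      by eventually_elim (simp add: coef_def \<phi>_def)
  qed
qed

lemma sum_le_L2norm_proj:
  assumes "cutoff \<eta>" "0 < N" "\<And>n. n \<in> freqs \<eta> N \<Longrightarrow> coef \<eta> N v n = w n"
  shows "ennreal (\<Sum>n\<in>freqs \<eta> N. (cmod (w n))\<^sup>2) \<le> (L2norm (proj \<eta> N v))\<^sup>2"
proof -
  have "0 \<le> (\<Sum>n\<in>freqs \<eta> N. (cmod (w n))\<^sup>2)" by (intro sum_nonneg) auto
  hence "1 * (\<Sum>n\<in>freqs \<eta> N. (cmod (w n))\<^sup>2) \<le> 2 * pi * (\<Sum>n\<in>freqs \<eta> N. (cmod (w n))\<^sup>2)"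
    using pi_ge_two by (intro mult_right_mono) auto
  moreover have "(\<Sum>n\<in>freqs \<eta> N. (cmod (coef \<eta> N v n))\<^sup>2) = (\<Sum>n\<in>freqs \<eta> N. (cmod (w n))\<^sup>2)"
    using assms(3) by (intro sum.cong) auto
  ultimately show ?thesis unfolding L2norm_proj[OF assms(1,2)] by (intro ennreal_leI) simp
qed

lemma power2_add_le: "a\<^sup>2 + b\<^sup>2 \<le> (a + b)\<^sup>2" for a b :: ennreal
  by (simp add: power2_sum)

context convex_symbol
begin

text \<open>All norms are squared. In the product of the two sums over input modes the second factor
  is bounded by its essential supremum and only the first is integrated, hence the L^2 norms in time
  for the first pair and the supremum norms for the second.\<close>

lemma bilinear_strichartz:
  fixes a :: "real \<Rightarrow> real \<Rightarrow> complex"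
  assumes \<eta>: "cutoff \<eta>" and \<alpha>: "\<alpha> \<le> 2" and T: "0 < T" "T < 1" and N: "dyadic N1" "dyadic N2"
    and a: "\<And>\<xi>\<^sub>1 \<xi>\<^sub>2. cmod (a \<xi>\<^sub>1 \<xi>\<^sub>2) \<le> A"
    and f: "memLinfTL2 T f1" "memLinfTL2 T f2" and u: "memCTL2 T u1" "memCTL2 T u2"
    and sol: "solves p T u1 f1" "solves p T u2 f2"
  shows "L2TL2norm T (\<lambda>t. Lam a (proj \<eta> N1 (u1 t)) (proj \<eta> N2 (u2 t)))
      \<le> ennreal (sqrt (2 * pi * (6144 * card_const + 3)) * (\<bar>A\<bar> + 1) * T powr (- 1/4) * (max N1 N2) powr (1/2 - \<alpha>/4))
        * (L2TL2norm T (\<lambda>t. proj \<eta> N1 (u1 t)) + L2TL2norm T (\<lambda>t. proj \<eta> N1 (f1 t)))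
        * (LinfTL2norm T (\<lambda>t. proj \<eta> N2 (u2 t)) + LinfTL2norm T (\<lambda>t. proj \<eta> N2 (f2 t)))"
proof -
  define N where "N = max N1 N2"
  obtain l1 l2 where l: "N1 = 2 ^ l1" "N2 = 2 ^ l2" using N by (auto simp: dyadic_def)
  have Npos: "0 < N1" "0 < N2" by (simp_all add: l)
  \<comment> \<open>Dyadic numbers are integers, so N can serve as the number of time
    pieces.\<close>
  define n0 :: nat where "n0 = max (2 ^ l1) (2 ^ l2)"
  have n0: "real n0 = N" "1 \<le> n0" by (auto simp: n0_def N_def l of_nat_max le_max_iff_disj)
  have N1: "1 \<le> N" using n0 by (metis of_nat_1 of_nat_le_iff)
  define Q where "Q = T powr (- 1/2) * N powr (1 - \<alpha>/2)"
  have Q: "1 \<le> Q" "Q\<^sup>2 = N powr (2 - \<alpha>) / T"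
  proof -
    have "1 powr (- 1/2) \<le> T powr (- 1/2)" using T by (intro powr_mono2') auto
    moreover have "1 \<le> N powr (1 - \<alpha>/2)" using N1 \<alpha> by (intro ge_one_powr_ge_zero) auto
    ultimately show "1 \<le> Q" unfolding Q_def using mult_mono[of 1 "T powr (- 1/2)" 1 "N powr (1 - \<alpha>/2)"] by simp
    have "T powr (- 1/2) * T powr (- 1/2) = 1 / T"
      using T by (simp add: powr_add[symmetric] powr_minus_divide)
    moreover have "N powr (1 - \<alpha>/2) * N powr (1 - \<alpha>/2) = N powr (2 - \<alpha>)"
      by (simp add: powr_add[symmetric])
    ultimately have "(T powr (- 1/2) * T powr (- 1/2)) * (N powr (1 - \<alpha>/2) * N powr (1 - \<alpha>/2)) = 1 / T * N powr (2 - \<alpha>)"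
      by simp
    thus "Q\<^sup>2 = N powr (2 - \<alpha>) / T" by (simp add: Q_def power2_eq_square mult_ac)
  qed
  \<comment> \<open>The square of K carries exactly one power of Q. Taking |A| + 1 keeps the
    constant positive even for A = 0.\<close>
  define K where "K = sqrt (2 * pi * (6144 * card_const + 3)) * (\<bar>A\<bar> + 1) * T powr (- 1/4) * N powr (1/2 - \<alpha>/4)"
  have K: "0 \<le> K" "2 * pi * ((6144 * card_const + 3) * A\<^sup>2 * Q) \<le> K\<^sup>2"
  proof -
    show "0 \<le> K" using card_const_pos by (simp add: K_def)
    have "(T powr (- 1/4))\<^sup>2 = T powr (- 1/2)" "(N powr (1/2 - \<alpha>/4))\<^sup>2 = N powr (1 - \<alpha>/2)"
      by (simp_all add: power2_eq_square powr_add[symmetric])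
    hence K2: "K\<^sup>2 = 2 * pi * (6144 * card_const + 3) * (\<bar>A\<bar> + 1)\<^sup>2 * Q"
      using card_const_pos by (simp add: K_def Q_def power_mult_distrib mult_ac)
    have "\<bar>A\<bar>\<^sup>2 \<le> (\<bar>A\<bar> + 1)\<^sup>2" by (intro power_mono) auto
    hence "2 * pi * (6144 * card_const + 3) * A\<^sup>2 * Q \<le> 2 * pi * (6144 * card_const + 3) * (\<bar>A\<bar> + 1)\<^sup>2 * Q"
      using card_const_pos Q by (intro mult_right_mono mult_left_mono) auto
    thus "2 * pi * ((6144 * card_const + 3) * A\<^sup>2 * Q) \<le> K\<^sup>2" unfolding K2 by (simp only: mult.assoc)
  qed
  let ?Z1 = "freqs \<eta> N1" and ?Z2 = "freqs \<eta> N2"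
  let ?X = "(\<lambda>(m, n). m + n) ` (?Z1 \<times> ?Z2)"
  have fin: "finite ?Z1" "finite ?Z2" using finite_freqs[OF \<eta>] Npos by auto
  obtain U1 G1 where
    1: "\<And>n. is_primitive T (\<lambda>t. U1 t n) (\<lambda>t. \<i> * of_real (p (of_int n)) * U1 t n - \<i> * of_real (of_int n) * G1 t n)"
      "\<And>n. (\<lambda>t. G1 t n) \<in> borel_measurable borel"
      "\<And>t n. t \<in> {0<..<T} \<Longrightarrow> coef \<eta> N1 (u1 t) n = U1 t n"
      "AE t in time T. \<forall>n\<in>?Z1. coef \<eta> N1 (f1 t) n = G1 t n"
    by (rule coef_primitive[OF \<eta> Npos(1) T(1) u(1) f(1) sol(1)]) (rule that; assumption)
  obtain U2 G2 where
    2: "\<And>n. is_primitive T (\<lambda>t. U2 t n) (\<lambda>t. \<i> * of_real (p (of_int n)) * U2 t n - \<i> * of_real (of_int n) * G2 t n)"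
      "\<And>n. (\<lambda>t. G2 t n) \<in> borel_measurable borel"
      "\<And>t n. t \<in> {0<..<T} \<Longrightarrow> coef \<eta> N2 (u2 t) n = U2 t n"
      "AE t in time T. \<forall>n\<in>?Z2. coef \<eta> N2 (f2 t) n = G2 t n"
    by (rule coef_primitive[OF \<eta> Npos(2) T(1) u(2) f(2) sol(2)]) (rule that; assumption)
  have mU: "(\<lambda>t. U1 t n) \<in> borel_measurable borel" "(\<lambda>t. U2 t n) \<in> borel_measurable borel" for n
    using 1(1)[of n] 2(1)[of n] by (simp_all add: is_primitive_def)
  note [measurable] = mU 1(2) 2(2)
  let ?u1 = "\<lambda>t. \<Sum>n\<in>?Z1. (cmod (U1 t n))\<^sup>2" and ?g1 = "\<lambda>t. \<Sum>n\<in>?Z1. (cmod (G1 t n))\<^sup>2"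
  let ?u2 = "\<lambda>t. \<Sum>n\<in>?Z2. (cmod (U2 t n))\<^sup>2" and ?g2 = "\<lambda>t. \<Sum>n\<in>?Z2. (cmod (G2 t n))\<^sup>2"
  let ?F = "\<lambda>t. \<Sum>\<xi>\<in>?X. (cmod (\<Sum>n | n \<in> ?Z1 \<and> \<xi> - n \<in> ?Z2. a (of_int n) (of_int (\<xi> - n)) * U1 t n * U2 t (\<xi> - n)))\<^sup>2"
  let ?X1 = "L2TL2norm T (\<lambda>t. proj \<eta> N1 (u1 t))" and ?Y1 = "L2TL2norm T (\<lambda>t. proj \<eta> N1 (f1 t))"
  let ?X2 = "LinfTL2norm T (\<lambda>t. proj \<eta> N2 (u2 t))" and ?Y2 = "LinfTL2norm T (\<lambda>t. proj \<eta> N2 (f2 t))"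
  let ?k = "?X2\<^sup>2 + ?Y2\<^sup>2"
  have nonneg: "0 \<le> ?u1 t" "0 \<le> ?g1 t" "0 \<le> ?u2 t" "0 \<le> ?g2 t" "0 \<le> ?F t" for t
    by (auto intro!: sum_nonneg)
  have core: "(\<integral>\<^sup>+t. ennreal (?F t) \<partial>ivl 0 T) \<le> ennreal ((6144 * card_const + 3) * A\<^sup>2 * Q) *
      (\<integral>\<^sup>+t. ennreal ((\<Sum>n\<in>?Z1. (cmod (U1 t n))\<^sup>2 + (cmod (G1 t n))\<^sup>2) * (\<Sum>n\<in>?Z2. (cmod (U2 t n))\<^sup>2 + (cmod (G2 t n))\<^sup>2)) \<partial>ivl 0 T)"
  proof (rule bilinear_estimate[where ?n0.0 = n0, OF n0(2) T Q(1), unfolded n0(1), OF Q(2) fin])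
    show "finite ?X" using fin by simp
    show "\<bar>real_of_int n\<bar> \<le> 2 * N" if "n \<in> ?Z1" for n
      using freqs_bounds(2)[OF \<eta> Npos(1) that] by (simp add: N_def)
    show "\<bar>real_of_int n\<bar> \<le> 2 * N" if "n \<in> ?Z2" for n
      using freqs_bounds(2)[OF \<eta> Npos(2) that] by (simp add: N_def)
    show "N / 2 \<le> max \<bar>real_of_int m\<bar> \<bar>real_of_int n\<bar>" if "m \<in> ?Z1" "n \<in> ?Z2" for m n
      using freqs_bounds(1)[OF \<eta> Npos(1) that(1)] freqs_bounds(1)[OF \<eta> Npos(2) that(2)] by (auto simp: N_def max_def)
  qed (use 1 2 a in auto)
  have AE2: "AE t in ivl 0 T. ennreal (?u2 t + ?g2 t) \<le> ?k"
  proof -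
    have "AE t in time T. L2norm (proj \<eta> N2 (u2 t)) \<le> ?X2" "AE t in time T. L2norm (proj \<eta> N2 (f2 t)) \<le> ?Y2"
      unfolding LinfTL2norm_def by (rule esssup_AE)+
    moreover have "AE t in time T. t \<in> {0<..<T}" by (rule AE_I2) (simp add: space_restrict_space)
    ultimately have "AE t in time T. ennreal (?u2 t + ?g2 t) \<le> ?k"
      using 2(4)
    proof eventually_elim
      case (elim t)
      have "ennreal (?u2 t + ?g2 t) = ennreal (?u2 t) + ennreal (?g2 t)" by (rule ennreal_plus) (rule nonneg)+
      also have "\<dots> \<le> (L2norm (proj \<eta> N2 (u2 t)))\<^sup>2 + (L2norm (proj \<eta> N2 (f2 t)))\<^sup>2"
        by (intro add_mono sum_le_L2norm_proj \<eta> Npos) (use elim 2(3) in auto)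
      also have "\<dots> \<le> ?k" by (intro add_mono power_mono elim) auto
      finally show ?case .
    qed
    thus ?thesis by (simp only: AE_ivl_iff)
  qed
  have int1: "(\<integral>\<^sup>+t. ennreal (?u1 t + ?g1 t) \<partial>ivl 0 T) \<le> ?X1\<^sup>2 + ?Y1\<^sup>2"
  proof -
    have "(\<integral>\<^sup>+t. ennreal (?u1 t + ?g1 t) \<partial>ivl 0 T) = (\<integral>\<^sup>+t. ennreal (?u1 t) + ennreal (?g1 t) \<partial>ivl 0 T)"
      by (intro nn_integral_cong ennreal_plus nonneg)
    also have "\<dots> = (\<integral>\<^sup>+t. ennreal (?u1 t) \<partial>ivl 0 T) + (\<integral>\<^sup>+t. ennreal (?g1 t) \<partial>ivl 0 T)"
      by (intro nn_integral_add borel_measurable_ivl) measurable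
    also have "\<dots> \<le> (\<integral>\<^sup>+t. (L2norm (proj \<eta> N1 (u1 t)))\<^sup>2 \<partial>time T) + (\<integral>\<^sup>+t. (L2norm (proj \<eta> N1 (f1 t)))\<^sup>2 \<partial>time T)"
      unfolding nn_integral_time_eq_ivl[symmetric]
    proof (intro add_mono)
      show "(\<integral>\<^sup>+t. ennreal (?u1 t) \<partial>time T) \<le> (\<integral>\<^sup>+t. (L2norm (proj \<eta> N1 (u1 t)))\<^sup>2 \<partial>time T)"
        by (intro nn_integral_mono sum_le_L2norm_proj \<eta> Npos 1(3)) (simp add: space_restrict_space)
      have "AE t in time T. ennreal (?g1 t) \<le> (L2norm (proj \<eta> N1 (f1 t)))\<^sup>2"
        using 1(4) by eventually_elim (intro sum_le_L2norm_proj \<eta> Npos, simp)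
      thus "(\<integral>\<^sup>+t. ennreal (?g1 t) \<partial>time T) \<le> (\<integral>\<^sup>+t. (L2norm (proj \<eta> N1 (f1 t)))\<^sup>2 \<partial>time T)"
        by (rule nn_integral_mono_AE)
    qed
    finally show ?thesis by (simp only: L2TL2norm_def ennsqrt_power2)
  qed
  have "(L2TL2norm T (\<lambda>t. Lam a (proj \<eta> N1 (u1 t)) (proj \<eta> N2 (u2 t))))\<^sup>2
      = (\<integral>\<^sup>+t. (L2norm (Lam a (proj \<eta> N1 (u1 t)) (proj \<eta> N2 (u2 t))))\<^sup>2 \<partial>time T)"
    by (simp only: L2TL2norm_def ennsqrt_power2)
  also have "\<dots> = (\<integral>\<^sup>+t. ennreal (2 * pi) * ennreal (?F t) \<partial>time T)"
  proof (rule nn_integral_cong)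
    fix t assume "t \<in> space (time T)"
    hence t: "t \<in> {0<..<T}" by (simp add: space_restrict_space)
    show "(L2norm (Lam a (proj \<eta> N1 (u1 t)) (proj \<eta> N2 (u2 t))))\<^sup>2 = ennreal (2 * pi) * ennreal (?F t)"
      unfolding L2norm_Lam_proj[OF \<eta> Npos] 1(3)[OF t] 2(3)[OF t] using nonneg(5)[of t]
      by (subst ennreal_mult') auto
  qed
  also have "\<dots> = ennreal (2 * pi) * (\<integral>\<^sup>+t. ennreal (?F t) \<partial>ivl 0 T)"
    unfolding nn_integral_time_eq_ivl by (intro nn_integral_cmult borel_measurable_ivl) measurable
  also have "\<dots> \<le> ennreal (2 * pi) * (ennreal ((6144 * card_const + 3) * A\<^sup>2 * Q) * (?k * (?X1\<^sup>2 + ?Y1\<^sup>2)))"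
  proof (intro mult_left_mono order_trans[OF core])
    have "(\<integral>\<^sup>+t. ennreal ((\<Sum>n\<in>?Z1. (cmod (U1 t n))\<^sup>2 + (cmod (G1 t n))\<^sup>2) * (\<Sum>n\<in>?Z2. (cmod (U2 t n))\<^sup>2 + (cmod (G2 t n))\<^sup>2)) \<partial>ivl 0 T)
      \<le> (\<integral>\<^sup>+t. ?k * ennreal (?u1 t + ?g1 t) \<partial>ivl 0 T)"
      using AE2
    proof (intro nn_integral_mono_AE, eventually_elim)
      case (elim t)
      have "ennreal ((?u1 t + ?g1 t) * (?u2 t + ?g2 t)) = ennreal (?u1 t + ?g1 t) * ennreal (?u2 t + ?g2 t)"
        by (intro ennreal_mult add_nonneg_nonneg nonneg)
      also have "\<dots> \<le> ennreal (?u1 t + ?g1 t) * ?k" by (intro mult_left_mono elim) auto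
      finally show ?case by (simp only: sum.distrib mult.commute)
    qed
    also have "\<dots> = ?k * (\<integral>\<^sup>+t. ennreal (?u1 t + ?g1 t) \<partial>ivl 0 T)"
      by (intro nn_integral_cmult borel_measurable_ivl) measurable
    also have "\<dots> \<le> ?k * (?X1\<^sup>2 + ?Y1\<^sup>2)" by (intro mult_left_mono int1) auto
    finally show "(\<integral>\<^sup>+t. ennreal ((\<Sum>n\<in>?Z1. (cmod (U1 t n))\<^sup>2 + (cmod (G1 t n))\<^sup>2) * (\<Sum>n\<in>?Z2. (cmod (U2 t n))\<^sup>2 + (cmod (G2 t n))\<^sup>2)) \<partial>ivl 0 T)
      \<le> ?k * (?X1\<^sup>2 + ?Y1\<^sup>2)" .
  qed auto
  also have "\<dots> = ennreal (2 * pi * ((6144 * card_const + 3) * A\<^sup>2 * Q)) * (?k * (?X1\<^sup>2 + ?Y1\<^sup>2))"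
    by (subst ennreal_mult') (simp_all only: mult.assoc pi_ge_zero zero_le_mult_iff zero_le_numeral simp_thms)
  also have "\<dots> \<le> ennreal (K\<^sup>2) * ((?X2 + ?Y2)\<^sup>2 * (?X1 + ?Y1)\<^sup>2)"
    by (intro mult_mono ennreal_leI K power2_add_le) auto
  also have "\<dots> = (ennreal K * (?X1 + ?Y1) * (?X2 + ?Y2))\<^sup>2"
    using K(1) by (simp only: ennreal_power[symmetric] power_mult_distrib mult_ac)
  finally have "(L2TL2norm T (\<lambda>t. Lam a (proj \<eta> N1 (u1 t)) (proj \<eta> N2 (u2 t))))\<^sup>2
      \<le> (ennreal K * (?X1 + ?Y1) * (?X2 + ?Y2))\<^sup>2" .
  from ennsqrt_mono[OF this] show ?thesis by (simp only: ennsqrt_of_power2 K_def N_def)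
qed

end

theorem proposition3p1:
  fixes \<eta> p :: "real \<Rightarrow> real" and \<alpha> A :: real
  assumes "cutoff \<eta>"
    and "1 \<le> \<alpha>" and "\<alpha> \<le> 2"
    and "dispersive_symbol \<alpha> p"
  shows "\<exists>C::real. 0 < C \<and>
    (\<forall>(T::real) (N1::real) (N2::real) (a :: real \<Rightarrow> real \<Rightarrow> complex)
      (u1 :: real \<Rightarrow> real \<Rightarrow> complex) (u2 :: real \<Rightarrow> real \<Rightarrow> complex)
      (f1 :: real \<Rightarrow> real \<Rightarrow> complex) (f2 :: real \<Rightarrow> real \<Rightarrow> complex).
      0 < T \<longrightarrow> T < 1 \<longrightarrow> dyadic N1 \<longrightarrow> dyadic N2 \<longrightarrow>
      (\<forall>\<xi>\<^sub>1 \<xi>\<^sub>2. cmod (a \<xi>\<^sub>1 \<xi>\<^sub>2) \<le> A) \<longrightarrow>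
      memLinfTL2 T f1 \<longrightarrow> memLinfTL2 T f2 \<longrightarrow>
      memCTL2 T u1 \<longrightarrow> memCTL2 T u2 \<longrightarrow>
      solves p T u1 f1 \<longrightarrow> solves p T u2 f2 \<longrightarrow>
      L2TL2norm T (\<lambda>t. Lam a (proj \<eta> N1 (u1 t)) (proj \<eta> N2 (u2 t)))
      \<le> ennreal (C * T powr (- 1/4) * (max N1 N2) powr (1/2 - \<alpha>/4))
        * (L2TL2norm T (\<lambda>t. proj \<eta> N1 (u1 t)) + L2TL2norm T (\<lambda>t. proj \<eta> N1 (f1 t)))
        * (LinfTL2norm T (\<lambda>t. proj \<eta> N2 (u2 t)) + LinfTL2norm T (\<lambda>t. proj \<eta> N2 (f2 t))))"
proof -
  obtain \<xi>\<^sub>0 c where c: "0 < \<xi>\<^sub>0" "0 < c" "\<And>\<xi>. \<xi>\<^sub>0 \<le> \<xi> \<Longrightarrow> c * \<xi> powr (\<alpha> - 1) \<le> deriv (deriv p) \<xi>"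
    using assms(4) unfolding dispersive_symbol_def comparable_on_def by fastforce
  interpret convex_symbol p "deriv p" "deriv (deriv p)" \<alpha> c \<xi>\<^sub>0
    using assms(2,4) c by unfold_locales (auto simp: dispersive_symbol_def DERIV_deriv_iff_real_differentiable)
  let ?C = "sqrt (2 * pi * (6144 * card_const + 3)) * (\<bar>A\<bar> + 1)"
  show ?thesis
  proof (intro exI[of _ ?C] conjI allI impI)
    show "0 < ?C" using card_const_pos by (intro mult_pos_pos) (auto intro!: mult_pos_pos add_pos_pos)
  qed (rule bilinear_strichartz[OF assms(1,3)]; blast)
qed

end
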